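(* Let $m \in \mathbb{R}$ with $m \neq 0$ and $m \neq -2$, let $\lambda \in \mathbb{R}$, let $(M,g)$ be a closed (i.e. compact and without boundary), connected smooth Riemannian manifold, and let $X$ be a smooth vector field on $M$ such that $$\mathrm{Ric} + \frac{1}{2}\mathcal{L}_X g - \frac{1}{m} X^* \otimes X^* = \lambda g$$ on $M$. Then $(M,g)$ has constant scalar curvature if and only if $X$ is a Killing field.
   Context: Here $\mathrm{Ric}$ is the Ricci tensor of $g$, $\mathcal{L}_X g$ is the Lie derivative of the metric along $X$, and $X^* = g(X,\cdot)$ is the 1-form dual to $X$. The vector field $X$ is Killing if $\mathcal{L}_X g = 0$. The scalar curvature is the trace of $\mathrm{Ric}$ with respect to $g$. A triple $(M,g,X)$ satisfying the displayed equation is said to satisfy the $m$-quasi-Einstein equation. *)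

theory Defs
  imports "HOL-Analysis.Analysis"
begin

section \<open>Smooth maps between open subsets of Euclidean spaces\<close>

text \<open>These notions are used for open sets only, so derivatives are taken at a point and not
  within the set.\<close>

primrec Ck_on :: "nat \<Rightarrow> ('a::real_normed_vector \<Rightarrow> 'b::real_normed_vector) \<Rightarrow> 'a set \<Rightarrow> bool"
where
  "Ck_on 0 f S \<longleftrightarrow> continuous_on S f"
| "Ck_on (Suc k) f S \<longleftrightarrow>
     (\<forall>x\<in>S. f differentiable (at x)) \<and>
     (\<forall>v. Ck_on k (\<lambda>x. frechet_derivative f (at x) v) S)"

definition smooth_on :: "('a::real_normed_vector \<Rightarrow> 'b::real_normed_vector) \<Rightarrow> 'a set \<Rightarrow> bool"
  where "smooth_on f S \<longleftrightarrow> (\<forall>k. Ck_on k f S)"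

definition partial_deriv :: "'n \<Rightarrow> (real^'n \<Rightarrow> real) \<Rightarrow> real^'n \<Rightarrow> real"
  where "partial_deriv i f x = frechet_derivative f (at x) (axis i 1)"


section \<open>Smooth manifolds\<close>

text \<open>A chart is a pair of its domain and its coordinate map; the values of the coordinate map
  outside the domain are irrelevant.\<close>

type_synonym ('a, 'n) chart = "'a set \<times> ('a \<Rightarrow> (real, 'n) vec)"

abbreviation chart_dom :: "('a, 'n::finite) chart \<Rightarrow> 'a set"
  where "chart_dom c \<equiv> fst c"

abbreviation chart_map :: "('a, 'n::finite) chart \<Rightarrow> 'a \<Rightarrow> real^'n"
  where "chart_map c \<equiv> snd c"

definition chart_image :: "('a, 'n::finite) chart \<Rightarrow> (real^'n) set"
  where "chart_image c = chart_map c ` chart_dom c"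

definition chart_on :: "'a topology \<Rightarrow> ('a, 'n::finite) chart \<Rightarrow> bool"
  where "chart_on M c \<longleftrightarrow>
    openin M (chart_dom c) \<and> open (chart_image c) \<and>
    homeomorphic_map (subtopology M (chart_dom c)) (top_of_set (chart_image c)) (chart_map c)"

definition transition :: "('a, 'n::finite) chart \<Rightarrow> ('a, 'n) chart \<Rightarrow> real^'n \<Rightarrow> real^'n"
  where "transition c d x = chart_map d (inv_into (chart_dom c) (chart_map c) x)"

definition overlap :: "('a, 'n::finite) chart \<Rightarrow> ('a, 'n) chart \<Rightarrow> (real^'n) set"
  where "overlap c d = chart_map c ` (chart_dom c \<inter> chart_dom d)"

text \<open>All charts take values in open subsets of \<open>real^'n\<close>, so these manifolds have no boundary;
  their dimension is \<open>CARD('n)\<close>. The atlas need not be maximal.\<close>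

definition smooth_manifold :: "'a topology \<Rightarrow> ('a, 'n::finite) chart set \<Rightarrow> bool"
  where "smooth_manifold M A \<longleftrightarrow>
    Hausdorff_space M \<and> second_countable M \<and>
    (\<forall>c\<in>A. chart_on M c) \<and> (\<Union>c\<in>A. chart_dom c) = topspace M \<and>
    (\<forall>c\<in>A. \<forall>d\<in>A. smooth_on (transition c d) (overlap c d))"

abbreviation jacobian :: "('a, 'n::finite) chart \<Rightarrow> ('a, 'n) chart \<Rightarrow> real^'n \<Rightarrow> real^'n^'n"
  where "jacobian c d x \<equiv> matrix (frechet_derivative (transition c d) (at x))"


section \<open>Vector fields and Riemannian metrics\<close>

text \<open>A tensor field is given by its components in each chart of the atlas, as functions of the
  coordinates, subject to the transformation law on overlaps. Covariant 2-tensors are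
  matrix-valued: the entry \<open>i\<close>, \<open>j\<close> is the value on the coordinate vector fields
  \<open>\<partial>\<^sub>i\<close>, \<open>\<partial>\<^sub>j\<close>.\<close>

definition vector_field ::
    "('a, 'n::finite) chart set \<Rightarrow> (('a, 'n) chart \<Rightarrow> real^'n \<Rightarrow> real^'n) \<Rightarrow> bool"
  where "vector_field A X \<longleftrightarrow>
    (\<forall>c\<in>A. smooth_on (X c) (chart_image c)) \<and>
    (\<forall>c\<in>A. \<forall>d\<in>A. \<forall>x\<in>overlap c d. X d (transition c d x) = jacobian c d x *v X c x)"

definition riemannian_metric ::
    "('a, 'n::finite) chart set \<Rightarrow> (('a, 'n) chart \<Rightarrow> real^'n \<Rightarrow> real^'n^'n) \<Rightarrow> bool"
  where "riemannian_metric A g \<longleftrightarrow>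
    (\<forall>c\<in>A. smooth_on (g c) (chart_image c)) \<and>
    (\<forall>c\<in>A. \<forall>x\<in>chart_image c.
       transpose (g c x) = g c x \<and> (\<forall>v. v \<noteq> 0 \<longrightarrow> v \<bullet> (g c x *v v) > 0)) \<and>
    (\<forall>c\<in>A. \<forall>d\<in>A. \<forall>x\<in>overlap c d.
       g c x = transpose (jacobian c d x) ** g d (transition c d x) ** jacobian c d x)"


section \<open>Curvature and Lie derivative in a chart\<close>

text \<open>In this section \<open>G\<close> and \<open>V\<close> are the components of a metric and of a vector field in a
  single chart.\<close>

text \<open>\<open>christoffel G k i j\<close> is the symbol \<open>\<Gamma>\<close> with upper index \<open>k\<close> and lower indices
  \<open>i\<close>, \<open>j\<close> of the Levi-Civita connection.\<close>

definition christoffel :: "(real^'n \<Rightarrow> real^'n^'n) \<Rightarrow> 'n::finite \<Rightarrow> 'n \<Rightarrow> 'n \<Rightarrow> real^'n \<Rightarrow> real"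
  where "christoffel G k i j x =
    (1/2) * (\<Sum>l\<in>UNIV. matrix_inv (G x) $ k $ l *
      (partial_deriv i (\<lambda>y. G y $ j $ l) x + partial_deriv j (\<lambda>y. G y $ i $ l) x
       - partial_deriv l (\<lambda>y. G y $ i $ j) x))"

text \<open>\<open>riemann G l i j k\<close> is the component along \<open>\<partial>\<^sub>l\<close> of \<open>R(\<partial>\<^sub>i, \<partial>\<^sub>j)\<partial>\<^sub>k\<close>, where
  \<open>R(X, Y)Z = \<nabla>\<^sub>X \<nabla>\<^sub>Y Z - \<nabla>\<^sub>Y \<nabla>\<^sub>X Z - \<nabla>\<^bsub>[X,Y]\<^esub> Z\<close>.\<close>

definition riemann ::
    "(real^'n \<Rightarrow> real^'n^'n) \<Rightarrow> 'n::finite \<Rightarrow> 'n \<Rightarrow> 'n \<Rightarrow> 'n \<Rightarrow> real^'n \<Rightarrow> real"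
  where "riemann G l i j k x =
    partial_deriv i (christoffel G l j k) x - partial_deriv j (christoffel G l i k) x
    + (\<Sum>p\<in>UNIV. christoffel G l i p x * christoffel G p j k x
                - christoffel G l j p x * christoffel G p i k x)"

text \<open>\<open>Ric(Y, Z)\<close> is the trace of \<open>W \<longmapsto> R(W, Y)Z\<close>, so that round spheres have positive Ricci
  curvature.\<close>

definition ricci :: "(real^'n \<Rightarrow> real^'n^'n) \<Rightarrow> real^'n::finite \<Rightarrow> real^'n^'n"
  where "ricci G x = (\<chi> j k. \<Sum>i\<in>UNIV. riemann G i i j k x)"

definition scalar_curvature :: "(real^'n \<Rightarrow> real^'n^'n) \<Rightarrow> real^'n::finite \<Rightarrow> real"
  where "scalar_curvature G x = (\<Sum>i\<in>UNIV. \<Sum>j\<in>UNIV. matrix_inv (G x) $ i $ j * ricci G x $ i $ j)"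

text \<open>This is \<open>(\<L>\<^sub>X g)(Y, Z) = X (g(Y, Z)) - g([X, Y], Z) - g(Y, [X, Z])\<close> for \<open>Y = \<partial>\<^sub>i\<close>,
  \<open>Z = \<partial>\<^sub>j\<close>.\<close>

definition lie_deriv_metric ::
    "(real^'n \<Rightarrow> real^'n) \<Rightarrow> (real^'n \<Rightarrow> real^'n^'n) \<Rightarrow> real^'n::finite \<Rightarrow> real^'n^'n"
  where "lie_deriv_metric V G x = (\<chi> i j. \<Sum>k\<in>UNIV.
    V x $ k * partial_deriv k (\<lambda>y. G y $ i $ j) x
    + G x $ k $ j * partial_deriv i (\<lambda>y. V y $ k) x
    + G x $ i $ k * partial_deriv j (\<lambda>y. V y $ k) x)"

definition dual_form ::
    "(real^'n \<Rightarrow> real^'n^'n) \<Rightarrow> (real^'n \<Rightarrow> real^'n) \<Rightarrow> real^'n::finite \<Rightarrow> real^'n"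
  where "dual_form G V x = (\<chi> j. \<Sum>i\<in>UNIV. G x $ i $ j * V x $ i)"

definition tensor_product :: "real^'n \<Rightarrow> real^'n \<Rightarrow> real^'n::finite^'n"
  where "tensor_product a b = (\<chi> i j. a $ i * b $ j)"


section \<open>Global notions\<close>

definition constant_scalar_curvature ::
    "('a, 'n::finite) chart set \<Rightarrow> (('a, 'n) chart \<Rightarrow> real^'n \<Rightarrow> real^'n^'n) \<Rightarrow> bool"
  where "constant_scalar_curvature A g \<longleftrightarrow>
    (\<exists>\<kappa>. \<forall>c\<in>A. \<forall>x\<in>chart_image c. scalar_curvature (g c) x = \<kappa>)"

definition killing_field ::
    "('a, 'n::finite) chart set \<Rightarrow> (('a, 'n) chart \<Rightarrow> real^'n \<Rightarrow> real^'n^'n) \<Rightarrow>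
     (('a, 'n) chart \<Rightarrow> real^'n \<Rightarrow> real^'n) \<Rightarrow> bool"
  where "killing_field A g X \<longleftrightarrow>
    (\<forall>c\<in>A. \<forall>x\<in>chart_image c. lie_deriv_metric (X c) (g c) x = 0)"

definition quasi_einstein ::
    "real \<Rightarrow> real \<Rightarrow> ('a, 'n::finite) chart set \<Rightarrow>
     (('a, 'n) chart \<Rightarrow> real^'n \<Rightarrow> real^'n^'n) \<Rightarrow> (('a, 'n) chart \<Rightarrow> real^'n \<Rightarrow> real^'n) \<Rightarrow> bool"
  where "quasi_einstein m lam A g X \<longleftrightarrow>
    (\<forall>c\<in>A. \<forall>x\<in>chart_image c.
       ricci (g c) x + (1/2) *\<^sub>R lie_deriv_metric (X c) (g c) x
       - (1/m) *\<^sub>R tensor_product (dual_form (g c) (X c) x) (dual_form (g c) (X c) x)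
       = lam *\<^sub>R g c x)"

end

theory Submission
  imports Defs
begin

text \<open>Put \<open>L = \<L>\<^sub>X g\<close>. Tracing the equation gives \<open>R + div X - |X|\<^sup>2/m = n \<lambda>\<close>, and taking its divergence,
  with the contracted Bianchi identity \<open>2 div Ric = dR\<close>, gives a second relation.
  If \<open>R = \<kappa>\<close> is constant, the two combine to
  \<open>|L|\<^sup>2/4 + (div X)\<^sup>2/2 = div Z\<close> for
  \<open>Z = L(X)/2 - (|X|\<^sup>2/m + \<kappa> - n \<lambda>) X/2\<close>, whose integral over the closed manifold vanishes, so \<open>L = 0\<close>.
  If \<open>L = 0\<close>, they give \<open>dR = d|X|\<^sup>2/m\<close> and \<open>dR = -d|X|\<^sup>2/m\<close>, so \<open>R\<close> is locally constant.

  The divergence theorem is needed only in the form that \<open>div Z \<ge> 0\<close> implies \<open>div Z = 0\<close>. For a partition of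
  unity \<open>\<phi>\<^sub>j\<close>, each \<open>div (\<phi>\<^sub>j Z)\<close> integrates to zero in a single chart, and
  \<open>\<Sum>\<^sub>j \<integral> Z(\<phi>\<^sub>j) = \<Sum>\<^sub>i \<integral> \<phi>\<^sub>i Z(\<Sum>\<^sub>j \<phi>\<^sub>j) = 0\<close> by change of variables on the overlaps.\<close>

section \<open>Calculus in coordinates\<close>

text \<open>In div Z the derivative of |X|^2 enters twice with opposite signs: from the part X*
  \<otimes> X* / m of Ric and from the coefficient of X in Z. This cancellation fixes the
  coefficient |X|^2/(2m), and what remains is a sum of squares whatever the sign of m.

  Charts carry components only, so passing between them needs care. Z is therefore written through
  L(X), |X|^2 and X; here L(X) is the Lie derivative of X* along X, in which the second derivatives
  of a transition map cancel. In the converse direction the traced equation expresses R through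
  |X|^2, so the scalar curvatures of different charts are compared through this function on M.

  Inside a chart, connection and curvature are matrices indexed by the directions of
  differentiation. Metric compatibility, the skew-symmetry of the curvature and the second Bianchi
  identity become identities between noncommuting matrices, proved before any index is
  contracted.\<close>

lemma has_derivative_imp_frechet:
  "(f has_derivative f') (at x) \<Longrightarrow> frechet_derivative f (at x) v = f' v"
  using frechet_derivative_at by metis

section \<open>Closure properties of C^k functions on open sets\<close>

lemma Ck_on_cong:
  assumes "open S" "\<And>x. x \<in> S \<Longrightarrow> f x = g x" "Ck_on k f S"
  shows "Ck_on k g S"
  using assms(2,3)
proof (induction k arbitrary: f g)
  case 0
  then show ?case by (auto intro: continuous_on_eq)
next
  case (Suc k)
  have D: "(g has_derivative frechet_derivative f (at x)) (at x)" if "x \<in> S" for x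
  proof (rule has_derivative_transform_within_open[OF _ \<open>open S\<close> that])
    show "(f has_derivative frechet_derivative f (at x)) (at x)"
      using Suc.prems(2) that frechet_derivative_works by auto
  qed (use Suc.prems(1) in auto)
  have "Ck_on k (\<lambda>x. frechet_derivative g (at x) v) S" for v
  proof (rule Suc.IH[of "\<lambda>x. frechet_derivative f (at x) v"])
    show "frechet_derivative f (at x) v = frechet_derivative g (at x) v" if "x \<in> S" for x
      using has_derivative_imp_frechet[OF D[OF that]] by simp
  qed (use Suc.prems(2) in auto)
  with D show ?case by (auto simp: differentiable_def)
qed

text \<open>\<open>Ck_on\<close> speaks of the choice-based \<open>frechet_derivative\<close>; this
  rule accepts any explicit derivative instead. The closure proofs below use it to name the
  derivative that the calculus rule at hand produces.\<close>

lemma Ck_on_SucI: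
  assumes "open S" "\<And>x. x \<in> S \<Longrightarrow> (f has_derivative f' x) (at x)"
    and "\<And>v. Ck_on k (\<lambda>x. f' x v) S"
  shows "Ck_on (Suc k) f S"
proof -
  have "Ck_on k (\<lambda>x. frechet_derivative f (at x) v) S" for v
    by (rule Ck_on_cong[OF assms(1) _ assms(3)[of v]])
       (simp add: has_derivative_imp_frechet[OF assms(2)])
  then show ?thesis using assms(2) by (auto simp: differentiable_def)
qed

lemma Ck_on_has_derivative:
  "Ck_on (Suc k) f S \<Longrightarrow> x \<in> S \<Longrightarrow> (f has_derivative frechet_derivative f (at x)) (at x)"
  using frechet_derivative_works by auto

lemma Ck_on_SucD: "Ck_on (Suc k) f S \<Longrightarrow> Ck_on k f S"
proof (induction k arbitrary: f)
  case 0
  then show ?case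
    by (auto intro!: continuous_at_imp_continuous_on differentiable_imp_continuous_within)
next
  case (Suc k)
  then show ?case by auto
qed

lemma Ck_on_subset: "Ck_on k f S \<Longrightarrow> T \<subseteq> S \<Longrightarrow> Ck_on k f T"
  by (induction k arbitrary: f) (auto intro: continuous_on_subset)

lemma Ck_on_const: "open S \<Longrightarrow> Ck_on k (\<lambda>x. c) S"
proof (induction k arbitrary: c)
  case (Suc k)
  show ?case
    by (rule Ck_on_SucI[where f'="\<lambda>x v. 0"]) (use Suc in \<open>auto intro!: derivative_eq_intros\<close>)
qed auto

lemma Ck_on_linear:
  assumes "open S" "bounded_linear h" "Ck_on k f S"
  shows "Ck_on k (\<lambda>x. h (f x)) S"
  using assms(3)
proof (induction k arbitrary: f)
  case 0
  then show ?case
    using assms(2) by (auto intro: bounded_linear.continuous_on)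
next
  case (Suc k)
  show ?case
  proof (rule Ck_on_SucI[OF assms(1), where f'="\<lambda>x v. h (frechet_derivative f (at x) v)"])
    show "((\<lambda>x. h (f x)) has_derivative (\<lambda>v. h (frechet_derivative f (at x) v))) (at x)" if "x \<in> S" for x
      using bounded_linear.has_derivative[OF assms(2) Ck_on_has_derivative[OF Suc.prems that]] .
    show "Ck_on k (\<lambda>x. h (frechet_derivative f (at x) v)) S" for v
      using Suc.IH Suc.prems by auto
  qed
qed

lemma Ck_on_add:
  assumes "open S" "Ck_on k f S" "Ck_on k g S"
  shows "Ck_on k (\<lambda>x. f x + g x) S"
  using assms(2,3)
proof (induction k arbitrary: f g)
  case 0
  then show ?case by (auto intro: continuous_intros)
next
  case (Suc k)
  show ?case
  proof (rule Ck_on_SucI[OF assms(1),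
      where f'="\<lambda>x v. frechet_derivative f (at x) v + frechet_derivative g (at x) v"])
    show "((\<lambda>x. f x + g x) has_derivative
        (\<lambda>v. frechet_derivative f (at x) v + frechet_derivative g (at x) v)) (at x)" if "x \<in> S" for x
      by (intro has_derivative_add Ck_on_has_derivative[OF Suc.prems(1) that] Ck_on_has_derivative[OF Suc.prems(2) that])
    show "Ck_on k (\<lambda>x. frechet_derivative f (at x) v + frechet_derivative g (at x) v) S" for v
      using Suc.IH Suc.prems by auto
  qed
qed

lemma Ck_on_mult:
  fixes f g :: "'a::real_normed_vector \<Rightarrow> real"
  assumes "open S" "Ck_on k f S" "Ck_on k g S"
  shows "Ck_on k (\<lambda>x. f x * g x) S"
  using assms(2,3)
proof (induction k arbitrary: f g)
  case 0
  then show ?case by (auto intro: continuous_intros)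
next
  case (Suc k)
  show ?case
  proof (rule Ck_on_SucI[OF assms(1),
      where f'="\<lambda>x v. f x * frechet_derivative g (at x) v + frechet_derivative f (at x) v * g x"])
    show "((\<lambda>x. f x * g x) has_derivative
        (\<lambda>v. f x * frechet_derivative g (at x) v + frechet_derivative f (at x) v * g x)) (at x)"
      if "x \<in> S" for x
      by (intro has_derivative_mult Ck_on_has_derivative[OF Suc.prems(1) that] Ck_on_has_derivative[OF Suc.prems(2) that])
    show "Ck_on k (\<lambda>x. f x * frechet_derivative g (at x) v + frechet_derivative f (at x) v * g x) S" for v
      \<comment> \<open>The product rule also involves \<open>f\<close> and \<open>g\<close>
        themselves, so both are first lowered to order \<open>k\<close>.\<close>
      using Suc.prems Ck_on_SucD[OF Suc.prems(1)] Ck_on_SucD[OF Suc.prems(2)]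
      by (intro Ck_on_add assms(1) Suc.IH) auto
  qed
qed

lemma Ck_on_uminus:
  fixes f :: "'a::real_normed_vector \<Rightarrow> real"
  shows "open S \<Longrightarrow> Ck_on k f S \<Longrightarrow> Ck_on k (\<lambda>x. - f x) S"
  using Ck_on_mult[OF _ Ck_on_const, of S k f "-1"] by simp

lemma Ck_on_diff:
  fixes f :: "'a::real_normed_vector \<Rightarrow> real"
  shows "open S \<Longrightarrow> Ck_on k f S \<Longrightarrow> Ck_on k g S \<Longrightarrow> Ck_on k (\<lambda>x. f x - g x) S"
  using Ck_on_add[OF _ _ Ck_on_uminus, of S k f g] by simp

lemma Ck_on_sum:
  assumes "open S" "\<And>i. i \<in> I \<Longrightarrow> Ck_on k (f i) S"
  shows "Ck_on k (\<lambda>x. \<Sum>i\<in>I. f i x) S"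
  using assms(2)
  by (induction I rule: infinite_finite_induct) (auto intro!: Ck_on_const Ck_on_add assms(1))

lemma Ck_on_prod:
  fixes f :: "_ \<Rightarrow> 'a::real_normed_vector \<Rightarrow> real"
  assumes "open S" "\<And>i. i \<in> I \<Longrightarrow> Ck_on k (f i) S"
  shows "Ck_on k (\<lambda>x. \<Prod>i\<in>I. f i x) S"
  using assms(2)
  by (induction I rule: infinite_finite_induct) (auto intro!: Ck_on_const Ck_on_mult assms(1))

lemma Ck_on_inverse:
  fixes f :: "'a::real_normed_vector \<Rightarrow> real"
  assumes "open S" "Ck_on k f S" "\<And>x. x \<in> S \<Longrightarrow> f x \<noteq> 0"
  shows "Ck_on k (\<lambda>x. inverse (f x)) S"
  using assms(2)
proof (induction k)
  case 0
  then show ?case using assms(3) by (auto intro!: continuous_intros)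
next
  case (Suc k)
  show ?case
  proof (rule Ck_on_SucI[OF assms(1),
      where f'="\<lambda>x v. - (inverse (f x) * frechet_derivative f (at x) v * inverse (f x))"])
    show "((\<lambda>x. inverse (f x)) has_derivative
        (\<lambda>v. - (inverse (f x) * frechet_derivative f (at x) v * inverse (f x)))) (at x)"
      if "x \<in> S" for x
      by (rule Deriv.has_derivative_inverse[OF assms(3)[OF that] Ck_on_has_derivative[OF Suc.prems that]])
    \<comment> \<open>The derivative of the inverse contains the inverse again, but only to order
      \<open>k\<close>, where the induction hypothesis supplies it.\<close>
    have "Ck_on k (\<lambda>x. inverse (f x)) S" using Suc Ck_on_SucD by blast
    then show "Ck_on k (\<lambda>x. - (inverse (f x) * frechet_derivative f (at x) v * inverse (f x))) S" for v
      using Suc.prems by (intro Ck_on_uminus Ck_on_mult assms(1)) auto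
  qed
qed

lemma Ck_on_divide:
  fixes f :: "'a::real_normed_vector \<Rightarrow> real"
  assumes "open S" "Ck_on k f S" "Ck_on k g S" "\<And>x. x \<in> S \<Longrightarrow> g x \<noteq> 0"
  shows "Ck_on k (\<lambda>x. f x / g x) S"
  unfolding divide_inverse by (intro Ck_on_mult Ck_on_inverse assms)

lemma Ck_on_sqrt:
  fixes f :: "'a::real_normed_vector \<Rightarrow> real"
  assumes "open S" "Ck_on k f S" "\<And>x. x \<in> S \<Longrightarrow> f x > 0"
  shows "Ck_on k (\<lambda>x. sqrt (f x)) S"
  using assms(2)
proof (induction k)
  case 0
  then show ?case by (auto intro!: continuous_intros)
next
  case (Suc k)
  show ?case
  proof (rule Ck_on_SucI[OF assms(1),
      where f'="\<lambda>x v. frechet_derivative f (at x) v * inverse (2 * sqrt (f x))"])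
    show "((\<lambda>x. sqrt (f x)) has_derivative
        (\<lambda>v. frechet_derivative f (at x) v * inverse (2 * sqrt (f x)))) (at x)"
      if "x \<in> S" for x
      using has_derivative_real_sqrt[OF assms(3)[OF that] Ck_on_has_derivative[OF Suc.prems that]]
      by (rule has_derivative_eq_rhs) (auto simp: fun_eq_iff field_simps)
    have "Ck_on k (\<lambda>x. sqrt (f x)) S" using Suc Ck_on_SucD by blast
    moreover have "sqrt (f x) \<noteq> 0" if "x \<in> S" for x using assms(3)[OF that] by simp
    ultimately show "Ck_on k (\<lambda>x. frechet_derivative f (at x) v * inverse (2 * sqrt (f x))) S" for v
      using Suc.prems by (intro Ck_on_mult Ck_on_inverse Ck_on_const assms(1)) auto
  qed
qed

lemma Ck_on_nth:
  fixes f :: "'a::real_normed_vector \<Rightarrow> ('b::real_normed_vector)^'n"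
  shows "open S \<Longrightarrow> Ck_on k f S \<Longrightarrow> Ck_on k (\<lambda>x. f x $ i) S"
  by (rule Ck_on_linear[OF _ bounded_linear_vec_nth])

section \<open>Partial derivatives, the chain rule and the symmetry of second derivatives\<close>

lemma Ck_on_partial_deriv: "Ck_on (Suc k) f S \<Longrightarrow> Ck_on k (partial_deriv i f) S"
  by (auto simp: partial_deriv_def[abs_def])

lemma has_derivative_partial:
  assumes "(f has_derivative f') (at x)" shows "partial_deriv i f x = f' (axis i 1)"
  unfolding partial_deriv_def by (rule has_derivative_imp_frechet[OF assms])

lemma linear_eq_sum_axis:
  fixes f :: "real^'n \<Rightarrow> 'b::real_vector"
  assumes "linear f" shows "f v = (\<Sum>i\<in>UNIV. v $ i *\<^sub>R f (axis i 1))"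
proof -
  have "f v = f (\<Sum>i\<in>UNIV. v $ i *\<^sub>R axis i 1)"
    using basis_expansion[of v] by (simp add: scalar_mult_eq_scaleR)
  then show ?thesis by (simp add: linear_sum[OF assms] linear_cmul[OF assms])
qed

lemma frechet_derivative_eq_sum_partial:
  fixes f :: "real^'n \<Rightarrow> real"
  assumes "f differentiable (at x)"
  shows "frechet_derivative f (at x) v = (\<Sum>i\<in>UNIV. v $ i * partial_deriv i f x)"
proof -
  have "linear (frechet_derivative f (at x))"
    using assms by (simp add: linear_frechet_derivative)
  from linear_eq_sum_axis[OF this, of v] show ?thesis by (simp add: partial_deriv_def)
qed

text \<open>\<open>Ck_on\<close> controls derivatives in fixed directions, whereas the chain rule
  evaluates the derivative of \<open>f\<close> in a direction that varies with \<open>x\<close>.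
  Expanding this direction in the standard basis leaves partial derivatives of \<open>f\<close>
  composed with \<open>T\<close>, to which the induction hypothesis applies; hence the induction is
  over all \<open>f\<close>.\<close>

lemma Ck_on_compose:
  fixes f :: "real^'n \<Rightarrow> real" and T :: "'a::real_normed_vector \<Rightarrow> real^'n"
  assumes "open S" "open W" "Ck_on k f W" "Ck_on k T S" "T ` S \<subseteq> W"
  shows "Ck_on k (\<lambda>x. f (T x)) S"
  using assms(3,4)
proof (induction k arbitrary: f)
  case 0
  then show ?case using assms(5) by (auto intro: continuous_on_compose2)
next
  case (Suc k)
  show ?case
  proof (rule Ck_on_SucI[OF assms(1),
      where f'="\<lambda>x v. \<Sum>i\<in>UNIV. frechet_derivative T (at x) v $ i * partial_deriv i f (T x)"])
    show "((\<lambda>x. f (T x)) has_derivative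
        (\<lambda>v. \<Sum>i\<in>UNIV. frechet_derivative T (at x) v $ i * partial_deriv i f (T x))) (at x)"
      if "x \<in> S" for x
    proof -
      have Tx: "T x \<in> W" using that assms(5) by auto
      have "f differentiable (at (T x))" using Suc.prems(1) Tx by auto
      from frechet_derivative_eq_sum_partial[OF this]
      show ?thesis
        using has_derivative_compose[OF Ck_on_has_derivative[OF Suc.prems(2) that]
          Ck_on_has_derivative[OF Suc.prems(1) Tx]] by simp
    qed
    have "Ck_on k (\<lambda>x. partial_deriv i f (T x)) S" for i
      by (intro Suc.IH Ck_on_partial_deriv Suc.prems Ck_on_SucD[OF Suc.prems(2)])
    moreover have "Ck_on k (\<lambda>x. frechet_derivative T (at x) v) S" for v
      using Suc.prems(2) by auto
    ultimately show "Ck_on k (\<lambda>x. \<Sum>i\<in>UNIV. frechet_derivative T (at x) v $ i * partial_deriv i f (T x)) S" for v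
      by (intro Ck_on_sum Ck_on_mult Ck_on_nth assms(1))
  qed
qed

text \<open>Both functions have the same derivatives at \<open>x\<close>, so the choice inside
  \<open>frechet_derivative\<close> returns the same map for both.\<close>

lemma partial_deriv_cong:
  assumes "open U" "x \<in> U" "\<And>y. y \<in> U \<Longrightarrow> f y = g y"
  shows "partial_deriv i f x = partial_deriv i g x"
proof -
  have "(f has_derivative D) (at x) \<longleftrightarrow> (g has_derivative D) (at x)" for D
    using assms has_derivative_transform_within_open[of _ D x UNIV U] by metis
  then show ?thesis by (simp add: partial_deriv_def frechet_derivative_def)
qed

lemma differentiable_has_frechet:
  "f differentiable (at x) \<Longrightarrow> (f has_derivative frechet_derivative f (at x)) (at x)"
  using frechet_derivative_works by blast

lemma partial_deriv_const: "partial_deriv i (\<lambda>y. c) x = 0"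
  by (rule has_derivative_partial[where f'="\<lambda>_. 0"]) simp

lemma partial_deriv_add:
  "f differentiable (at x) \<Longrightarrow> g differentiable (at x) \<Longrightarrow>
   partial_deriv i (\<lambda>y. f y + g y) x = partial_deriv i f x + partial_deriv i g x"
  using has_derivative_partial[OF has_derivative_add[OF differentiable_has_frechet differentiable_has_frechet]]
  by (simp add: partial_deriv_def)

lemma partial_deriv_diff:
  "f differentiable (at x) \<Longrightarrow> g differentiable (at x) \<Longrightarrow>
   partial_deriv i (\<lambda>y. f y - g y) x = partial_deriv i f x - partial_deriv i g x"
  using has_derivative_partial[OF has_derivative_diff[OF differentiable_has_frechet differentiable_has_frechet]]
  by (simp add: partial_deriv_def)

lemma partial_deriv_mult:
  "f differentiable (at x) \<Longrightarrow> g differentiable (at x) \<Longrightarrow>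
   partial_deriv i (\<lambda>y. f y * g y) x = partial_deriv i f x * g x + f x * partial_deriv i g x"
  using has_derivative_partial[OF has_derivative_mult[OF differentiable_has_frechet[of f]
      differentiable_has_frechet[of g]], of x i]
  by (simp add: partial_deriv_def)

lemma partial_deriv_cmult:
  "f differentiable (at x) \<Longrightarrow> partial_deriv i (\<lambda>y. c * f y) x = c * partial_deriv i f x"
  by (simp add: partial_deriv_mult partial_deriv_const)

lemma partial_deriv_sum:
  "(\<And>k. k \<in> I \<Longrightarrow> f k differentiable (at x)) \<Longrightarrow>
   partial_deriv i (\<lambda>y. \<Sum>k\<in>I. f k y) x = (\<Sum>k\<in>I. partial_deriv i (f k) x)"
  using has_derivative_partial[OF has_derivative_sum[OF differentiable_has_frechet], of I f]
  by (simp add: partial_deriv_def)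

lemma partial_deriv_chain:
  fixes f :: "real^'n \<Rightarrow> real" and T :: "real^'m \<Rightarrow> real^'n"
  assumes "T differentiable (at x)" "f differentiable (at (T x))"
  shows "partial_deriv i (\<lambda>y. f (T y)) x =
    (\<Sum>k\<in>UNIV. partial_deriv i (\<lambda>y. T y $ k) x * partial_deriv k f (T x))"
proof -
  have T: "(T has_derivative frechet_derivative T (at x)) (at x)"
    by (rule differentiable_has_frechet[OF assms(1)])
  have "partial_deriv i (\<lambda>y. T y $ k) x = frechet_derivative T (at x) (axis i 1) $ k" for k
    by (rule has_derivative_partial[OF bounded_linear.has_derivative[OF bounded_linear_vec_nth T]])
  then show ?thesis
    using has_derivative_partial[OF has_derivative_compose[OF T differentiable_has_frechet[OF assms(2)]]]
    by (simp add: frechet_derivative_eq_sum_partial[OF assms(2)])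
qed

text \<open>Applying the mean value theorem twice to the second difference of \<open>f\<close> over a small
  parallelogram, in either order, gives a nearby value of each mixed derivative.\<close>

lemma second_difference:
  fixes f :: "real^'n \<Rightarrow> real"
  assumes U: "ball x r \<subseteq> U" and f: "Ck_on 2 f U" and h: "0 < h" "2 * h < r"
  obtains y where "dist x y < 2 * h"
    "f (x + h *\<^sub>R axis i 1 + h *\<^sub>R axis j 1) - f (x + h *\<^sub>R axis i 1) - f (x + h *\<^sub>R axis j 1) + f x
      = h * h * partial_deriv j (partial_deriv i f) y"
proof -
  define u v where "u = (axis i 1 :: real^'n)" and "v = (axis j 1 :: real^'n)"
  have dist: "dist x (x + s *\<^sub>R u + t *\<^sub>R v) \<le> s + t" if "0 \<le> s" "0 \<le> t" for s t
  proof -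
    have "dist x (x + s *\<^sub>R u + t *\<^sub>R v) = norm (s *\<^sub>R u + t *\<^sub>R v)"
      by (metis add.assoc add_diff_cancel_left' dist_commute dist_norm)
    also have "\<dots> \<le> s + t"
      using norm_triangle_ineq[of "s *\<^sub>R u" "t *\<^sub>R v"] that by (simp add: u_def v_def)
    finally show ?thesis .
  qed
  have in_U: "x + s *\<^sub>R u + t *\<^sub>R v \<in> U" if "0 \<le> s" "s \<le> h" "0 \<le> t" "t \<le> h" for s t
    using U dist[OF that(1,3)] that h by (auto simp: subset_iff)
  have C: "Ck_on (Suc (Suc 0)) f U" using f by (simp add: numeral_2_eq_2)
  have D1: "((\<lambda>s. f (x + s *\<^sub>R u + t *\<^sub>R v)) has_real_derivative
      partial_deriv i f (x + s *\<^sub>R u + t *\<^sub>R v)) (at s)"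
    if "0 \<le> s" "s \<le> h" "0 \<le> t" "t \<le> h" for s t
  proof -
    have f': "(f has_derivative frechet_derivative f (at (x + s *\<^sub>R u + t *\<^sub>R v))) (at (x + s *\<^sub>R u + t *\<^sub>R v))"
      by (rule Ck_on_has_derivative[OF C in_U[OF that]])
    have "((\<lambda>s. x + s *\<^sub>R u + t *\<^sub>R v) has_derivative (\<lambda>d. d *\<^sub>R u)) (at s)"
      by (auto intro!: derivative_eq_intros)
    from has_derivative_compose[OF this f'] show ?thesis
      unfolding has_field_derivative_def
      by (rule has_derivative_eq_rhs)
        (simp add: fun_eq_iff linear_cmul[OF has_derivative_linear[OF f']] partial_deriv_def flip: u_def)
  qed
  have C': "Ck_on (Suc 0) (partial_deriv i f) U" by (rule Ck_on_partial_deriv[OF C])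
  have D2: "((\<lambda>t. partial_deriv i f (x + s *\<^sub>R u + t *\<^sub>R v)) has_real_derivative
      partial_deriv j (partial_deriv i f) (x + s *\<^sub>R u + t *\<^sub>R v)) (at t)"
    if "0 \<le> s" "s \<le> h" "0 \<le> t" "t \<le> h" for s t
  proof -
    let ?f = "partial_deriv i f"
    have f': "(?f has_derivative frechet_derivative ?f (at (x + s *\<^sub>R u + t *\<^sub>R v))) (at (x + s *\<^sub>R u + t *\<^sub>R v))"
      by (rule Ck_on_has_derivative[OF C' in_U[OF that]])
    have "((\<lambda>t. x + s *\<^sub>R u + t *\<^sub>R v) has_derivative (\<lambda>d. d *\<^sub>R v)) (at t)"
      by (auto intro!: derivative_eq_intros)
    from has_derivative_compose[OF this f'] show ?thesis
      unfolding has_field_derivative_def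
      by (rule has_derivative_eq_rhs)
        (simp add: fun_eq_iff linear_cmul[OF has_derivative_linear[OF f']] partial_deriv_def[of j] flip: v_def)
  qed
  have "\<exists>s>0. s < h \<and> (f (x + h *\<^sub>R u + h *\<^sub>R v) - f (x + h *\<^sub>R u + 0 *\<^sub>R v))
      - (f (x + 0 *\<^sub>R u + h *\<^sub>R v) - f (x + 0 *\<^sub>R u + 0 *\<^sub>R v))
    = (h - 0) * (partial_deriv i f (x + s *\<^sub>R u + h *\<^sub>R v) - partial_deriv i f (x + s *\<^sub>R u + 0 *\<^sub>R v))"
    by (rule MVT2[where f="\<lambda>s. f (x + s *\<^sub>R u + h *\<^sub>R v) - f (x + s *\<^sub>R u + 0 *\<^sub>R v)"])
       (use h in \<open>(linarith | (intro DERIV_diff D1; linarith))+\<close>)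
  then obtain s where s: "0 < s" "s < h" and e1: "f (x + h *\<^sub>R u + h *\<^sub>R v) - f (x + h *\<^sub>R u)
      - f (x + h *\<^sub>R v) + f x
    = h * (partial_deriv i f (x + s *\<^sub>R u + h *\<^sub>R v) - partial_deriv i f (x + s *\<^sub>R u + 0 *\<^sub>R v))"
    by (auto simp: algebra_simps)
  have "\<exists>t>0. t < h \<and> partial_deriv i f (x + s *\<^sub>R u + h *\<^sub>R v) - partial_deriv i f (x + s *\<^sub>R u + 0 *\<^sub>R v)
    = (h - 0) * partial_deriv j (partial_deriv i f) (x + s *\<^sub>R u + t *\<^sub>R v)"
    by (rule MVT2) (use h s in \<open>(linarith | (intro D2; linarith))+\<close>)
  then obtain t where t: "0 < t" "t < h" and
    "partial_deriv i f (x + s *\<^sub>R u + h *\<^sub>R v) - partial_deriv i f (x + s *\<^sub>R u + 0 *\<^sub>R v)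
    = h * partial_deriv j (partial_deriv i f) (x + s *\<^sub>R u + t *\<^sub>R v)" by auto
  with e1 dist[of s t] s show thesis
    by (intro that[of "x + s *\<^sub>R u + t *\<^sub>R v"]) (auto simp: u_def v_def)
qed

text \<open>Schwarz's theorem. The second difference is symmetric in the two directions, so for
  every small \<open>h\<close> the mixed derivatives agree at suitable points within
  \<open>2 * h\<close> of \<open>x\<close>; continuity carries this to the limit.\<close>

lemma partial_deriv_commute:
  fixes f :: "real^'n \<Rightarrow> real"
  assumes U: "open U" "x \<in> U" and f: "Ck_on 2 f U"
  shows "partial_deriv i (partial_deriv j f) x = partial_deriv j (partial_deriv i f) x"
proof -
  obtain r where r: "r > 0" "ball x r \<subseteq> U" using U openE by blast
  \<comment> \<open>The factor 4 keeps \<open>2 * h n\<close> below \<open>r\<close> for every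
    \<open>n\<close>, including 0, so the parallelogram lies in the ball.\<close>
  define h where "h n = r / (4 * real (Suc n))" for n
  have h: "0 < h n" "2 * h n < r" for n
    using r by (auto simp: h_def field_simps intro!: add_pos_nonneg)
  have h0: "(\<lambda>n. 2 * h n) \<longlonglongrightarrow> 0"
  proof -
    have "(\<lambda>n. r / 2 * inverse (real (Suc n))) \<longlonglongrightarrow> r / 2 * 0"
      by (intro tendsto_intros LIMSEQ_inverse_real_of_nat)
    moreover have "r / 2 * inverse (real (Suc n)) = 2 * h n" for n
      by (simp add: h_def field_simps)
    ultimately show ?thesis by simp
  qed
  have "\<exists>y z. dist x y < 2 * h n \<and> dist x z < 2 * h n \<and>
    partial_deriv j (partial_deriv i f) y = partial_deriv i (partial_deriv j f) z" for n
  proof -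
    obtain y where y: "dist x y < 2 * h n"
      "f (x + h n *\<^sub>R axis i 1 + h n *\<^sub>R axis j 1) - f (x + h n *\<^sub>R axis i 1) - f (x + h n *\<^sub>R axis j 1) + f x
      = h n * h n * partial_deriv j (partial_deriv i f) y"
      by (rule second_difference[OF r(2) f h])
    obtain z where z: "dist x z < 2 * h n"
      "f (x + h n *\<^sub>R axis j 1 + h n *\<^sub>R axis i 1) - f (x + h n *\<^sub>R axis j 1) - f (x + h n *\<^sub>R axis i 1) + f x
      = h n * h n * partial_deriv i (partial_deriv j f) z"
      by (rule second_difference[OF r(2) f h])
    have "h n * h n * partial_deriv j (partial_deriv i f) y = h n * h n * partial_deriv i (partial_deriv j f) z"
      unfolding y(2)[symmetric] z(2)[symmetric] by (simp add: algebra_simps)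
    with y z h[of n] show ?thesis by auto
  qed
  then obtain y z where yz: "\<And>n. dist x (y n) < 2 * h n" "\<And>n. dist x (z n) < 2 * h n"
    "\<And>n. partial_deriv j (partial_deriv i f) (y n) = partial_deriv i (partial_deriv j f) (z n)"
    by metis
  have lim: "w \<longlonglongrightarrow> x" if "\<And>n. dist x (w n) < 2 * h n" for w
  proof -
    have "(\<lambda>n. dist (w n) x) \<longlonglongrightarrow> 0"
      by (rule Lim_null_comparison[OF _ h0]) (use that in \<open>auto simp: dist_commute less_imp_le\<close>)
    then show ?thesis using tendsto_dist_iff by blast
  qed
  have cont: "isCont (partial_deriv a (partial_deriv b f)) x" for a b
  proof -
    have "Ck_on (Suc (Suc 0)) f U" using f by (simp add: numeral_2_eq_2)
    then have "Ck_on 0 (partial_deriv a (partial_deriv b f)) U"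
      by (intro Ck_on_partial_deriv)
    then show ?thesis using U by (simp add: continuous_on_eq_continuous_at)
  qed
  have "(\<lambda>n. partial_deriv j (partial_deriv i f) (y n)) \<longlonglongrightarrow> partial_deriv j (partial_deriv i f) x"
    using cont lim[OF yz(1)] isCont_tendsto_compose by blast
  moreover have "(\<lambda>n. partial_deriv i (partial_deriv j f) (z n)) \<longlonglongrightarrow> partial_deriv i (partial_deriv j f) x"
    using cont lim[OF yz(2)] isCont_tendsto_compose by blast
  ultimately show ?thesis using yz(3) LIMSEQ_unique by auto
qed

section \<open>Matrix-valued functions\<close>

lemma matrix_mult_minus_left: "(- A) ** B = - (A ** (B :: real^'n^'m))"
  by (simp add: vec_eq_iff matrix_matrix_mult_def sum_negf)

lemma matrix_mult_minus_right: "(A :: real^'m^'k) ** (- B) = - (A ** (B :: real^'n^'m))"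
  by (simp add: vec_eq_iff matrix_matrix_mult_def sum_negf)

lemma matrix_plus_rdistrib: "(A + B) ** C = A ** C + B ** (C :: real^'n^'m)"
  by (simp add: vec_eq_iff matrix_matrix_mult_def sum.distrib algebra_simps)

lemma matrix_diff_rdistrib: "(A - B) ** C = A ** C - B ** (C :: real^'n^'m)"
  by (simp add: vec_eq_iff matrix_matrix_mult_def sum_subtractf algebra_simps)

lemma matrix_diff_ldistrib: "(A :: real^'m^'k) ** (B - C) = A ** B - A ** (C :: real^'n^'m)"
  by (simp add: vec_eq_iff matrix_matrix_mult_def sum_subtractf algebra_simps)

lemma transpose_add: "transpose (A + B) = transpose A + transpose (B :: real^'n^'m)"
  by (simp add: vec_eq_iff transpose_def)

lemma transpose_diff: "transpose (A - B) = transpose A - transpose (B :: real^'n^'m)"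
  by (simp add: vec_eq_iff transpose_def)

lemma transpose_uminus: "transpose (- A) = - transpose (A :: real^'n^'m)"
  by (simp add: vec_eq_iff transpose_def)

text \<open>With \<open>algebra_simps\<close> these rules expand a matrix identity into a sum of
  left-associated words, which then cancel additively.\<close>

lemmas matrix_ring_simps = matrix_mult_minus_left matrix_mult_minus_right matrix_plus_rdistrib
  matrix_add_ldistrib matrix_diff_rdistrib matrix_diff_ldistrib matrix_mul_assoc
  transpose_add transpose_diff transpose_uminus matrix_transpose_mul

section \<open>Inverses and determinants of matrix-valued functions\<close>

lemma matrix_inv_mult:
  fixes A :: "real^'n^'n"
  assumes "invertible A"
  shows "A ** matrix_inv A = mat 1" "matrix_inv A ** A = mat 1"
  using assms unfolding invertible_def matrix_inv_def by (metis (mono_tags, lifting) someI_ex)+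

text \<open>Cramer's rule for the column \<open>axis l 1\<close>. It exhibits the entries of the
  inverse as quotients of polynomials in the entries, which is how \<open>Ck_on_matrix_inv\<close>
  obtains their regularity.\<close>

lemma matrix_inv_entry:
  fixes A :: "real^'n^'n"
  assumes "det A \<noteq> 0"
  shows "matrix_inv A $ k $ l = det (\<chi> i j. if j = k then axis l 1 $ i else A $ i $ j) / det A"
proof -
  have "A *v (matrix_inv A *v axis l 1) = axis l 1"
    using matrix_inv_mult(1)[of A] assms by (simp add: matrix_vector_mul_assoc invertible_det_nz)
  then have "matrix_inv A *v axis l 1 = (\<chi> k. det (\<chi> i j. if j = k then axis l 1 $ i else A $ i $ j) / det A)"
    using cramer[OF assms] by blast
  then have "(matrix_inv A *v axis l 1) $ k = det (\<chi> i j. if j = k then axis l 1 $ i else A $ i $ j) / det A"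
    by simp
  then show ?thesis
    by (simp add: matrix_vector_mult_basis column_def)
qed

lemma Ck_on_det:
  fixes M :: "'a::real_normed_vector \<Rightarrow> real^'n^'n"
  assumes "open S" "\<And>i j. Ck_on k (\<lambda>x. M x $ i $ j) S"
  shows "Ck_on k (\<lambda>x. det (M x)) S"
  unfolding det_def by (intro Ck_on_sum Ck_on_mult Ck_on_prod Ck_on_const assms)

lemma Ck_on_matrix_inv:
  fixes M :: "'a::real_normed_vector \<Rightarrow> real^'n^'n"
  assumes S: "open S" and M: "\<And>i j. Ck_on k (\<lambda>x. M x $ i $ j) S"
    and det: "\<And>x. x \<in> S \<Longrightarrow> det (M x) \<noteq> 0"
  shows "Ck_on k (\<lambda>x. matrix_inv (M x) $ i $ j) S"
proof (rule Ck_on_cong[OF S])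
  show "det (\<chi> a b. if b = i then axis j 1 $ a else M x $ a $ b) / det (M x) = matrix_inv (M x) $ i $ j"
    if "x \<in> S" for x
    using matrix_inv_entry[OF det[OF that]] by simp
  have "Ck_on k (\<lambda>x. (\<chi> a b. if b = i then axis j 1 $ a else M x $ a $ b) $ c $ d) S" for c d
    by (cases "d = i") (auto intro: Ck_on_const[OF S] M)
  then show "Ck_on k (\<lambda>x. det (\<chi> a b. if b = i then axis j 1 $ a else M x $ a $ b) / det (M x)) S"
    by (intro Ck_on_divide Ck_on_det S M det)
qed

text \<open>The segment from the identity to \<open>A\<close> consists of positive definite, hence
  invertible, matrices. Were \<open>det A\<close> not positive, the determinant would vanish
  somewhere on it, since it starts at 1.\<close>

lemma det_posdef:
  fixes A :: "real^'n^'n"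
  assumes pos: "\<And>v. v \<noteq> 0 \<Longrightarrow> v \<bullet> (A *v v) > 0"
  shows "det A > 0"
proof (rule ccontr)
  assume "\<not> det A > 0"
  define B where "B t = (\<chi> i j. (1 - t) * mat 1 $ i $ j + t * A $ i $ j)" for t :: real
  have B: "B t *v v = (1 - t) *\<^sub>R v + t *\<^sub>R (A *v v)" for t v
  proof -
    have "B t = (1 - t) *\<^sub>R mat 1 + t *\<^sub>R A" by (simp add: B_def vec_eq_iff)
    then show ?thesis by (simp add: matrix_vector_mult_add_rdistrib flip: scaleR_matrix_vector_assoc)
  qed
  have cont: "continuous_on {0..1} (\<lambda>t. det (B t))"
    unfolding det_def B_def by (auto intro!: continuous_intros)
  have "det (B 0) = 1" "det (B 1) = det A"
    using det_I by (simp_all add: B_def)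
  then obtain t where t: "0 \<le> t" "t \<le> 1" "det (B t) = 0"
    using IVT2'[of "\<lambda>t. det (B t)" 1 0 0] cont \<open>\<not> det A > 0\<close> by (auto simp: not_less)
  then obtain v where v: "v \<noteq> 0" "B t *v v = 0"
    using invertible_det_nz[of "B t"] invertible_left_inverse[of "B t"] matrix_left_invertible_ker[of "B t"] by blast
  have "v \<bullet> (B t *v v) = (1 - t) * (v \<bullet> v) + t * (v \<bullet> (A *v v))"
    by (simp add: B inner_add_right)
  moreover have "\<dots> > 0"
  proof (cases "t = 0")
    case False
    then have "t * (v \<bullet> (A *v v)) > 0" using t pos[OF v(1)] by simp
    then show ?thesis using t by (simp add: add_nonneg_pos)
  qed (use v in simp)
  ultimately show False using v by simp
qed

text \<open>Jacobi's formula. The product rule in the Leibniz expansion gives a sum of determinants,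
  in each of which one row is replaced by its derivative.\<close>

lemma partial_deriv_det:
  fixes M :: "real^'n \<Rightarrow> real^'m^'m"
  assumes diff: "\<And>a b. (\<lambda>y. M y $ a $ b) differentiable (at x)" and "det (M x) \<noteq> 0"
  shows "partial_deriv i (\<lambda>y. det (M y)) x =
    det (M x) * (\<Sum>k\<in>UNIV. \<Sum>j\<in>UNIV. matrix_inv (M x) $ j $ k * partial_deriv i (\<lambda>y. M y $ k $ j) x)"
proof -
  let ?D = "\<lambda>a b. frechet_derivative (\<lambda>y. M y $ a $ b) (at x)"
  let ?d = "\<lambda>a b. partial_deriv i (\<lambda>y. M y $ a $ b) x"
  have D: "((\<lambda>y. M y $ a $ b) has_derivative ?D a b) (at x)" for a b
    by (rule differentiable_has_frechet[OF diff])
  have "((\<lambda>y. det (M y)) has_derivative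
     (\<lambda>v. \<Sum>p | p permutes UNIV. of_int (sign p) * (\<Sum>k\<in>UNIV. ?D k (p k) v * (\<Prod>j\<in>UNIV - {k}. M x $ j $ p j)))) (at x)"
    unfolding det_def
    by (intro has_derivative_sum has_derivative_mult_right has_derivative_prod D)
  from has_derivative_partial[OF this, of i]
  have "partial_deriv i (\<lambda>y. det (M y)) x =
     (\<Sum>p | p permutes UNIV. of_int (sign p) * (\<Sum>k\<in>UNIV. ?d k (p k) * (\<Prod>j\<in>UNIV - {k}. M x $ j $ p j)))"
    by (simp add: partial_deriv_def)
  also have "\<dots> = (\<Sum>k\<in>UNIV. \<Sum>p | p permutes UNIV. of_int (sign p) * (?d k (p k) * (\<Prod>j\<in>UNIV - {k}. M x $ j $ p j)))"
    by (simp add: sum_distrib_left) (rule sum.swap)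
  also have "\<dots> = (\<Sum>k\<in>UNIV. det (\<chi> a. if a = k then (\<chi> b. ?d k b) else row a (M x)))"
  proof (intro sum.cong refl)
    fix k
    have "?d k (p k) * (\<Prod>j\<in>UNIV - {k}. M x $ j $ p j) =
      (\<Prod>j\<in>UNIV. (\<chi> a. if a = k then (\<chi> b. ?d k b) else row a (M x)) $ j $ p j)" for p
      by (subst prod.remove[of UNIV k]) (auto simp: row_def intro!: prod.cong)
    then show "(\<Sum>p | p permutes UNIV. of_int (sign p) * (?d k (p k) * (\<Prod>j\<in>UNIV - {k}. M x $ j $ p j)))
      = det (\<chi> a. if a = k then (\<chi> b. ?d k b) else row a (M x))"
      unfolding det_def by simp
  qed
  also have "\<dots> = (\<Sum>k\<in>UNIV. (\<Sum>j\<in>UNIV. matrix_inv (M x) $ j $ k * ?d k j) * det (M x))"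
  proof (intro sum.cong refl)
    fix k
    \<comment> \<open>\<open>c\<close> holds the coefficients of the differentiated row in terms of
      the rows of \<open>M x\<close>. The rows other than \<open>k\<close> add nothing to the
      determinant, so Cramer's lemma leaves the coefficient \<open>c $ k\<close>.\<close>
    define c where "c = (\<chi> b. ?d k b) v* matrix_inv (M x)"
    have row: "(\<chi> b. ?d k b) = c v* M x"
      using matrix_inv_mult(2)[of "M x"] assms(2)
      by (simp add: c_def vector_matrix_mul_assoc invertible_det_nz)
    have "c v* M x = (\<Sum>a\<in>UNIV. c $ a *s row a (M x))"
      by (simp add: vec_eq_iff vector_matrix_mult_def row_def mult.commute)
    then have "det (\<chi> a. if a = k then (\<chi> b. ?d k b) else row a (M x)) = c $ k * det (M x)"
      using cramer_lemma_transpose[of k c "M x"] unfolding row by (simp only:)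
    then show "det (\<chi> a. if a = k then (\<chi> b. ?d k b) else row a (M x))
      = (\<Sum>j\<in>UNIV. matrix_inv (M x) $ j $ k * ?d k j) * det (M x)"
      by (simp add: c_def vector_matrix_mult_def mult.commute)
  qed
  finally show ?thesis by (simp add: sum_distrib_left mult.commute)
qed

section \<open>Entrywise derivatives of matrix-valued functions\<close>

definition pderiv_mat :: "'n \<Rightarrow> (real^'n \<Rightarrow> real^'m^'k) \<Rightarrow> real^'n \<Rightarrow> real^'m^'k"
  where "pderiv_mat i M x = (\<chi> a b. partial_deriv i (\<lambda>y. M y $ a $ b) x)"

definition differentiable_entries :: "(real^'n \<Rightarrow> real^'m^'k) \<Rightarrow> real^'n \<Rightarrow> bool"
  where "differentiable_entries M x \<longleftrightarrow> (\<forall>a b. (\<lambda>y. M y $ a $ b) differentiable (at x))"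

lemma pderiv_mat_mult:
  fixes M :: "real^'n \<Rightarrow> real^'m^'k" and N :: "real^'n \<Rightarrow> real^'l^'m"
  assumes "differentiable_entries M x" "differentiable_entries N x"
  shows "pderiv_mat i (\<lambda>y. M y ** N y) x = pderiv_mat i M x ** N x + M x ** pderiv_mat i N x"
  using assms
  by (simp add: vec_eq_iff pderiv_mat_def matrix_matrix_mult_def differentiable_entries_def
      partial_deriv_sum partial_deriv_mult sum.distrib differentiable_mult)

lemma pderiv_mat_add:
  "differentiable_entries M x \<Longrightarrow> differentiable_entries N x \<Longrightarrow>
   pderiv_mat i (\<lambda>y. M y + N y) x = pderiv_mat i M x + pderiv_mat i N x"
  by (simp add: vec_eq_iff pderiv_mat_def differentiable_entries_def partial_deriv_add)

lemma pderiv_mat_diff: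
  "differentiable_entries M x \<Longrightarrow> differentiable_entries N x \<Longrightarrow>
   pderiv_mat i (\<lambda>y. M y - N y) x = pderiv_mat i M x - pderiv_mat i N x"
  by (simp add: vec_eq_iff pderiv_mat_def differentiable_entries_def partial_deriv_diff)

lemma pderiv_mat_transpose: "pderiv_mat i (\<lambda>y. transpose (M y)) x = transpose (pderiv_mat i M x)"
  by (simp add: vec_eq_iff pderiv_mat_def transpose_def)

lemma pderiv_mat_const: "pderiv_mat i (\<lambda>y. C) x = 0"
  by (simp add: vec_eq_iff pderiv_mat_def partial_deriv_const)

lemma pderiv_mat_uminus: "differentiable_entries M x \<Longrightarrow> pderiv_mat i (\<lambda>y. - M y) x = - pderiv_mat i M x"
  using pderiv_mat_diff[of "\<lambda>y. 0" x M i] by (simp add: pderiv_mat_const differentiable_entries_def)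

lemma pderiv_mat_cong:
  assumes "open U" "x \<in> U" "\<And>y. y \<in> U \<Longrightarrow> M y = N y"
  shows "pderiv_mat i M x = pderiv_mat i N x"
proof -
  have "partial_deriv i (\<lambda>y. M y $ a $ b) x = partial_deriv i (\<lambda>y. N y $ a $ b) x" for a b
    by (rule partial_deriv_cong[OF assms(1,2)]) (simp add: assms(3))
  then show ?thesis by (simp add: vec_eq_iff pderiv_mat_def)
qed

text \<open>Regularity is recorded per entry because the product and quotient rules for
  \<open>Ck_on\<close> concern real-valued functions.\<close>

definition Ck_entries :: "nat \<Rightarrow> (real^'n \<Rightarrow> real^'m^'k) \<Rightarrow> (real^'n) set \<Rightarrow> bool"
  where "Ck_entries k M U \<longleftrightarrow> (\<forall>a b. Ck_on k (\<lambda>y. M y $ a $ b) U)"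

lemma Ck_entries_differentiable:
  "Ck_entries (Suc k) M U \<Longrightarrow> x \<in> U \<Longrightarrow> differentiable_entries M x"
  unfolding Ck_entries_def differentiable_entries_def by auto

lemma Ck_entries_mult:
  "open U \<Longrightarrow> Ck_entries k M U \<Longrightarrow> Ck_entries k N U \<Longrightarrow> Ck_entries k (\<lambda>y. M y ** N y) U"
  unfolding Ck_entries_def matrix_matrix_mult_def by (auto intro!: Ck_on_sum Ck_on_mult)

lemma Ck_entries_add:
  "open U \<Longrightarrow> Ck_entries k M U \<Longrightarrow> Ck_entries k N U \<Longrightarrow> Ck_entries k (\<lambda>y. M y + N y) U"
  unfolding Ck_entries_def by (auto intro!: Ck_on_add)

lemma Ck_entries_diff:
  "open U \<Longrightarrow> Ck_entries k M U \<Longrightarrow> Ck_entries k N U \<Longrightarrow> Ck_entries k (\<lambda>y. M y - N y) U"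
  unfolding Ck_entries_def by (auto intro!: Ck_on_diff)

lemma Ck_entries_transpose: "Ck_entries k M U \<Longrightarrow> Ck_entries k (\<lambda>y. transpose (M y)) U"
  unfolding Ck_entries_def transpose_def by simp

lemma Ck_entries_pderiv_mat: "Ck_entries (Suc k) M U \<Longrightarrow> Ck_entries k (pderiv_mat i M) U"
  unfolding Ck_entries_def pderiv_mat_def by (simp del: Ck_on.simps add: Ck_on_partial_deriv)

lemma pderiv_mat_commute:
  assumes "open U" "x \<in> U" "Ck_entries 2 M U"
  shows "pderiv_mat i (pderiv_mat j M) x = pderiv_mat j (pderiv_mat i M) x"
proof -
  have "partial_deriv i (partial_deriv j (\<lambda>y. M y $ a $ b)) x = partial_deriv j (partial_deriv i (\<lambda>y. M y $ a $ b)) x" for a b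
    using assms by (intro partial_deriv_commute[of U]) (auto simp: Ck_entries_def simp del: Ck_on.simps)
  then show ?thesis by (simp add: vec_eq_iff pderiv_mat_def)
qed

section \<open>The contracted Bianchi identity, algebraically\<close>

text \<open>Adjacent transpositions of iterated sums; the index permutations in the contraction
  below are composed of them.\<close>

lemma sum4_swap12: "(\<Sum>a\<in>UNIV. \<Sum>b\<in>UNIV. \<Sum>c\<in>UNIV. \<Sum>d\<in>UNIV. f a b c d)
  = (\<Sum>b\<in>UNIV. \<Sum>a\<in>UNIV. \<Sum>c\<in>UNIV. \<Sum>d\<in>UNIV. f a b c d)"
  by (rule sum.swap)

lemma sum4_swap23: "(\<Sum>a\<in>UNIV. \<Sum>b\<in>UNIV. \<Sum>c\<in>UNIV. \<Sum>d\<in>UNIV. f a b c d)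
  = (\<Sum>a\<in>UNIV. \<Sum>c\<in>UNIV. \<Sum>b\<in>UNIV. \<Sum>d\<in>UNIV. f a b c d)"
  by (intro sum.cong refl sum.swap)

lemma sum4_swap34: "(\<Sum>a\<in>UNIV. \<Sum>b\<in>UNIV. \<Sum>c\<in>UNIV. \<Sum>d\<in>UNIV. f a b c d)
  = (\<Sum>a\<in>UNIV. \<Sum>b\<in>UNIV. \<Sum>d\<in>UNIV. \<Sum>c\<in>UNIV. f a b c d)"
  by (intro sum.cong refl sum.swap)

lemma sum3_swap12: "(\<Sum>a\<in>UNIV. \<Sum>b\<in>UNIV. \<Sum>c\<in>UNIV. f a b c)
  = (\<Sum>b\<in>UNIV. \<Sum>a\<in>UNIV. \<Sum>c\<in>UNIV. f a b c)"
  by (rule sum.swap)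

lemma sum3_swap23: "(\<Sum>a\<in>UNIV. \<Sum>b\<in>UNIV. \<Sum>c\<in>UNIV. f a b c)
  = (\<Sum>a\<in>UNIV. \<Sum>c\<in>UNIV. \<Sum>b\<in>UNIV. f a b c)"
  by (intro sum.cong refl sum.swap)

text \<open>\<open>\<Gamma> i\<close> and \<open>R i j\<close> are the matrices of the connection form and of the curvature form, \<open>H\<close> the
  inverse metric, and \<open>dR k i j\<close>, \<open>dH k\<close> stand for their \<open>k\<close>-th partial derivatives.\<close>

lemma contracted_bianchi_algebra:
  fixes \<Gamma> :: "'n::finite \<Rightarrow> real^'n^'n" and R :: "'n \<Rightarrow> 'n \<Rightarrow> real^'n^'n"
    and dR :: "'n \<Rightarrow> 'n \<Rightarrow> 'n \<Rightarrow> real^'n^'n" and H :: "real^'n^'n" and dH :: "'n \<Rightarrow> real^'n^'n"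
  defines "Ric \<equiv> \<lambda>j k. \<Sum>l\<in>UNIV. R l j $ l $ k"
    and "dRic \<equiv> \<lambda>m j k. \<Sum>l\<in>UNIV. dR m l j $ l $ k"
  defines "S \<equiv> \<lambda>p j. \<Sum>k\<in>UNIV. H $ p $ k * Ric j k"
    and "dS \<equiv> \<lambda>m p j. \<Sum>k\<in>UNIV. dH m $ p $ k * Ric j k + H $ p $ k * dRic m j k"
    and "dScal \<equiv> \<lambda>m. \<Sum>j\<in>UNIV. \<Sum>k\<in>UNIV. dH m $ j $ k * Ric j k + H $ j $ k * dRic m j k"
  assumes sym: "\<And>i j k. \<Gamma> i $ k $ j = \<Gamma> j $ k $ i"
    and skew: "\<And>i j. R i j = - R j i" and dskew: "\<And>m i j. dR m i j = - dR m j i"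
    and dH: "\<And>m. dH m = - (\<Gamma> m ** H) - H ** transpose (\<Gamma> m)"
    and Hsym: "\<And>i j. H $ i $ j = H $ j $ i"
    and contr: "\<And>l m. (\<Sum>j\<in>UNIV. \<Sum>k\<in>UNIV. H $ j $ k * R j m $ l $ k) = - S l m"
    and dcontr: "\<And>i l m. (\<Sum>j\<in>UNIV. \<Sum>k\<in>UNIV. dH i $ j $ k * R j m $ l $ k + H $ j $ k * dR i j m $ l $ k) = - dS i l m"
    and bianchi: "\<And>m i j. (dR m i j + \<Gamma> m ** R i j - R i j ** \<Gamma> m)
      + (dR i j m + \<Gamma> i ** R j m - R j m ** \<Gamma> i) + (dR j m i + \<Gamma> j ** R m i - R m i ** \<Gamma> j) = 0"
  shows "dScal m = 2 * ((\<Sum>l\<in>UNIV. dS l l m) + (\<Sum>l\<in>UNIV. \<Sum>p\<in>UNIV. \<Gamma> l $ l $ p * S p m)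
    - (\<Sum>l\<in>UNIV. \<Sum>p\<in>UNIV. \<Gamma> m $ p $ l * S l p))"
proof -
  let ?S3 = "\<lambda>f. \<Sum>j\<in>UNIV. \<Sum>k\<in>UNIV. \<Sum>l\<in>UNIV. f j k l :: real"
  let ?S4 = "\<lambda>f. \<Sum>j\<in>UNIV. \<Sum>k\<in>UNIV. \<Sum>l\<in>UNIV. \<Sum>p\<in>UNIV. f j k l p :: real"
  \<comment> \<open>The letters \<open>a\<close>, \<open>b\<close>, \<open>c\<close> name the three
    cyclic summands of the second Bianchi identity after contraction with \<open>H\<close>, the
    digits their derivative term and the two products with \<open>\<Gamma>\<close>. The Christoffel
    terms of the divergence of \<open>S\<close> are \<open>t\<close> and \<open>e\<close>;
    \<open>dv\<close> is its part with partial derivatives.\<close>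
  define a1 where "a1 = ?S3 (\<lambda>j k l. H $ j $ k * dR m l j $ l $ k)"
  define a2 where "a2 = ?S4 (\<lambda>j k l p. H $ j $ k * (\<Gamma> m $ l $ p * R l j $ p $ k))"
  define a3 where "a3 = ?S4 (\<lambda>j k l p. H $ j $ k * (R l j $ l $ p * \<Gamma> m $ p $ k))"
  define b1 where "b1 = ?S3 (\<lambda>j k l. H $ j $ k * dR l j m $ l $ k)"
  define b2 where "b2 = ?S4 (\<lambda>j k l p. H $ j $ k * (\<Gamma> l $ l $ p * R j m $ p $ k))"
  define b3 where "b3 = ?S4 (\<lambda>j k l p. H $ j $ k * (R j m $ l $ p * \<Gamma> l $ p $ k))"
  define c1 where "c1 = ?S3 (\<lambda>j k l. H $ j $ k * dR j m l $ l $ k)"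
  define c2 where "c2 = ?S4 (\<lambda>j k l p. H $ j $ k * (\<Gamma> j $ l $ p * R m l $ p $ k))"
  define c3 where "c3 = ?S4 (\<lambda>j k l p. H $ j $ k * (R m l $ l $ p * \<Gamma> j $ p $ k))"
  define e where "e = (\<Sum>l\<in>UNIV. \<Sum>p\<in>UNIV. \<Gamma> m $ p $ l * S l p)"
  define t where "t = (\<Sum>l\<in>UNIV. \<Sum>p\<in>UNIV. \<Gamma> l $ l $ p * S p m)"
  define f where "f = ?S4 (\<lambda>l j p k. \<Gamma> l $ j $ p * H $ p $ k * R j m $ l $ k)"
  define dv where "dv = (\<Sum>l\<in>UNIV. dS l l m)"
  have dH_entry: "dH i $ a $ b = - (\<Sum>p\<in>UNIV. \<Gamma> i $ a $ p * H $ p $ b) - (\<Sum>p\<in>UNIV. H $ a $ p * \<Gamma> i $ b $ p)" for i a b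
    by (simp add: dH matrix_matrix_mult_def transpose_def)
  have sum0: "a1 + a2 - a3 + (b1 + b2 - b3) + (c1 + c2 - c3) = 0"
  proof -
    have "((dR m l j + \<Gamma> m ** R l j - R l j ** \<Gamma> m)
      + (dR l j m + \<Gamma> l ** R j m - R j m ** \<Gamma> l) + (dR j m l + \<Gamma> j ** R m l - R m l ** \<Gamma> j)) $ l $ k = 0" for j k l
      by (simp add: bianchi)
    then have "?S3 (\<lambda>j k l. H $ j $ k * ((dR m l j + \<Gamma> m ** R l j - R l j ** \<Gamma> m)
      + (dR l j m + \<Gamma> l ** R j m - R j m ** \<Gamma> l) + (dR j m l + \<Gamma> j ** R m l - R m l ** \<Gamma> j)) $ l $ k) = 0"
      by simp
    then have "?S3 (\<lambda>j k l. H $ j $ k * dR m l j $ l $ k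
        + (\<Sum>p\<in>UNIV. H $ j $ k * (\<Gamma> m $ l $ p * R l j $ p $ k)) - (\<Sum>p\<in>UNIV. H $ j $ k * (R l j $ l $ p * \<Gamma> m $ p $ k))
        + (H $ j $ k * dR l j m $ l $ k
        + (\<Sum>p\<in>UNIV. H $ j $ k * (\<Gamma> l $ l $ p * R j m $ p $ k)) - (\<Sum>p\<in>UNIV. H $ j $ k * (R j m $ l $ p * \<Gamma> l $ p $ k)))
        + (H $ j $ k * dR j m l $ l $ k
        + (\<Sum>p\<in>UNIV. H $ j $ k * (\<Gamma> j $ l $ p * R m l $ p $ k)) - (\<Sum>p\<in>UNIV. H $ j $ k * (R m l $ l $ p * \<Gamma> j $ p $ k)))) = 0"
      by (simp only: matrix_matrix_mult_def vector_add_component vector_minus_component vec_lambda_beta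
          distrib_left right_diff_distrib sum_distrib_left)
    then show ?thesis
      unfolding a1_def a2_def a3_def b1_def b2_def b3_def c1_def c2_def c3_def
      by (simp only: sum.distrib sum_subtractf)
  qed
  \<comment> \<open>The derivative of the inverse metric in the trace is replaced by Christoffel
    terms through \<open>dH\<close>.\<close>
  have A: "dScal m = a1 - e - a3"
  proof -
    have 1: "(\<Sum>j\<in>UNIV. \<Sum>k\<in>UNIV. H $ j $ k * dRic m j k) = a1"
      by (simp add: a1_def dRic_def sum_distrib_left)
    have 2: "(\<Sum>j\<in>UNIV. \<Sum>k\<in>UNIV. (\<Sum>p\<in>UNIV. \<Gamma> m $ j $ p * H $ p $ k) * Ric j k) = e"
    proof -
      have "(\<Sum>j\<in>UNIV. \<Sum>k\<in>UNIV. (\<Sum>p\<in>UNIV. \<Gamma> m $ j $ p * H $ p $ k) * Ric j k)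
        = ?S3 (\<lambda>j k p. \<Gamma> m $ j $ p * H $ p $ k * Ric j k)"
        by (simp add: sum_distrib_right)
      also have "\<dots> = ?S3 (\<lambda>j p k. \<Gamma> m $ j $ p * H $ p $ k * Ric j k)"
        by (rule sum3_swap23)
      also have "\<dots> = ?S3 (\<lambda>p j k. \<Gamma> m $ j $ p * H $ p $ k * Ric j k)"
        by (rule sum3_swap12)
      also have "\<dots> = e"
        by (simp add: e_def S_def sum_distrib_left mult.assoc)
      finally show ?thesis .
    qed
    have 3: "(\<Sum>j\<in>UNIV. \<Sum>k\<in>UNIV. (\<Sum>p\<in>UNIV. H $ j $ p * \<Gamma> m $ k $ p) * Ric j k) = a3"
    proof -
      have "(\<Sum>j\<in>UNIV. \<Sum>k\<in>UNIV. (\<Sum>p\<in>UNIV. H $ j $ p * \<Gamma> m $ k $ p) * Ric j k)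
        = ?S4 (\<lambda>j k p l. H $ j $ p * (R l j $ l $ k * \<Gamma> m $ k $ p))"
        by (simp add: sum_distrib_left sum_distrib_right Ric_def mult_ac)
      also have "\<dots> = ?S4 (\<lambda>j p k l. H $ j $ p * (R l j $ l $ k * \<Gamma> m $ k $ p))"
        by (rule sum4_swap23)
      also have "\<dots> = a3" unfolding a3_def by (rule sum4_swap34)
      finally show ?thesis .
    qed
    show ?thesis
      by (simp add: dScal_def dH_entry sum.distrib left_diff_distrib sum_subtractf sum_negf 1 2 3)
  qed
  have a2: "a2 = e"
  proof -
    have "a2 = ?S4 (\<lambda>j k l p. \<Gamma> m $ l $ p * - (H $ j $ k * R j l $ p $ k))"
    proof -
      have "H $ j $ k * (\<Gamma> m $ l $ p * R l j $ p $ k) = \<Gamma> m $ l $ p * - (H $ j $ k * R j l $ p $ k)"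
        for j k l p
        using skew[of l j] by simp
      then show ?thesis unfolding a2_def by simp
    qed
    also have "\<dots> = ?S4 (\<lambda>j l k p. \<Gamma> m $ l $ p * - (H $ j $ k * R j l $ p $ k))"
      by (rule sum4_swap23)
    also have "\<dots> = ?S4 (\<lambda>l j k p. \<Gamma> m $ l $ p * - (H $ j $ k * R j l $ p $ k))"
      by (rule sum4_swap12)
    also have "\<dots> = ?S4 (\<lambda>l j p k. \<Gamma> m $ l $ p * - (H $ j $ k * R j l $ p $ k))"
      by (rule sum4_swap34)
    also have "\<dots> = ?S4 (\<lambda>l p j k. \<Gamma> m $ l $ p * - (H $ j $ k * R j l $ p $ k))"
      by (rule sum4_swap23)
    also have "\<dots> = (\<Sum>l\<in>UNIV. \<Sum>p\<in>UNIV. \<Gamma> m $ l $ p * S p l)"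
      by (simp add: contr sum_negf flip: sum_distrib_left)
    also have "\<dots> = e" unfolding e_def by (rule sum.swap)
    finally show ?thesis .
  qed
  \<comment> \<open>\<open>dcontr\<close> rewrites \<open>dS l l m\<close> through
    \<open>dR l j m\<close>, the derivative in the second cyclic summand.\<close>
  have B: "dv = b3 + f - b1"
  proof -
    have 1: "(\<Sum>l\<in>UNIV. \<Sum>j\<in>UNIV. \<Sum>k\<in>UNIV. H $ j $ k * dR l j m $ l $ k) = b1"
      unfolding b1_def by (rule trans[OF sum3_swap12 sum3_swap23])
    have 2: "(\<Sum>l\<in>UNIV. \<Sum>j\<in>UNIV. \<Sum>k\<in>UNIV. (\<Sum>p\<in>UNIV. \<Gamma> l $ j $ p * H $ p $ k) * R j m $ l $ k) = f"
      unfolding f_def sum_distrib_right by (rule sum4_swap34)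
    have 3: "(\<Sum>l\<in>UNIV. \<Sum>j\<in>UNIV. \<Sum>k\<in>UNIV. (\<Sum>p\<in>UNIV. H $ j $ p * \<Gamma> l $ k $ p) * R j m $ l $ k) = b3"
    proof -
      have "(\<Sum>l\<in>UNIV. \<Sum>j\<in>UNIV. \<Sum>k\<in>UNIV. (\<Sum>p\<in>UNIV. H $ j $ p * \<Gamma> l $ k $ p) * R j m $ l $ k)
        = ?S4 (\<lambda>l j k p. H $ j $ p * (R j m $ l $ k * \<Gamma> l $ k $ p))"
        unfolding sum_distrib_right by (intro sum.cong refl) simp
      also have "\<dots> = ?S4 (\<lambda>j l k p. H $ j $ p * (R j m $ l $ k * \<Gamma> l $ k $ p))"
        by (rule sum4_swap12)
      also have "\<dots> = ?S4 (\<lambda>j l p k. H $ j $ p * (R j m $ l $ k * \<Gamma> l $ k $ p))"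
        by (rule sum4_swap34)
      also have "\<dots> = b3" unfolding b3_def by (rule sum4_swap23)
      finally show ?thesis .
    qed
    have "- dv = (\<Sum>l\<in>UNIV. \<Sum>j\<in>UNIV. \<Sum>k\<in>UNIV. dH l $ j $ k * R j m $ l $ k + H $ j $ k * dR l j m $ l $ k)"
      by (simp add: dcontr dv_def sum_negf)
    also have "\<dots> = b1 - f - b3"
      by (simp add: dH_entry sum.distrib left_diff_distrib sum_subtractf sum_negf 1 2 3)
    finally show ?thesis by simp
  qed
  have b2: "b2 = - t"
  proof -
    have "b2 = ?S4 (\<lambda>j k l p. \<Gamma> l $ l $ p * (H $ j $ k * R j m $ p $ k))"
      unfolding b2_def by (intro sum.cong refl) (simp add: mult_ac)
    also have "\<dots> = ?S4 (\<lambda>j l k p. \<Gamma> l $ l $ p * (H $ j $ k * R j m $ p $ k))"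
      by (rule sum4_swap23)
    also have "\<dots> = ?S4 (\<lambda>l j k p. \<Gamma> l $ l $ p * (H $ j $ k * R j m $ p $ k))"
      by (rule sum4_swap12)
    also have "\<dots> = ?S4 (\<lambda>l j p k. \<Gamma> l $ l $ p * (H $ j $ k * R j m $ p $ k))"
      by (rule sum4_swap34)
    also have "\<dots> = ?S4 (\<lambda>l p j k. \<Gamma> l $ l $ p * (H $ j $ k * R j m $ p $ k))"
      by (rule sum4_swap23)
    also have "\<dots> = - t"
      by (simp add: contr sum_negf t_def flip: sum_distrib_left)
    finally show ?thesis .
  qed
  have Ric_skew: "(\<Sum>l\<in>UNIV. R m l $ l $ k) = - Ric m k" for k

  proof -
    have "R m l $ l $ k = - R l m $ l $ k" for l using skew[of m l] by simp
    then show ?thesis by (simp only: Ric_def sum_negf)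
  qed
  have dRic_skew: "(\<Sum>l\<in>UNIV. dR j m l $ l $ k) = - dRic j m k" for j k

  proof -
    have "dR j m l $ l $ k = - dR j l m $ l $ k" for l using dskew[of j m l] by simp
    then show ?thesis by (simp only: dRic_def sum_negf)
  qed
  \<comment> \<open>Here \<open>dv\<close> is expanded from the definition of \<open>dS\<close>,
    which brings in the third cyclic summand.\<close>
  have C: "dv = - t + c3 - c1"
  proof -
    have 1: "(\<Sum>j\<in>UNIV. \<Sum>k\<in>UNIV. H $ j $ k * dRic j m k) = - c1"
      by (simp add: c1_def dRic_skew sum_negf flip: sum_distrib_left)
    have 2: "(\<Sum>j\<in>UNIV. \<Sum>k\<in>UNIV. (\<Sum>p\<in>UNIV. \<Gamma> j $ j $ p * H $ p $ k) * Ric m k) = t"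
    proof -
      have "(\<Sum>j\<in>UNIV. \<Sum>k\<in>UNIV. (\<Sum>p\<in>UNIV. \<Gamma> j $ j $ p * H $ p $ k) * Ric m k)
        = ?S3 (\<lambda>j k p. \<Gamma> j $ j $ p * (H $ p $ k * Ric m k))"
        by (simp add: sum_distrib_right mult.assoc)
      also have "\<dots> = ?S3 (\<lambda>j p k. \<Gamma> j $ j $ p * (H $ p $ k * Ric m k))"
        by (rule sum3_swap23)
      also have "\<dots> = t" by (simp add: t_def S_def sum_distrib_left)
      finally show ?thesis .
    qed
    have 3: "(\<Sum>j\<in>UNIV. \<Sum>k\<in>UNIV. (\<Sum>p\<in>UNIV. H $ j $ p * \<Gamma> j $ k $ p) * Ric m k) = - c3"
    proof -
      have "- c3 = ?S4 (\<lambda>j k l p. - (H $ j $ k * (R m l $ l $ p * \<Gamma> j $ p $ k)))"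
        by (simp add: c3_def sum_negf)
      also have "\<dots> = ?S4 (\<lambda>j k p l. - (H $ j $ k * (R m l $ l $ p * \<Gamma> j $ p $ k)))"
        by (rule sum4_swap34)
      also have "\<dots> = ?S4 (\<lambda>j p k l. - (H $ j $ k * (R m l $ l $ p * \<Gamma> j $ p $ k)))"
        by (rule sum4_swap23)
      also have "\<dots> = (\<Sum>j\<in>UNIV. \<Sum>p\<in>UNIV. \<Sum>k\<in>UNIV. H $ j $ k * (Ric m p * \<Gamma> j $ p $ k))"
      proof (intro sum.cong refl)
        fix j p k
        have "(\<Sum>l\<in>UNIV. - (H $ j $ k * (R m l $ l $ p * \<Gamma> j $ p $ k)))
          = - (H $ j $ k * ((\<Sum>l\<in>UNIV. R m l $ l $ p) * \<Gamma> j $ p $ k))"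
          unfolding sum_negf sum_distrib_left sum_distrib_right ..
        then show "(\<Sum>l\<in>UNIV. - (H $ j $ k * (R m l $ l $ p * \<Gamma> j $ p $ k)))
          = H $ j $ k * (Ric m p * \<Gamma> j $ p $ k)"
          by (simp add: Ric_skew)
      qed
      also have "\<dots> = (\<Sum>j\<in>UNIV. \<Sum>k\<in>UNIV. (\<Sum>p\<in>UNIV. H $ j $ p * \<Gamma> j $ k $ p) * Ric m k)"
        unfolding sum_distrib_right by (intro sum.cong refl) simp
      finally show ?thesis by simp
    qed
    show ?thesis
      by (simp add: dv_def dS_def dH_entry sum.distrib left_diff_distrib sum_subtractf sum_negf 1 2 3)
  qed
  \<comment> \<open>The place where the symmetry of \<open>\<Gamma>\<close> in its lower indices
    enters: it matches the products left over in the second and third summands.\<close>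
  have c2: "c2 = - f"
  proof -
    have "f = ?S4 (\<lambda>l j k p. \<Gamma> l $ j $ p * H $ p $ k * R j m $ l $ k)"
      unfolding f_def by (rule sum4_swap34)
    also have "\<dots> = ?S4 (\<lambda>l k j p. \<Gamma> l $ j $ p * H $ p $ k * R j m $ l $ k)"
      by (rule sum4_swap23)
    also have "\<dots> = ?S4 (\<lambda>l k p j. \<Gamma> l $ j $ p * H $ p $ k * R j m $ l $ k)"
      by (rule sum4_swap34)
    also have "\<dots> = ?S4 (\<lambda>l p k j. \<Gamma> l $ j $ p * H $ p $ k * R j m $ l $ k)"
      by (rule sum4_swap23)
    also have "\<dots> = ?S4 (\<lambda>p l k j. \<Gamma> l $ j $ p * H $ p $ k * R j m $ l $ k)"
      by (rule sum4_swap12)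
    also have "\<dots> = ?S4 (\<lambda>p k l j. \<Gamma> l $ j $ p * H $ p $ k * R j m $ l $ k)"
      by (rule sum4_swap23)
    also have "\<dots> = ?S4 (\<lambda>p k j l. \<Gamma> l $ j $ p * H $ p $ k * R j m $ l $ k)"
      by (rule sum4_swap34)
    also have "\<dots> = ?S4 (\<lambda>j k l p. - (H $ j $ k * (\<Gamma> j $ l $ p * R m l $ p $ k)))"
    proof (intro sum.cong refl)
      fix j k l p :: 'n
      show "\<Gamma> p $ l $ j * H $ j $ k * R l m $ p $ k = - (H $ j $ k * (\<Gamma> j $ l $ p * R m l $ p $ k))"
        using skew[of l m] sym[of p l j] by (simp add: mult_ac)
    qed
    finally show ?thesis by (simp add: c2_def sum_negf)
  qed
  \<comment> \<open>The cyclic summands equal \<open>dScal m + 2 * e\<close>,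
    \<open>f - dv - t\<close> and \<open>- dv - t - f\<close>. The last two each hold one copy of
    the divergence, whence the factor 2.\<close>
  from sum0 A a2 B b2 C c2 have "dScal m = 2 * (dv + t - e)" by argo
  then show ?thesis by (simp add: dv_def t_def e_def)
qed

section \<open>A Riemannian metric in a chart\<close>

text \<open>The row is the upper index and the column the second lower one, so matrix products
  compose endomorphisms and \<open>curvature\<close> becomes d\<Gamma> plus a commutator.\<close>

definition connection :: "(real^'n \<Rightarrow> real^'n^'n) \<Rightarrow> 'n::finite \<Rightarrow> real^'n \<Rightarrow> real^'n^'n"
  where "connection G i x = (\<chi> a b. christoffel G a i b x)"

definition curvature :: "(real^'n \<Rightarrow> real^'n^'n) \<Rightarrow> 'n::finite \<Rightarrow> 'n \<Rightarrow> real^'n \<Rightarrow> real^'n^'n"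
  where "curvature G i j x = (\<chi> l k. riemann G l i j k x)"

text \<open>The mixed tensor that raises the second index of Ric; the transpose puts the remaining
  index in the column, ready to be paired with a vector.\<close>

definition ricci_up :: "(real^'n \<Rightarrow> real^'n^'n) \<Rightarrow> real^'n::finite \<Rightarrow> real^'n^'n"
  where "ricci_up G x = matrix_inv (G x) ** transpose (ricci G x)"

definition volume_density :: "(real^'n \<Rightarrow> real^'n^'n) \<Rightarrow> real^'n::finite \<Rightarrow> real"
  where "volume_density G x = sqrt (det (G x))"

lemma curvature_eq: "curvature G i j x = pderiv_mat i (connection G j) x - pderiv_mat j (connection G i) x
    + (connection G i x ** connection G j x - connection G j x ** connection G i x)"
  by (simp add: vec_eq_iff curvature_def riemann_def pderiv_mat_def connection_def
      matrix_matrix_mult_def sum_subtractf)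

lemma curvature_skew: "curvature G i j x = - curvature G j i x"
  by (simp add: curvature_eq)

locale chart_metric =
  fixes U :: "(real^'n::finite) set" and G :: "real^'n \<Rightarrow> real^'n^'n"
  assumes open_U: "open U"
    and Ck_G: "\<And>k. Ck_entries k G U"
    and sym: "\<And>x. x \<in> U \<Longrightarrow> transpose (G x) = G x"
    and pos: "\<And>x v. x \<in> U \<Longrightarrow> v \<noteq> 0 \<Longrightarrow> v \<bullet> (G x *v v) > 0"
begin

abbreviation "H \<equiv> \<lambda>x. matrix_inv (G x)"
abbreviation "\<Gamma> \<equiv> connection G"
abbreviation "R \<equiv> curvature G"

lemma det_pos: "x \<in> U \<Longrightarrow> det (G x) > 0"
  using det_posdef pos by blast

lemma invertible_G: "x \<in> U \<Longrightarrow> invertible (G x)"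
  using det_pos invertible_det_nz by fastforce

lemmas G_H = matrix_inv_mult(1)[OF invertible_G] and H_G = matrix_inv_mult(2)[OF invertible_G]

lemma G_entry_sym: "x \<in> U \<Longrightarrow> G x $ i $ j = G x $ j $ i"
  using sym[of x] by (simp add: transpose_def vec_eq_iff)

lemma H_sym:
  assumes "x \<in> U" shows "transpose (H x) = H x"
proof -
  have "transpose (H x) ** G x = mat 1"
    using G_H[OF assms] sym[OF assms] by (metis matrix_transpose_mul transpose_mat)
  then have "transpose (H x) ** (G x ** H x) = H x"
    by (simp add: matrix_mul_assoc)
  then show ?thesis by (simp add: G_H[OF assms])
qed

lemma H_entry_sym: "x \<in> U \<Longrightarrow> H x $ i $ j = H x $ j $ i"
  using H_sym[of x] by (simp add: transpose_def vec_eq_iff)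

lemma Ck_H: "Ck_entries k H U"
  using Ck_G det_pos unfolding Ck_entries_def
  by (intro allI Ck_on_matrix_inv open_U) (auto simp: less_imp_neq[symmetric] dest: det_pos)

lemma Ck_connection: "Ck_entries k (\<Gamma> i) U"
proof -
  have G: "Ck_on (Suc k) (\<lambda>y. G y $ a $ b) U" for a b using Ck_G Ck_entries_def by blast
  have "Ck_on k (\<lambda>y. H y $ a $ b) U" for a b using Ck_H[of k] by (simp add: Ck_entries_def)
  then have "Ck_on k (christoffel G a i b) U" for a b
    unfolding christoffel_def[abs_def]
    by (intro Ck_on_mult Ck_on_const Ck_on_sum Ck_on_add Ck_on_diff open_U Ck_on_partial_deriv[OF G])
  then show ?thesis by (simp add: Ck_entries_def connection_def)
qed

lemma Ck_curvature: "Ck_entries k (R i j) U"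
  unfolding curvature_eq[abs_def]
  by (intro Ck_entries_add Ck_entries_diff Ck_entries_mult Ck_entries_pderiv_mat Ck_connection open_U)

lemma differentiable_mats:
  assumes "x \<in> U"
  shows "differentiable_entries G x" "differentiable_entries H x" "differentiable_entries (\<Gamma> i) x"
    "differentiable_entries (R i j) x"
  using Ck_entries_differentiable[OF Ck_G assms] Ck_entries_differentiable[OF Ck_H assms]
    Ck_entries_differentiable[OF Ck_connection assms] Ck_entries_differentiable[OF Ck_curvature assms]
  by auto

lemma partial_G_sym:
  assumes "x \<in> U"
  shows "partial_deriv k (\<lambda>y. G y $ i $ j) x = partial_deriv k (\<lambda>y. G y $ j $ i) x"
  by (rule partial_deriv_cong[OF open_U assms G_entry_sym])

section \<open>Metric compatibility and the curvature identities\<close>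

lemma connection_sym:
  assumes "x \<in> U" shows "\<Gamma> i x $ k $ j = \<Gamma> j x $ k $ i"
  unfolding connection_def christoffel_def vec_lambda_beta
  by (intro arg_cong[of _ _ "(*) (1/2)"] sum.cong refl) (simp add: partial_G_sym[OF assms, of _ i j] algebra_simps)

text \<open>Multiplying by \<open>G\<close> cancels the inverse metric in \<open>christoffel\<close>
  and leaves the Christoffel symbols of the first kind.\<close>

lemma lower_connection:
  assumes "x \<in> U"
  shows "(G x ** \<Gamma> i x) $ l $ j = (1/2) * (partial_deriv i (\<lambda>y. G y $ j $ l) x
    + partial_deriv j (\<lambda>y. G y $ i $ l) x - partial_deriv l (\<lambda>y. G y $ i $ j) x)"
proof -
  define E where "E = (\<chi> b. (1/2) * (partial_deriv i (\<lambda>y. G y $ j $ b) x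
    + partial_deriv j (\<lambda>y. G y $ i $ b) x - partial_deriv b (\<lambda>y. G y $ i $ j) x))"
  have "column j (\<Gamma> i x) = H x *v E"
    by (simp add: vec_eq_iff column_def connection_def christoffel_def matrix_vector_mult_def E_def sum_distrib_left)
  then have "G x *v column j (\<Gamma> i x) = E"
    by (simp add: matrix_vector_mul_assoc G_H[OF assms])
  then have "(G x *v column j (\<Gamma> i x)) $ l = E $ l" by simp
  then show ?thesis
    by (simp add: E_def matrix_vector_mult_def matrix_matrix_mult_def column_def)
qed

text \<open>Metric compatibility. In the sum of a first-kind symbol and its transpose the two other
  metric derivatives occur with opposite signs.\<close>

lemma pderiv_G:
  assumes "x \<in> U"
  shows "pderiv_mat i G x = G x ** \<Gamma> i x + transpose (\<Gamma> i x) ** G x"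
proof -
  have "transpose (\<Gamma> i x) ** G x = transpose (G x ** \<Gamma> i x)"
    using sym[OF assms] by (simp add: matrix_transpose_mul)
  then have "(G x ** \<Gamma> i x + transpose (\<Gamma> i x) ** G x) $ l $ j = pderiv_mat i G x $ l $ j" for l j
    using partial_G_sym[OF assms, of i j l] partial_G_sym[OF assms, of _ i j]
    by (simp add: transpose_def lower_connection[OF assms] pderiv_mat_def)
       (simp add: partial_G_sym[OF assms, of l i j] partial_G_sym[OF assms, of j i l] field_simps)
  then show ?thesis by (simp add: vec_eq_iff)
qed

text \<open>Differentiate \<open>G y ** H y = mat 1\<close> and multiply by \<open>H x\<close> from
  the left; metric compatibility turns the derivative of \<open>G\<close> into Christoffel
  terms.\<close>

lemma pderiv_H:
  assumes x: "x \<in> U"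
  shows "pderiv_mat i H x = - (\<Gamma> i x ** H x) - H x ** transpose (\<Gamma> i x)"
proof -
  have "pderiv_mat i (\<lambda>y. G y ** H y) x = pderiv_mat i (\<lambda>y. mat 1) x"
    by (rule pderiv_mat_cong[OF open_U x]) (rule G_H)
  then have "pderiv_mat i G x ** H x + G x ** pderiv_mat i H x = 0"
    by (simp add: pderiv_mat_mult differentiable_mats x pderiv_mat_const)
  then have "H x ** (pderiv_mat i G x ** H x) + H x ** (G x ** pderiv_mat i H x) = 0"
    by (metis matrix_add_ldistrib matrix_diff_ldistrib diff_self)
  moreover have "H x ** (G x ** pderiv_mat i H x) = pderiv_mat i H x"
    by (simp add: matrix_mul_assoc H_G[OF x])
  moreover have "H x ** (pderiv_mat i G x ** H x) = (H x ** G x) ** \<Gamma> i x ** H x + H x ** transpose (\<Gamma> i x) ** (G x ** H x)"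
    by (simp add: pderiv_G[OF x] matrix_ring_simps)
  ultimately show ?thesis
    by (simp add: H_G[OF x] G_H[OF x] add_eq_0_iff)
qed

text \<open>A consequence of commuting second derivatives of \<open>H\<close>: the curvature is
  skew-adjoint for the metric. After inserting \<open>pderiv_H\<close> twice, the terms with
  \<open>H\<close> between two connection matrices are symmetric in \<open>i\<close>,
  \<open>j\<close> and cancel; the rest assembles to \<open>R i j\<close>.\<close>

lemma curvature_H_skew:
  assumes x: "x \<in> U"
  shows "R i j x ** H x + H x ** transpose (R i j x) = 0"
proof -
  have D: "pderiv_mat i (pderiv_mat j H) x =
     - (pderiv_mat i (\<Gamma> j) x ** H x + \<Gamma> j x ** pderiv_mat i H x
       + (pderiv_mat i H x ** transpose (\<Gamma> j x) + H x ** transpose (pderiv_mat i (\<Gamma> j) x)))" for i j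
  proof -
    have d: "differentiable_entries (\<lambda>y. \<Gamma> j y ** H y) x"
        "differentiable_entries (\<lambda>y. H y ** transpose (\<Gamma> j y)) x"
        "differentiable_entries (\<lambda>y. transpose (\<Gamma> j y)) x"
        "differentiable_entries (\<lambda>y. \<Gamma> j y ** H y + H y ** transpose (\<Gamma> j y)) x"
      by (intro Ck_entries_differentiable[OF _ x, where k=0] Ck_entries_mult Ck_entries_add
          Ck_entries_transpose Ck_connection Ck_H open_U)+
    have "pderiv_mat i (pderiv_mat j H) x = pderiv_mat i (\<lambda>y. - (\<Gamma> j y ** H y + H y ** transpose (\<Gamma> j y))) x"
      by (rule pderiv_mat_cong[OF open_U x]) (simp add: pderiv_H)
    then show ?thesis
      by (simp only: pderiv_mat_uminus pderiv_mat_add pderiv_mat_mult pderiv_mat_transpose d differentiable_mats x)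
  qed
  have "pderiv_mat i (pderiv_mat j H) x = pderiv_mat j (pderiv_mat i H) x"
    by (rule pderiv_mat_commute[OF open_U x Ck_H])
  then show ?thesis
    unfolding D pderiv_H[OF x] curvature_eq by (simp add: matrix_ring_simps algebra_simps)
qed

text \<open>Second derivatives of \<open>\<Gamma>\<close> cancel in the cyclic sum because partial
  derivatives commute, first-derivative terms cancel against the commutators with
  \<open>\<Gamma>\<close>, and the cubic terms by the Jacobi identity.\<close>

lemma second_bianchi:
  assumes x: "x \<in> U"
  shows "(pderiv_mat m (R i j) x + \<Gamma> m x ** R i j x - R i j x ** \<Gamma> m x)
    + (pderiv_mat i (R j m) x + \<Gamma> i x ** R j m x - R j m x ** \<Gamma> i x)
    + (pderiv_mat j (R m i) x + \<Gamma> j x ** R m i x - R m i x ** \<Gamma> j x) = 0"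
proof -
  have d1: "differentiable_entries (pderiv_mat a (\<Gamma> b)) x" for a b
    by (rule Ck_entries_differentiable[OF Ck_entries_pderiv_mat[OF Ck_connection] x])
  have d2: "differentiable_entries (\<lambda>y. \<Gamma> a y ** \<Gamma> b y) x" for a b
    by (intro Ck_entries_differentiable[OF _ x, where k=0] Ck_entries_mult Ck_connection open_U)
  have d3: "differentiable_entries (\<lambda>y. \<Gamma> a y ** \<Gamma> b y - \<Gamma> b y ** \<Gamma> a y) x" for a b
    by (intro Ck_entries_differentiable[OF _ x, where k=0] Ck_entries_mult Ck_entries_diff Ck_connection open_U)
  have d4: "differentiable_entries (\<lambda>y. pderiv_mat a (\<Gamma> b) y - pderiv_mat b (\<Gamma> a) y) x" for a b
    by (intro Ck_entries_differentiable[OF _ x, where k=0] Ck_entries_pderiv_mat Ck_entries_diff Ck_connection open_U)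
  have D: "pderiv_mat m (R i j) x = pderiv_mat m (pderiv_mat i (\<Gamma> j)) x - pderiv_mat m (pderiv_mat j (\<Gamma> i)) x
    + (pderiv_mat m (\<Gamma> i) x ** \<Gamma> j x + \<Gamma> i x ** pderiv_mat m (\<Gamma> j) x
     - (pderiv_mat m (\<Gamma> j) x ** \<Gamma> i x + \<Gamma> j x ** pderiv_mat m (\<Gamma> i) x))" for m i j
    unfolding curvature_eq[abs_def]
    by (simp add: pderiv_mat_add pderiv_mat_diff pderiv_mat_mult d1 d2 d3 d4 differentiable_mats x)
  have C: "pderiv_mat a (pderiv_mat b (\<Gamma> c)) x = pderiv_mat b (pderiv_mat a (\<Gamma> c)) x" for a b c
    by (rule pderiv_mat_commute[OF open_U x Ck_connection])
  show ?thesis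
    unfolding D C[of i m] C[of j m] C[of j i] unfolding curvature_eq
    by (simp add: matrix_ring_simps algebra_simps)
qed

lemma differentiable_entry:
  assumes "x \<in> U"
  shows "(\<lambda>y. H y $ a $ b) differentiable (at x)" "(\<lambda>y. R i j y $ a $ b) differentiable (at x)"
    "(\<lambda>y. ricci G y $ a $ b) differentiable (at x)"
proof -
  show "(\<lambda>y. H y $ a $ b) differentiable (at x)" and R: "(\<lambda>y. R i j y $ a $ b) differentiable (at x)" for i j a b
    using differentiable_mats[OF assms] by (auto simp: differentiable_entries_def)
  have "(\<lambda>y. ricci G y $ a $ b) = (\<lambda>y. \<Sum>i\<in>UNIV. R i a y $ i $ b)"
    by (simp add: ricci_def curvature_def)
  then show "(\<lambda>y. ricci G y $ a $ b) differentiable (at x)"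
    using R by (simp add: differentiable_sum)
qed

text \<open>The two sums with \<open>\<Gamma>\<close> complete the partial derivatives to a
  covariant divergence, so the right-hand side is 2 div Ric.\<close>

lemma contracted_bianchi:
  assumes x: "x \<in> U"
  shows "partial_deriv m (scalar_curvature G) x =
    2 * ((\<Sum>l\<in>UNIV. partial_deriv l (\<lambda>y. ricci_up G y $ l $ m) x)
      + (\<Sum>l\<in>UNIV. \<Sum>p\<in>UNIV. \<Gamma> l x $ l $ p * ricci_up G x $ p $ m)
      - (\<Sum>l\<in>UNIV. \<Sum>p\<in>UNIV. \<Gamma> m x $ p $ l * ricci_up G x $ l $ p))"
proof -
  note diff = differentiable_entry[OF x]
  have ric: "ricci G y $ j $ k = (\<Sum>l\<in>UNIV. R l j y $ l $ k)" for y j k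
    by (simp add: ricci_def curvature_def)
  have dric: "partial_deriv m (\<lambda>y. ricci G y $ j $ k) x = (\<Sum>l\<in>UNIV. pderiv_mat m (R l j) x $ l $ k)" for m j k
    unfolding ric by (simp add: partial_deriv_sum diff pderiv_mat_def)
  have dH: "partial_deriv m (\<lambda>y. H y $ j $ k) x = pderiv_mat m H x $ j $ k" for m j k
    by (simp add: pderiv_mat_def)
  have up: "ricci_up G y $ p $ j = (\<Sum>k\<in>UNIV. H y $ p $ k * ricci G y $ j $ k)" for y p j
    by (simp add: ricci_up_def matrix_matrix_mult_def transpose_def)
  have dup: "partial_deriv m (\<lambda>y. ricci_up G y $ p $ j) x = (\<Sum>k\<in>UNIV. pderiv_mat m H x $ p $ k * ricci G x $ j $ k
      + H x $ p $ k * (\<Sum>l\<in>UNIV. pderiv_mat m (R l j) x $ l $ k))" for m p j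
    unfolding up by (simp add: partial_deriv_sum partial_deriv_mult differentiable_mult diff dric dH)
  have dscal: "partial_deriv m (scalar_curvature G) x = (\<Sum>j\<in>UNIV. \<Sum>k\<in>UNIV. pderiv_mat m H x $ j $ k * ricci G x $ j $ k
      + H x $ j $ k * (\<Sum>l\<in>UNIV. pderiv_mat m (R l j) x $ l $ k))"
    unfolding scalar_curvature_def[abs_def]
    by (simp add: partial_deriv_sum partial_deriv_mult differentiable_mult differentiable_sum diff dric dH)
  \<comment> \<open>Contracting \<open>curvature_H_skew\<close> moves the trace from one pair of
    curvature indices to the other.\<close>
  have contr: "(\<Sum>j\<in>UNIV. \<Sum>k\<in>UNIV. H y $ j $ k * R j m y $ l $ k) = - ricci_up G y $ l $ m" if "y \<in> U" for y l m
  proof -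
    have "R j m y ** H y = - (H y ** transpose (R j m y))" for j
      using curvature_H_skew[OF that, of j m] by (simp add: eq_neg_iff_add_eq_0)
    then have "(R j m y ** H y) $ l $ j = (- (H y ** transpose (R j m y))) $ l $ j" for j
      by simp
    then have "(\<Sum>k\<in>UNIV. H y $ j $ k * R j m y $ l $ k) = - (\<Sum>k\<in>UNIV. H y $ l $ k * R j m y $ j $ k)" for j
      by (simp add: matrix_matrix_mult_def transpose_def H_entry_sym[OF that, of j] mult.commute)
    then have "(\<Sum>j\<in>UNIV. \<Sum>k\<in>UNIV. H y $ j $ k * R j m y $ l $ k)
      = - (\<Sum>j\<in>UNIV. \<Sum>k\<in>UNIV. H y $ l $ k * R j m y $ j $ k)"
      by (simp add: sum_negf)
    also have "\<dots> = - ricci_up G y $ l $ m"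
      unfolding up ric sum_distrib_left by (rule arg_cong[of _ _ uminus]) (rule sum.swap)
    finally show ?thesis .
  qed
  \<comment> \<open>\<open>contr\<close> holds throughout the open set \<open>U\<close>, so both
    sides have the same derivatives.\<close>
  have dcontr: "(\<Sum>j\<in>UNIV. \<Sum>k\<in>UNIV. pderiv_mat i H x $ j $ k * R j m x $ l $ k + H x $ j $ k * pderiv_mat i (R j m) x $ l $ k)
    = - partial_deriv i (\<lambda>y. ricci_up G y $ l $ m) x" for i l m
  proof -
    have "partial_deriv i (\<lambda>y. \<Sum>j\<in>UNIV. \<Sum>k\<in>UNIV. H y $ j $ k * R j m y $ l $ k) x
      = partial_deriv i (\<lambda>y. (- 1) * ricci_up G y $ l $ m) x"
      by (rule partial_deriv_cong[OF open_U x]) (simp add: contr)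
    also have "\<dots> = (- 1) * partial_deriv i (\<lambda>y. ricci_up G y $ l $ m) x"
      by (rule partial_deriv_cmult) (simp add: up differentiable_sum differentiable_mult diff)
    finally show ?thesis
      by (simp add: partial_deriv_sum partial_deriv_mult differentiable_mult differentiable_sum diff dH)
         (simp add: pderiv_mat_def)
  qed
  have "(\<Sum>j\<in>UNIV. \<Sum>k\<in>UNIV. pderiv_mat m H x $ j $ k * (\<Sum>l\<in>UNIV. R l j x $ l $ k)
      + H x $ j $ k * (\<Sum>l\<in>UNIV. pderiv_mat m (R l j) x $ l $ k))
    = 2 * ((\<Sum>l\<in>UNIV. \<Sum>k\<in>UNIV. pderiv_mat l H x $ l $ k * (\<Sum>l\<in>UNIV. R l m x $ l $ k)
      + H x $ l $ k * (\<Sum>r\<in>UNIV. pderiv_mat l (R r m) x $ r $ k))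
      + (\<Sum>l\<in>UNIV. \<Sum>p\<in>UNIV. \<Gamma> l x $ l $ p * (\<Sum>k\<in>UNIV. H x $ p $ k * (\<Sum>l\<in>UNIV. R l m x $ l $ k)))
      - (\<Sum>l\<in>UNIV. \<Sum>p\<in>UNIV. \<Gamma> m x $ p $ l * (\<Sum>k\<in>UNIV. H x $ l $ k * (\<Sum>l\<in>UNIV. R l p x $ l $ k))))"
  proof (rule contracted_bianchi_algebra)
    show "\<Gamma> i x $ k $ j = \<Gamma> j x $ k $ i" for i j k by (rule connection_sym[OF x])
    show "R i j x = - R j i x" for i j by (rule curvature_skew)
    show "pderiv_mat m (R i j) x = - pderiv_mat m (R j i) x" for m i j
    proof -
      have "R i j = (\<lambda>y. - R j i y)" using curvature_skew by blast
      then show ?thesis using pderiv_mat_uminus[OF differentiable_mats(4)[OF x], of m j i] by simp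
    qed
    show "pderiv_mat m H x = - (\<Gamma> m x ** H x) - H x ** transpose (\<Gamma> m x)" for m
      by (rule pderiv_H[OF x])
    show "H x $ i $ j = H x $ j $ i" for i j by (rule H_entry_sym[OF x])
    show "(\<Sum>j\<in>UNIV. \<Sum>k\<in>UNIV. H x $ j $ k * R j m x $ l $ k)
      = - (\<Sum>k\<in>UNIV. H x $ l $ k * (\<Sum>l\<in>UNIV. R l m x $ l $ k))" for l m
      using contr[OF x, of m l] by (simp add: up ric)
    show "(\<Sum>j\<in>UNIV. \<Sum>k\<in>UNIV. pderiv_mat i H x $ j $ k * R j m x $ l $ k + H x $ j $ k * pderiv_mat i (R j m) x $ l $ k)
     = - (\<Sum>k\<in>UNIV. pderiv_mat i H x $ l $ k * (\<Sum>l\<in>UNIV. R l m x $ l $ k)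
        + H x $ l $ k * (\<Sum>l\<in>UNIV. pderiv_mat i (R l m) x $ l $ k))" for i l m
      unfolding dcontr dup ric ..
    show "(pderiv_mat m (R i j) x + \<Gamma> m x ** R i j x - R i j x ** \<Gamma> m x)
      + (pderiv_mat i (R j m) x + \<Gamma> i x ** R j m x - R j m x ** \<Gamma> i x)
      + (pderiv_mat j (R m i) x + \<Gamma> j x ** R m i x - R m i x ** \<Gamma> j x) = 0" for m i j
      by (rule second_bianchi[OF x])
  qed
  then show ?thesis unfolding dscal dup unfolding up ric .
qed

section \<open>The Riemannian volume density\<close>

lemma volume_density_pos: "x \<in> U \<Longrightarrow> volume_density G x > 0"
  using det_pos by (simp add: volume_density_def)

lemma Ck_volume_density: "Ck_on k (volume_density G) U"
  unfolding volume_density_def[abs_def] using Ck_G det_pos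
  by (intro Ck_on_sqrt Ck_on_det open_U) (auto simp: Ck_entries_def)

text \<open>Jacobi's formula expresses the derivative of \<open>det (G x)\<close> through the trace
  of \<open>pderiv_mat i G x ** H x\<close>, and metric compatibility makes this twice the trace of
  \<open>\<Gamma> i x\<close>. It is the reason why \<open>divergence\<close> is the divergence with
  respect to this density.\<close>

lemma pderiv_volume_density:
  assumes x: "x \<in> U"
  shows "partial_deriv i (volume_density G) x = volume_density G x * (\<Sum>k\<in>UNIV. \<Gamma> k x $ k $ i)"
proof -
  have dG: "(\<lambda>y. G y $ a $ b) differentiable (at x)" for a b
    using differentiable_mats(1)[OF x] by (simp add: differentiable_entries_def)
  have det0: "det (G x) \<noteq> 0" using det_pos[OF x] by simp
  have "(\<Sum>k\<in>UNIV. \<Sum>j\<in>UNIV. H x $ j $ k * partial_deriv i (\<lambda>y. G y $ k $ j) x) = trace (pderiv_mat i G x ** H x)"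
    by (simp add: trace_def matrix_matrix_mult_def pderiv_mat_def mult.commute)
  also have "pderiv_mat i G x ** H x = G x ** (\<Gamma> i x ** H x) + transpose (\<Gamma> i x) ** (G x ** H x)"
    by (simp add: pderiv_G[OF x] matrix_ring_simps)
  also have "trace \<dots> = trace ((\<Gamma> i x ** H x) ** G x) + trace (transpose (\<Gamma> i x))"
    by (simp add: trace_add trace_mul_sym[of "G x"] G_H[OF x])
  also have "\<dots> = 2 * (\<Sum>k\<in>UNIV. \<Gamma> k x $ k $ i)"
    by (simp add: H_G[OF x] trace_def transpose_def connection_sym[OF x, of i] flip: matrix_mul_assoc)
  finally have ddet: "partial_deriv i (\<lambda>y. det (G y)) x = 2 * det (G x) * (\<Sum>k\<in>UNIV. \<Gamma> k x $ k $ i)"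
    by (simp add: partial_deriv_det[OF dG det0])
  have diff: "volume_density G differentiable (at x)"
    using Ck_volume_density[of "Suc 0"] x by auto
  \<comment> \<open>The square root is removed by differentiating its square.\<close>
  have "partial_deriv i (\<lambda>y. volume_density G y * volume_density G y) x = partial_deriv i (\<lambda>y. det (G y)) x"
    by (rule partial_deriv_cong[OF open_U x]) (use det_pos in \<open>simp add: volume_density_def less_imp_le\<close>)
  then have "2 * (partial_deriv i (volume_density G) x * volume_density G x) = 2 * det (G x) * (\<Sum>k\<in>UNIV. \<Gamma> k x $ k $ i)"
    by (simp add: partial_deriv_mult[OF diff diff] ddet mult.commute)
  moreover have "det (G x) = volume_density G x * volume_density G x"
    using det_pos[OF x] by (simp add: volume_density_def)
  ultimately have "volume_density G x * partial_deriv i (volume_density G) x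
      = volume_density G x * (volume_density G x * (\<Sum>k\<in>UNIV. \<Gamma> k x $ k $ i))"
    by (simp add: mult_ac)
  then show ?thesis using volume_density_pos[OF x] by simp
qed

end

section \<open>The divergence identity\<close>

definition vector_jacobian :: "(real^'n \<Rightarrow> real^'n) \<Rightarrow> real^'n::finite \<Rightarrow> real^'n^'n"
  where "vector_jacobian V x = (\<chi> a i. partial_deriv i (\<lambda>y. V y $ a) x)"

text \<open>Entry \<open>a\<close>, \<open>i\<close> is the \<open>a\<close>-th component of the
  covariant derivative of \<open>V\<close> in direction \<open>i\<close>. The index of
  \<open>V\<close> stands in the first lower slot of \<open>\<Gamma>\<close>, as the symmetry
  permits, so that the sum matches the derivative of \<open>G\<close> along \<open>V\<close> in the
  Lie derivative.\<close>

definition covariant_deriv :: "(real^'n \<Rightarrow> real^'n^'n) \<Rightarrow> (real^'n \<Rightarrow> real^'n) \<Rightarrow> real^'n::finite \<Rightarrow> real^'n^'n"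
  where "covariant_deriv G V x = vector_jacobian V x + (\<Sum>k\<in>UNIV. V x $ k *\<^sub>R connection G k x)"

definition divergence :: "(real^'n \<Rightarrow> real^'n^'n) \<Rightarrow> (real^'n \<Rightarrow> real^'n) \<Rightarrow> real^'n::finite \<Rightarrow> real"
  where "divergence G V x = (\<Sum>i\<in>UNIV. partial_deriv i (\<lambda>y. V y $ i) x)
    + (\<Sum>i\<in>UNIV. \<Sum>k\<in>UNIV. connection G k x $ k $ i * V x $ i)"

definition sq_norm :: "(real^'n \<Rightarrow> real^'n^'n) \<Rightarrow> (real^'n \<Rightarrow> real^'n) \<Rightarrow> real^'n::finite \<Rightarrow> real"
  where "sq_norm G V x = dual_form G V x \<bullet> V x"

text \<open>The constant \<open>c\<close> will be \<kappa> - n \<lambda>. With \<open>c\<close> as a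
  parameter the field is an expression in \<open>G\<close> and \<open>V\<close> free of curvature,
  and its change of chart reduces to that of its ingredients.\<close>

definition flux :: "(real^'n \<Rightarrow> real^'n^'n) \<Rightarrow> (real^'n \<Rightarrow> real^'n) \<Rightarrow> real \<Rightarrow> real \<Rightarrow> real^'n::finite \<Rightarrow> real^'n"
  where "flux G V m c x = (1/2) *\<^sub>R (matrix_inv (G x) *v (lie_deriv_metric V G x *v V x))
    - ((sq_norm G V x / m + c) / 2) *\<^sub>R V x"

text \<open>Symmetric Gaussian elimination. \<open>J\<close> holds the indices whose rows may be
  nonzero; splitting off the square of a pivot row \<open>k\<close> leaves the Schur complement,
  again positive semidefinite and supported on fewer indices.\<close>

lemma psd_factorization_on:
  fixes h :: "'n::finite \<Rightarrow> 'n \<Rightarrow> real"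
  assumes "finite J" "\<And>i j. h i j = h j i" "\<And>i j. i \<notin> J \<Longrightarrow> h i j = 0"
    and "\<And>v. (\<Sum>i\<in>UNIV. \<Sum>j\<in>UNIV. v i * v j * h i j) \<ge> 0"
  shows "\<exists>p. \<forall>i j. h i j = (\<Sum>a\<in>J. p a i * p a j)"
  using assms
proof (induction J arbitrary: h rule: finite_induct)
  case empty
  then show ?case by simp
next
  case (insert k J)
  let ?q = "\<lambda>h v. \<Sum>i\<in>UNIV. \<Sum>j\<in>UNIV. v i * v j * h i j"
  define \<delta> where "\<delta> i = (if i = k then 1 else 0 :: real)" for i
  have delta: "(\<Sum>i\<in>UNIV. \<delta> i * f i) = f k" for f :: "'n \<Rightarrow> real"
    by (simp add: \<delta>_def if_distrib[of "\<lambda>x. x * _"] cong: if_cong)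
  have shift: "?q h (\<lambda>i. v i + t * \<delta> i) = ?q h v + 2 * t * (\<Sum>j\<in>UNIV. v j * h k j) + t * t * h k k" for v t
  proof -
    have "?q h (\<lambda>i. v i + t * \<delta> i) = ?q h v
       + (\<Sum>i\<in>UNIV. \<Sum>j\<in>UNIV. \<delta> j * (t * v i * h i j))
       + (\<Sum>i\<in>UNIV. \<Sum>j\<in>UNIV. \<delta> i * (t * v j * h i j))
       + (\<Sum>i\<in>UNIV. \<Sum>j\<in>UNIV. \<delta> j * (\<delta> i * (t * t * h i j)))"
      by (simp only: sum.distrib[symmetric]) (simp add: algebra_simps)
    also have "(\<Sum>i\<in>UNIV. \<Sum>j\<in>UNIV. \<delta> i * (t * v j * h i j)) = t * (\<Sum>j\<in>UNIV. v j * h k j)"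
      by (simp add: delta mult.assoc flip: sum_distrib_left)
    also have "(\<Sum>i\<in>UNIV. \<Sum>j\<in>UNIV. \<delta> j * (t * v i * h i j)) = t * (\<Sum>j\<in>UNIV. v j * h k j)"
      by (simp only: delta insert.prems(1)[of _ k]) (simp add: sum_distrib_left mult_ac)
    also have "(\<Sum>i\<in>UNIV. \<Sum>j\<in>UNIV. \<delta> j * (\<delta> i * (t * t * h i j))) = t * t * h k k"
      by (simp add: delta)
    finally show ?thesis by simp
  qed
  show ?case
  proof (cases "h k k = 0")
    case True
    have "h k j = 0" for j
    proof (rule ccontr)
      assume nz: "h k j \<noteq> 0"
      define v where "v = (\<lambda>i. if i = j then 1 else 0 :: real)"
      \<comment> \<open>With \<open>h k k = 0\<close> the shifted form is affine in
        \<open>t\<close>; this \<open>t\<close> gives it the value -1.\<close>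
      define t where "t = - (?q h v + 1) / (2 * h k j)"
      have "(\<Sum>i\<in>UNIV. v i * h k i) = h k j"
        by (simp add: v_def if_distrib[of "\<lambda>x. x * _"] cong: if_cong)
      then have "?q h (\<lambda>i. v i + t * \<delta> i) = -1"
        unfolding shift using True nz by (simp add: t_def field_simps)
      then show False using insert.prems(3)[of "\<lambda>i. v i + t * \<delta> i"] by linarith
    qed
    then have "\<And>i j. i \<notin> J \<Longrightarrow> h i j = 0" using insert.prems(2) by (metis insertE)
    then obtain p where p: "\<And>i j. h i j = (\<Sum>a\<in>J. p a i * p a j)"
      using insert.IH[of h] insert.prems by blast
    show ?thesis
    proof (intro exI allI)
      fix i j
      have "(\<Sum>a\<in>insert k J. (p(k := \<lambda>_. 0)) a i * (p(k := \<lambda>_. 0)) a j)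
          = (\<Sum>a\<in>J. (p(k := \<lambda>_. 0)) a i * (p(k := \<lambda>_. 0)) a j)"
        using insert.hyps by simp
      also have "\<dots> = (\<Sum>a\<in>J. p a i * p a j)"
        using insert.hyps by (intro sum.cong refl) auto
      finally show "h i j = (\<Sum>a\<in>insert k J. (p(k := \<lambda>_. 0)) a i * (p(k := \<lambda>_. 0)) a j)"
        using p by simp
    qed
  next
    case False
    define d where "d = h k k"
    have "?q h \<delta> = d"
      using shift[of "\<lambda>_. 0" 1] by (simp add: d_def)
    then have d: "d > 0" using insert.prems(3)[of \<delta>] False by (simp add: d_def)
    define h' where "h' i j = h i j - h k i * h k j / d" for i j
    have "\<exists>p. \<forall>i j. h' i j = (\<Sum>a\<in>J. p a i * p a j)"
    proof (rule insert.IH)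
      show "h' i j = h' j i" for i j using insert.prems(1) by (simp add: h'_def mult.commute)
      show "h' i j = 0" if "i \<notin> J" for i j
      proof (cases "i = k")
        case True
        then show ?thesis using d by (simp add: h'_def d_def)
      next
        case False
        then have "h i j = 0" "h i k = 0" using insert.prems(2) that by auto
        then show ?thesis using insert.prems(1)[of k i] by (simp add: h'_def)
      qed
      show "0 \<le> ?q h' v" for v
      proof -
        define w where "w = (\<Sum>j\<in>UNIV. v j * h k j)"
        have "?q h' v = ?q h v - w * w / d"
        proof -
          have "?q h' v = (\<Sum>i\<in>UNIV. \<Sum>j\<in>UNIV. v i * v j * h i j - (v i * h k i) * (v j * h k j) / d)"
            by (intro sum.cong refl) (simp add: h'_def right_diff_distrib)
          also have "\<dots> = ?q h v - w * w / d"
            unfolding w_def sum_product by (simp only: sum_subtractf sum_divide_distrib)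
          finally show ?thesis .
        qed
        \<comment> \<open>Completing the square: \<open>- w / d\<close> is the shift along
          \<open>\<delta>\<close> that minimises the form.\<close>
        also have "\<dots> = ?q h (\<lambda>i. v i + (- w / d) * \<delta> i)"
          unfolding shift w_def[symmetric] d_def[symmetric] using d by (simp add: field_simps)
        finally show ?thesis using insert.prems(3) by simp
      qed
    qed
    then obtain p where p: "\<And>i j. h' i j = (\<Sum>a\<in>J. p a i * p a j)" by blast
    define p' where "p' = p(k := \<lambda>i. h k i / sqrt d)"
    show ?thesis
    proof (intro exI allI)
      fix i j
      have "(\<Sum>a\<in>insert k J. p' a i * p' a j) = p' k i * p' k j + (\<Sum>a\<in>J. p' a i * p' a j)"
        using insert.hyps by simp
      also have "(\<Sum>a\<in>J. p' a i * p' a j) = (\<Sum>a\<in>J. p a i * p a j)"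
        using insert.hyps by (intro sum.cong refl) (auto simp: p'_def)
      also have "\<dots> = h' i j" using p by simp
      also have "p' k i * p' k j = h k i * h k j / d"
        using d by (simp add: p'_def)
      finally show "h i j = (\<Sum>a\<in>insert k J. p' a i * p' a j)" by (simp add: h'_def)
    qed
  qed
qed

lemma psd_factorization:
  fixes A :: "real^'n^'n"
  assumes "transpose A = A" "\<And>v. v \<bullet> (A *v v) \<ge> 0"
  obtains P :: "real^'n^'n" where "A = P ** transpose P"
proof -
  have "\<exists>p. \<forall>i j. A $ i $ j = (\<Sum>a\<in>(UNIV :: 'n set). p a i * p a j)"
  proof (rule psd_factorization_on)
    show "A $ i $ j = A $ j $ i" for i j
      using assms(1) by (simp add: transpose_def vec_eq_iff)
    show "0 \<le> (\<Sum>i\<in>UNIV. \<Sum>j\<in>UNIV. v i * v j * A $ i $ j)" for v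
      using assms(2)[of "\<chi> i. v i"]
      by (simp add: inner_vec_def matrix_vector_mult_def sum_distrib_left mult_ac)
  qed auto
  then obtain p where "\<And>i j. A $ i $ j = (\<Sum>a\<in>(UNIV :: 'n set). p a i * p a j)" by blast
  then have "A = (\<chi> i a. p a i) ** transpose (\<chi> i a. p a i)"
    by (simp add: vec_eq_iff matrix_matrix_mult_def transpose_def)
  then show thesis using that by blast
qed

lemma trace_square_symmetric:
  fixes M :: "real^'n^'n"
  assumes "transpose M = M"
  shows "trace (M ** M) = (\<Sum>i\<in>UNIV. \<Sum>j\<in>UNIV. (M $ i $ j)\<^sup>2)"
proof -
  have "M $ i $ j = M $ j $ i" for i j using assms by (simp add: transpose_def vec_eq_iff)
  then show ?thesis by (simp add: trace_def matrix_matrix_mult_def power2_eq_square)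
qed

text \<open>With \<open>A = P ** transpose P\<close> the trace is the sum of the squared entries of
  \<open>transpose P ** L ** P\<close>. For the inverse metric as \<open>A\<close> it is the squared
  norm of the tensor \<open>L\<close>.\<close>

lemma trace_square_psd:
  fixes A L :: "real^'n^'n"
  assumes A: "transpose A = A" "\<And>v. v \<bullet> (A *v v) \<ge> 0" and L: "transpose L = L"
  shows "trace (A ** L ** A ** L) \<ge> 0"
    and "trace (A ** L ** A ** L) = 0 \<Longrightarrow> A ** L ** A = 0"
proof -
  obtain P :: "real^'n^'n" where P: "A = P ** transpose P"
    by (rule psd_factorization[OF A])
  define M where "M = transpose P ** L ** P"
  have M: "transpose M = M" by (simp add: M_def matrix_transpose_mul L matrix_mul_assoc)
  have "trace (A ** L ** A ** L) = trace (P ** (transpose P ** L ** P ** transpose P ** L))"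
    by (simp add: P matrix_mul_assoc)
  also have "\<dots> = trace (transpose P ** L ** P ** transpose P ** L ** P)"
    by (rule trace_mul_sym)
  also have "\<dots> = trace (M ** M)" by (simp add: M_def matrix_mul_assoc)
  finally have t: "trace (A ** L ** A ** L) = (\<Sum>i\<in>UNIV. \<Sum>j\<in>UNIV. (M $ i $ j)\<^sup>2)"
    by (simp add: trace_square_symmetric[OF M])
  show "trace (A ** L ** A ** L) \<ge> 0" unfolding t by (intro sum_nonneg) simp
  assume "trace (A ** L ** A ** L) = 0"
  then have "M = 0" by (simp add: t sum_nonneg_eq_0_iff sum_nonneg vec_eq_iff)
  have "A ** L ** A = P ** M ** transpose P" by (simp add: P M_def matrix_mul_assoc)
  then show "A ** L ** A = 0" using \<open>M = 0\<close> by (simp add: vec_eq_iff matrix_matrix_mult_def)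
qed

section \<open>Traces, rank-one matrices and product rules for the divergence\<close>

lemma trace_scaleR: "trace (c *\<^sub>R A) = c * trace (A :: real^'n^'n)"
  by (simp add: trace_def sum_distrib_left)

lemma trace_transpose: "trace (transpose A) = trace (A :: real^'n^'n)"
  by (simp add: trace_def transpose_def)

lemma trace_mult_tensor_product: "trace (tensor_product a b ** M) = b \<bullet> (M *v a)"
proof -
  have "trace (tensor_product a b ** M) = (\<Sum>i\<in>UNIV. \<Sum>k\<in>UNIV. b $ k * (M $ k $ i * a $ i))"
    by (simp add: trace_def matrix_matrix_mult_def tensor_product_def mult_ac)
  also have "\<dots> = (\<Sum>k\<in>UNIV. \<Sum>i\<in>UNIV. b $ k * (M $ k $ i * a $ i))" by (rule sum.swap)
  finally show ?thesis by (simp add: inner_vec_def matrix_vector_mult_def sum_distrib_left)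
qed

lemma matrix_mult_tensor_product: "M ** tensor_product a b = tensor_product (M *v a) b"
  by (simp add: vec_eq_iff tensor_product_def matrix_matrix_mult_def matrix_vector_mult_def
      sum_distrib_right mult.assoc)

lemma tensor_product_mult_vec: "tensor_product a b *v v = (b \<bullet> v) *\<^sub>R a"
  by (simp add: vec_eq_iff tensor_product_def matrix_vector_mult_def inner_vec_def sum_distrib_left mult_ac)

lemma transpose_tensor_product: "transpose (tensor_product a b) = tensor_product b a"
  by (simp add: vec_eq_iff tensor_product_def transpose_def mult.commute)

lemma matrix_mult_scaleR_left: "(c *\<^sub>R A) ** B = c *\<^sub>R (A ** (B :: real^'n^'m))"
  by (simp add: vec_eq_iff matrix_matrix_mult_def sum_distrib_left mult.assoc)

lemma matrix_mult_scaleR_right: "(A :: real^'m^'k) ** (c *\<^sub>R B) = c *\<^sub>R (A ** (B :: real^'n^'m))"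
  by (simp add: vec_eq_iff matrix_matrix_mult_def sum_distrib_left mult_ac)

lemma transpose_scaleR: "transpose (c *\<^sub>R A) = c *\<^sub>R transpose (A :: real^'n^'m)"
  by (simp add: vec_eq_iff transpose_def)

lemma transpose_sum: "transpose (\<Sum>k\<in>I. f k) = (\<Sum>k\<in>I. transpose (f k :: real^'n^'m))"
  by (simp add: vec_eq_iff transpose_def)

lemma matrix_mult_sum_left: "(\<Sum>k\<in>I. f k) ** B = (\<Sum>k\<in>I. f k ** (B :: real^'n^'m))"
  by (simp add: vec_eq_iff matrix_matrix_mult_def sum_distrib_right) (intro allI, rule sum.swap)

lemma matrix_mult_sum_right: "(A :: real^'m^'k) ** (\<Sum>k\<in>I. f k) = (\<Sum>k\<in>I. A ** (f k :: real^'n^'m))"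
  by (simp add: vec_eq_iff matrix_matrix_mult_def sum_distrib_left) (intro allI, rule sum.swap)

lemma divergence_add:
  assumes "\<And>i. (\<lambda>y. V y $ i) differentiable (at x)" "\<And>i. (\<lambda>y. W y $ i) differentiable (at x)"
  shows "divergence G (\<lambda>y. V y + W y) x = divergence G V x + divergence G W x"
  by (simp add: divergence_def partial_deriv_add assms sum.distrib algebra_simps)

lemma divergence_scale:
  assumes "f differentiable (at x)" "\<And>i. (\<lambda>y. V y $ i) differentiable (at x)"
  shows "divergence G (\<lambda>y. f y *\<^sub>R V y) x = f x * divergence G V x + (\<Sum>i\<in>UNIV. partial_deriv i f x * V x $ i)"
  by (simp add: divergence_def partial_deriv_mult assms sum.distrib sum_distrib_left algebra_simps)

lemma divergence_cong:
  assumes "open U" "x \<in> U" "\<And>y. y \<in> U \<Longrightarrow> V y = W y"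
  shows "divergence G V x = divergence G W x"
proof -
  have "partial_deriv i (\<lambda>y. V y $ i) x = partial_deriv i (\<lambda>y. W y $ i) x" for i
    by (rule partial_deriv_cong[OF assms(1,2)]) (simp add: assms(3))
  then show ?thesis by (simp add: divergence_def assms)
qed

section \<open>Covariant derivative, Lie derivative and the divergence of Ric(X)\<close>

locale chart_vector_field = chart_metric U G for U :: "(real^'n::finite) set" and G +
  fixes X :: "real^'n \<Rightarrow> real^'n"
  assumes Ck_X: "\<And>k i. Ck_on k (\<lambda>y. X y $ i) U"
begin

abbreviation "A \<equiv> covariant_deriv G X"
abbreviation "L \<equiv> lie_deriv_metric X G"
abbreviation "\<alpha> \<equiv> dual_form G X"
abbreviation "N \<equiv> sq_norm G X"

lemma diff_X: "x \<in> U \<Longrightarrow> (\<lambda>y. X y $ i) differentiable (at x)"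
  using Ck_X[of "Suc 0"] by auto

lemma diff_G: "x \<in> U \<Longrightarrow> (\<lambda>y. G y $ i $ j) differentiable (at x)"
  using differentiable_mats(1) by (auto simp: differentiable_entries_def)

lemma dual_form_eq: "x \<in> U \<Longrightarrow> \<alpha> x = G x *v X x"
  using G_entry_sym[of x] by (simp add: vec_eq_iff dual_form_def matrix_vector_mult_def)

lemma H_dual_form: "x \<in> U \<Longrightarrow> H x *v \<alpha> x = X x"
  by (simp add: dual_form_eq matrix_vector_mul_assoc H_G)

text \<open>Metric compatibility converts the derivative of \<open>G\<close> along \<open>X\<close>
  into Christoffel terms, which complete the Jacobian of \<open>X\<close> to its covariant
  derivative. Thus L is twice the symmetric part of \<nabla>X with lowered index.\<close>

lemma lie_deriv_eq:
  assumes x: "x \<in> U"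
  shows "L x = G x ** A x + transpose (A x) ** G x"
proof -
  have "L x = (\<Sum>k\<in>UNIV. X x $ k *\<^sub>R pderiv_mat k G x) + transpose (vector_jacobian X x) ** G x + G x ** vector_jacobian X x"
    by (simp add: vec_eq_iff lie_deriv_metric_def pderiv_mat_def vector_jacobian_def transpose_def
        matrix_matrix_mult_def sum.distrib mult.commute)
  also have "(\<Sum>k\<in>UNIV. X x $ k *\<^sub>R pderiv_mat k G x) =
     G x ** (\<Sum>k\<in>UNIV. X x $ k *\<^sub>R \<Gamma> k x) + transpose (\<Sum>k\<in>UNIV. X x $ k *\<^sub>R \<Gamma> k x) ** G x"
    by (simp add: pderiv_G[OF x] scaleR_add_right sum.distrib matrix_mult_sum_left matrix_mult_sum_right
        transpose_sum matrix_mult_scaleR_left matrix_mult_scaleR_right transpose_scaleR)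
  finally show ?thesis by (simp add: covariant_deriv_def matrix_ring_simps)
qed

lemma lie_deriv_sym: "x \<in> U \<Longrightarrow> transpose (L x) = L x"
  by (simp add: lie_deriv_eq matrix_ring_simps sym add.commute)

lemma H_lie_deriv:
  assumes x: "x \<in> U"
  shows "H x ** L x = A x + H x ** transpose (A x) ** G x"
proof -
  have "H x ** L x = (H x ** G x) ** A x + H x ** transpose (A x) ** G x"
    unfolding lie_deriv_eq[OF x] by (simp add: matrix_ring_simps)
  then show ?thesis by (simp add: H_G[OF x])
qed

lemma divergence_eq_trace:
  assumes x: "x \<in> U" shows "divergence G X x = trace (A x)"
proof -
  have "trace (\<Sum>k\<in>UNIV. X x $ k *\<^sub>R \<Gamma> k x) = (\<Sum>i\<in>UNIV. \<Sum>k\<in>UNIV. X x $ k * \<Gamma> k x $ i $ i)"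
    by (simp add: trace_def)
  also have "\<dots> = (\<Sum>k\<in>UNIV. \<Sum>i\<in>UNIV. X x $ k * \<Gamma> k x $ i $ i)"
    by (rule sum.swap)
  also have "\<dots> = (\<Sum>i\<in>UNIV. \<Sum>k\<in>UNIV. \<Gamma> k x $ k $ i * X x $ i)"
    by (simp add: connection_sym[OF x] mult.commute)
  finally show ?thesis
    by (simp add: divergence_def covariant_deriv_def trace_add) (simp add: trace_def vector_jacobian_def)
qed

lemma trace_conj:
  assumes x: "x \<in> U" shows "trace (H x ** M ** G x) = trace M"
proof -
  have "trace (H x ** M ** G x) = trace (G x ** (H x ** M))" by (rule trace_mul_sym)
  then show ?thesis by (simp add: matrix_mul_assoc G_H[OF x])
qed

lemma trace_H_lie_deriv: "x \<in> U \<Longrightarrow> trace (H x ** L x) = 2 * divergence G X x"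
  by (simp add: H_lie_deriv trace_add trace_conj trace_transpose divergence_eq_trace)

text \<open>A symmetric tensor sees only the symmetric part of \<nabla>X, which is L/2. In matrices,
  \<open>H x ** L x\<close> is \<open>A x\<close> plus its metric adjoint \<open>B\<close>, and the
  squares of the two have equal traces.\<close>

lemma trace_HLA:
  assumes x: "x \<in> U"
  shows "trace (H x ** L x ** A x) = trace (H x ** L x ** H x ** L x) / 2"
proof -
  define B where "B = H x ** transpose (A x) ** G x"
  have HL: "H x ** L x = A x + B" using H_lie_deriv[OF x] by (simp add: B_def)
  have "B ** B = H x ** (transpose (A x) ** transpose (A x)) ** G x"
  proof -
    have "B ** B = H x ** transpose (A x) ** (G x ** H x) ** transpose (A x) ** G x"
      by (simp add: B_def matrix_mul_assoc)
    then show ?thesis by (simp add: G_H[OF x] matrix_mul_assoc)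
  qed
  then have BB: "trace (B ** B) = trace (A x ** A x)"
    using trace_transpose[of "A x ** A x"] by (simp add: trace_conj[OF x] matrix_transpose_mul)
  have "H x ** L x ** H x ** L x = (H x ** L x) ** (H x ** L x)" by (simp add: matrix_mul_assoc)
  also have "trace \<dots> = trace (A x ** A x) + trace (A x ** B) + trace (B ** A x) + trace (B ** B)"
    by (simp add: HL matrix_ring_simps trace_add)
  also have "\<dots> = 2 * (trace (A x ** A x) + trace (B ** A x))"
    by (simp add: BB trace_mul_sym[of "A x" B])
  finally show ?thesis by (simp add: HL matrix_ring_simps trace_add)
qed

text \<open>By metric compatibility the derivative of |X|^2 in direction \<open>k\<close> is 2
  g(\<nabla>_k X, X); the Christoffel terms come from the derivative of \<open>G\<close>.\<close>

lemma partial_sq_norm: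
  assumes x: "x \<in> U" shows "partial_deriv k N x = 2 * (transpose (A x) *v \<alpha> x) $ k"
proof -
  have N: "N y = (\<Sum>j\<in>UNIV. \<Sum>i\<in>UNIV. G y $ i $ j * X y $ i * X y $ j)" for y
    by (simp add: sq_norm_def dual_form_def inner_vec_def sum_distrib_right)
  have "partial_deriv k N x = (\<Sum>j\<in>UNIV. \<Sum>i\<in>UNIV. (partial_deriv k (\<lambda>y. G y $ i $ j) x * X x $ i
      + G x $ i $ j * partial_deriv k (\<lambda>y. X y $ i) x) * X x $ j + G x $ i $ j * X x $ i * partial_deriv k (\<lambda>y. X y $ j) x)"
    unfolding N[abs_def]
    by (simp add: partial_deriv_sum partial_deriv_mult differentiable_mult differentiable_sum diff_X[OF x] diff_G[OF x])
  also have "\<dots> = (\<Sum>j\<in>UNIV. \<Sum>i\<in>UNIV. X x $ j * pderiv_mat k G x $ i $ j * X x $ i)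
      + (\<Sum>j\<in>UNIV. \<Sum>i\<in>UNIV. G x $ i $ j * X x $ j * vector_jacobian X x $ i $ k)
      + (\<Sum>j\<in>UNIV. \<Sum>i\<in>UNIV. G x $ i $ j * X x $ i * vector_jacobian X x $ j $ k)"
    by (simp add: pderiv_mat_def vector_jacobian_def sum.distrib algebra_simps)
  also have "(\<Sum>j\<in>UNIV. \<Sum>i\<in>UNIV. G x $ i $ j * X x $ j * vector_jacobian X x $ i $ k)
      = (\<Sum>i\<in>UNIV. \<Sum>j\<in>UNIV. G x $ j $ i * X x $ j * vector_jacobian X x $ i $ k)"
    by (subst sum.swap) (simp add: G_entry_sym[OF x])
  also have "(\<Sum>j\<in>UNIV. \<Sum>i\<in>UNIV. G x $ i $ j * X x $ i * vector_jacobian X x $ j $ k)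
      = (transpose (vector_jacobian X x) *v \<alpha> x) $ k"
    by (simp add: dual_form_def matrix_vector_mult_def transpose_def sum_distrib_left mult_ac)
  also have "(\<Sum>j\<in>UNIV. \<Sum>i\<in>UNIV. X x $ j * pderiv_mat k G x $ i $ j * X x $ i) = X x \<bullet> (pderiv_mat k G x *v X x)"
    by (subst sum.swap) (simp add: inner_vec_def matrix_vector_mult_def sum_distrib_left mult_ac)
  also have "\<dots> = 2 * (\<alpha> x \<bullet> (\<Gamma> k x *v X x))"
  proof -
    have "X x \<bullet> (G x ** \<Gamma> k x *v X x) = \<alpha> x \<bullet> (\<Gamma> k x *v X x)"
      using sym[OF x] by (metis dual_form_eq[OF x] dot_lmul_matrix matrix_vector_mul_assoc transpose_matrix_vector)
    moreover have "X x \<bullet> (transpose (\<Gamma> k x) ** G x *v X x) = \<alpha> x \<bullet> (\<Gamma> k x *v X x)"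
      by (metis dual_form_eq[OF x] dot_lmul_matrix inner_commute matrix_vector_mul_assoc transpose_matrix_vector transpose_transpose)
    ultimately show ?thesis
      by (simp add: pderiv_G[OF x] matrix_vector_mult_add_rdistrib inner_add_right)
  qed
  also have "\<alpha> x \<bullet> (\<Gamma> k x *v X x) = (transpose (\<Sum>j\<in>UNIV. X x $ j *\<^sub>R \<Gamma> j x) *v \<alpha> x) $ k"
    by (simp add: inner_vec_def matrix_vector_mult_def transpose_def connection_sym[OF x, of k]
        sum_distrib_left sum_distrib_right mult_ac)
  finally show ?thesis
    by (simp add: covariant_deriv_def transpose_add matrix_vector_mult_add_rdistrib del: transpose_matrix_vector)
qed

text \<open>The product rule div(Ric X) = (div Ric)(X) + <Ric, \<nabla>X> with div Ric = dR/2. The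
  Christoffel term left by the Bianchi identity joins the Jacobian of \<open>X\<close> to form the
  covariant derivative.\<close>

lemma divergence_ricci_up:
  assumes x: "x \<in> U"
  shows "divergence G (\<lambda>y. ricci_up G y *v X y) x =
    (1/2) * (\<Sum>m\<in>UNIV. X x $ m * partial_deriv m (scalar_curvature G) x) + trace (ricci_up G x ** A x)"
proof -
  let ?S = "ricci_up G"
  have bianchi: "(\<Sum>l\<in>UNIV. partial_deriv l (\<lambda>y. ?S y $ l $ m) x) + (\<Sum>l\<in>UNIV. \<Sum>p\<in>UNIV. \<Gamma> l x $ l $ p * ?S x $ p $ m)
     = (1/2) * partial_deriv m (scalar_curvature G) x + (\<Sum>l\<in>UNIV. \<Sum>p\<in>UNIV. \<Gamma> m x $ p $ l * ?S x $ l $ p)" for m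
    unfolding contracted_bianchi[OF x, of m] by (simp add: field_simps)
  have dS: "(\<lambda>y. ?S y $ l $ m) differentiable (at x)" for l m
    using differentiable_entry[OF x]
    by (simp add: ricci_up_def matrix_matrix_mult_def transpose_def differentiable_sum differentiable_mult)
  have "divergence G (\<lambda>y. ?S y *v X y) x =
    (\<Sum>l\<in>UNIV. \<Sum>m\<in>UNIV. partial_deriv l (\<lambda>y. ?S y $ l $ m) x * X x $ m)
    + (\<Sum>l\<in>UNIV. \<Sum>m\<in>UNIV. ?S x $ l $ m * vector_jacobian X x $ m $ l)
    + (\<Sum>p\<in>UNIV. \<Sum>l\<in>UNIV. \<Sum>m\<in>UNIV. \<Gamma> l x $ l $ p * ?S x $ p $ m * X x $ m)"
    by (simp add: divergence_def matrix_vector_mult_def partial_deriv_sum partial_deriv_mult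
        differentiable_mult dS diff_X[OF x] vector_jacobian_def sum.distrib sum_distrib_left mult.assoc)
  also have "(\<Sum>l\<in>UNIV. \<Sum>m\<in>UNIV. partial_deriv l (\<lambda>y. ?S y $ l $ m) x * X x $ m)
    = (\<Sum>m\<in>UNIV. X x $ m * (\<Sum>l\<in>UNIV. partial_deriv l (\<lambda>y. ?S y $ l $ m) x))"
    by (subst sum.swap) (simp add: sum_distrib_left mult.commute)
  also have "(\<Sum>p\<in>UNIV. \<Sum>l\<in>UNIV. \<Sum>m\<in>UNIV. \<Gamma> l x $ l $ p * ?S x $ p $ m * X x $ m)
    = (\<Sum>m\<in>UNIV. X x $ m * (\<Sum>l\<in>UNIV. \<Sum>p\<in>UNIV. \<Gamma> l x $ l $ p * ?S x $ p $ m))"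
  proof -
    have "(\<Sum>p\<in>UNIV. \<Sum>l\<in>UNIV. \<Sum>m\<in>UNIV. \<Gamma> l x $ l $ p * ?S x $ p $ m * X x $ m)
      = (\<Sum>p\<in>UNIV. \<Sum>m\<in>UNIV. \<Sum>l\<in>UNIV. \<Gamma> l x $ l $ p * ?S x $ p $ m * X x $ m)"
      by (rule sum3_swap23)
    also have "\<dots> = (\<Sum>m\<in>UNIV. \<Sum>p\<in>UNIV. \<Sum>l\<in>UNIV. \<Gamma> l x $ l $ p * ?S x $ p $ m * X x $ m)"
      by (rule sum3_swap12)
    also have "\<dots> = (\<Sum>m\<in>UNIV. \<Sum>l\<in>UNIV. \<Sum>p\<in>UNIV. \<Gamma> l x $ l $ p * ?S x $ p $ m * X x $ m)"
      by (rule sum3_swap23)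
    finally show ?thesis by (simp add: sum_distrib_left mult_ac)
  qed
  also have "(\<Sum>m\<in>UNIV. X x $ m * (\<Sum>l\<in>UNIV. partial_deriv l (\<lambda>y. ?S y $ l $ m) x))
     + (\<Sum>l\<in>UNIV. \<Sum>m\<in>UNIV. ?S x $ l $ m * vector_jacobian X x $ m $ l)
     + (\<Sum>m\<in>UNIV. X x $ m * (\<Sum>l\<in>UNIV. \<Sum>p\<in>UNIV. \<Gamma> l x $ l $ p * ?S x $ p $ m))
     = (\<Sum>m\<in>UNIV. X x $ m * ((\<Sum>l\<in>UNIV. partial_deriv l (\<lambda>y. ?S y $ l $ m) x)
         + (\<Sum>l\<in>UNIV. \<Sum>p\<in>UNIV. \<Gamma> l x $ l $ p * ?S x $ p $ m)))
     + (\<Sum>l\<in>UNIV. \<Sum>m\<in>UNIV. ?S x $ l $ m * vector_jacobian X x $ m $ l)"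
    by (simp add: distrib_left sum.distrib)
  also have "(\<Sum>m\<in>UNIV. X x $ m * ((\<Sum>l\<in>UNIV. partial_deriv l (\<lambda>y. ?S y $ l $ m) x)
         + (\<Sum>l\<in>UNIV. \<Sum>p\<in>UNIV. \<Gamma> l x $ l $ p * ?S x $ p $ m)))
     = (\<Sum>m\<in>UNIV. X x $ m * ((1/2) * partial_deriv m (scalar_curvature G) x
       + (\<Sum>l\<in>UNIV. \<Sum>p\<in>UNIV. \<Gamma> m x $ p $ l * ?S x $ l $ p)))"
    by (simp only: bianchi)
  also have "(\<Sum>m\<in>UNIV. X x $ m * ((1/2) * partial_deriv m (scalar_curvature G) x
       + (\<Sum>l\<in>UNIV. \<Sum>p\<in>UNIV. \<Gamma> m x $ p $ l * ?S x $ l $ p)))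
     = (1/2) * (\<Sum>m\<in>UNIV. X x $ m * partial_deriv m (scalar_curvature G) x)
       + (\<Sum>m\<in>UNIV. \<Sum>l\<in>UNIV. \<Sum>p\<in>UNIV. ?S x $ l $ p * (X x $ m * \<Gamma> m x $ p $ l))"
    by (simp add: distrib_left sum.distrib sum_distrib_left mult_ac)
  also have "(\<Sum>m\<in>UNIV. \<Sum>l\<in>UNIV. \<Sum>p\<in>UNIV. ?S x $ l $ p * (X x $ m * \<Gamma> m x $ p $ l))
    = (\<Sum>l\<in>UNIV. \<Sum>p\<in>UNIV. \<Sum>m\<in>UNIV. ?S x $ l $ p * (X x $ m * \<Gamma> m x $ p $ l))"
    by (rule trans[OF sum3_swap12 sum3_swap23])
  also have "\<dots> = (\<Sum>l\<in>UNIV. \<Sum>p\<in>UNIV. ?S x $ l $ p * (\<Sum>m\<in>UNIV. X x $ m *\<^sub>R \<Gamma> m x) $ p $ l)"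
    by (simp add: sum_distrib_left)
  finally show ?thesis
    by (simp add: covariant_deriv_def trace_def matrix_matrix_mult_def sum.distrib distrib_left)
qed

end

context chart_vector_field
begin

lemma Ck_dual_form: "Ck_on k (\<lambda>y. \<alpha> y $ i) U"
  unfolding dual_form_def using Ck_G[of k] Ck_X
  by (simp add: Ck_entries_def Ck_on_sum Ck_on_mult open_U)

lemma Ck_sq_norm: "Ck_on k N U"
  unfolding sq_norm_def[abs_def] inner_vec_def
  by (simp add: Ck_on_sum Ck_on_mult open_U Ck_dual_form Ck_X)

lemma Ck_lie_deriv: "Ck_on k (\<lambda>y. L y $ i $ j) U"
proof -
  have G: "Ck_on k (\<lambda>y. G y $ a $ b) U" "Ck_on (Suc k) (\<lambda>y. G y $ a $ b) U" for a b
    using Ck_G Ck_entries_def by blast+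
  show ?thesis
    unfolding lie_deriv_metric_def vec_lambda_beta
    by (intro Ck_on_sum Ck_on_add Ck_on_mult open_U G Ck_X Ck_on_partial_deriv[OF G(2)] Ck_on_partial_deriv[OF Ck_X])
qed

lemma Ck_flux: "Ck_on k (\<lambda>y. flux G X m c y $ i) U"
proof -
  have H: "Ck_on k (\<lambda>y. H y $ a $ b) U" for a b
    using Ck_H[of k] by (simp add: Ck_entries_def)
  have "(\<lambda>y. flux G X m c y $ i) = (\<lambda>y. (1/2) * (\<Sum>a\<in>UNIV. H y $ i $ a * (\<Sum>b\<in>UNIV. L y $ a $ b * X y $ b))
      - ((1/(2*m)) * N y + c / 2) * X y $ i)"
    by (simp add: fun_eq_iff flux_def matrix_vector_mult_def field_simps)
  then show ?thesis
    by (simp only:) (intro Ck_on_sum Ck_on_add Ck_on_diff Ck_on_mult Ck_on_const open_U H Ck_lie_deriv Ck_X Ck_sq_norm)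
qed

text \<open>\<open>\<L>\<^sub>X X\<^sup>* = (\<L>\<^sub>X g)(X, \<cdot>)\<close>, because \<open>\<L>\<^sub>X X = 0\<close>.\<close>

lemma lie_deriv_mult_X:
  assumes x: "x \<in> U"
  shows "(L x *v X x) $ j = (\<Sum>k\<in>UNIV. X x $ k * partial_deriv k (\<lambda>y. \<alpha> y $ j) x)
    + (\<Sum>k\<in>UNIV. \<alpha> x $ k * partial_deriv j (\<lambda>y. X y $ k) x)"
proof -
  have d\<alpha>: "partial_deriv k (\<lambda>y. \<alpha> y $ j) x = (\<Sum>i\<in>UNIV. partial_deriv k (\<lambda>y. G y $ i $ j) x * X x $ i
      + G x $ i $ j * partial_deriv k (\<lambda>y. X y $ i) x)" for k j
    unfolding dual_form_def vec_lambda_beta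
    by (simp add: partial_deriv_sum partial_deriv_mult differentiable_mult diff_X[OF x] diff_G[OF x])
  have "L x $ j $ i = L x $ i $ j" for i
    using lie_deriv_sym[OF x] by (simp add: transpose_def vec_eq_iff)
  then have "(L x *v X x) $ j = (\<Sum>i\<in>UNIV. L x $ i $ j * X x $ i)"
    by (simp add: matrix_vector_mult_def)
  also have "\<dots> = (\<Sum>i\<in>UNIV. \<Sum>k\<in>UNIV. (X x $ k * partial_deriv k (\<lambda>y. G y $ i $ j) x
    + G x $ k $ j * partial_deriv i (\<lambda>y. X y $ k) x + G x $ i $ k * partial_deriv j (\<lambda>y. X y $ k) x) * X x $ i)"
    by (simp add: lie_deriv_metric_def sum_distrib_right)
  also have "\<dots> = (\<Sum>i\<in>UNIV. \<Sum>k\<in>UNIV. X x $ k * (partial_deriv k (\<lambda>y. G y $ i $ j) x * X x $ i))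
     + (\<Sum>i\<in>UNIV. \<Sum>k\<in>UNIV. G x $ i $ k * X x $ i * partial_deriv j (\<lambda>y. X y $ k) x)
     + (\<Sum>i\<in>UNIV. \<Sum>k\<in>UNIV. X x $ i * (G x $ k $ j * partial_deriv i (\<lambda>y. X y $ k) x))"
    by (simp only: sum.distrib[symmetric]) (simp add: algebra_simps)
  also have "(\<Sum>i\<in>UNIV. \<Sum>k\<in>UNIV. X x $ k * (partial_deriv k (\<lambda>y. G y $ i $ j) x * X x $ i))
     = (\<Sum>k\<in>UNIV. \<Sum>i\<in>UNIV. X x $ k * (partial_deriv k (\<lambda>y. G y $ i $ j) x * X x $ i))"
    by (rule sum.swap)
  also have "(\<Sum>i\<in>UNIV. \<Sum>k\<in>UNIV. G x $ i $ k * X x $ i * partial_deriv j (\<lambda>y. X y $ k) x)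
     = (\<Sum>k\<in>UNIV. \<Sum>i\<in>UNIV. G x $ i $ k * X x $ i * partial_deriv j (\<lambda>y. X y $ k) x)"
    by (rule sum.swap)
  also have "\<dots> = (\<Sum>k\<in>UNIV. \<alpha> x $ k * partial_deriv j (\<lambda>y. X y $ k) x)"
    by (simp add: dual_form_def sum_distrib_right)
  finally show ?thesis
    by (simp add: d\<alpha> sum_distrib_left distrib_left sum.distrib)
qed

text \<open>Substituting \<open>v = G x *v w\<close> with \<open>w = H x *v v\<close> turns the
  quadratic form of \<open>H x\<close> at \<open>v\<close> into that of \<open>G x\<close> at
  \<open>w\<close>.\<close>

lemma H_psd:
  assumes x: "x \<in> U" shows "v \<bullet> (H x *v v) \<ge> 0"
proof -
  have "v = G x *v (H x *v v)" by (simp add: matrix_vector_mul_assoc G_H[OF x])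
  then have "v \<bullet> (H x *v v) = (H x *v v) \<bullet> (G x *v (H x *v v))" by (metis inner_commute)
  then show ?thesis using pos[OF x, of "H x *v v"] by (cases "H x *v v = 0") auto
qed

lemma lie_deriv_norm_nonneg: "x \<in> U \<Longrightarrow> trace (H x ** L x ** H x ** L x) \<ge> 0"
  by (intro trace_square_psd H_sym H_psd lie_deriv_sym)

lemma lie_deriv_eq_0:
  assumes x: "x \<in> U" and "trace (H x ** L x ** H x ** L x) = 0"
  shows "L x = 0"
proof -
  have "H x ** L x ** H x = 0"
    using trace_square_psd(2)[OF H_sym[OF x] H_psd[OF x] lie_deriv_sym[OF x] assms(2)] .
  then have "G x ** (H x ** L x ** H x) ** G x = 0"
    by (simp add: vec_eq_iff matrix_matrix_mult_def)
  moreover have "G x ** (H x ** L x ** H x) ** G x = (G x ** H x) ** L x ** (H x ** G x)"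
    by (simp add: matrix_mul_assoc)
  ultimately show ?thesis by (simp add: G_H[OF x] H_G[OF x])
qed

end

section \<open>The quasi-Einstein equation in a chart\<close>

locale quasi_einstein_chart = chart_vector_field U G X for U :: "(real^'n::finite) set" and G X +
  fixes m lam :: real
  assumes m_nz: "m \<noteq> 0"
    and quasi_einstein_eq: "\<And>x. x \<in> U \<Longrightarrow> ricci G x + (1/2) *\<^sub>R L x - (1/m) *\<^sub>R tensor_product (\<alpha> x) (\<alpha> x) = lam *\<^sub>R G x"
begin

lemma ricci_up_eq:
  assumes x: "x \<in> U"
  shows "ricci_up G x = lam *\<^sub>R mat 1 + (1/m) *\<^sub>R tensor_product (X x) (\<alpha> x) - (1/2) *\<^sub>R (H x ** L x)"
proof -
  have "ricci G x = lam *\<^sub>R G x + (1/m) *\<^sub>R tensor_product (\<alpha> x) (\<alpha> x) - (1/2) *\<^sub>R L x"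
    using quasi_einstein_eq[OF x] by (simp add: algebra_simps)
  then show ?thesis
    by (simp add: ricci_up_def transpose_add transpose_diff transpose_scaleR transpose_tensor_product
        sym[OF x] lie_deriv_sym[OF x] matrix_add_ldistrib matrix_diff_ldistrib matrix_mult_scaleR_right
        matrix_mult_tensor_product H_dual_form[OF x] H_G[OF x])
qed

lemma scalar_eq:
  assumes x: "x \<in> U"
  shows "scalar_curvature G x = lam * CARD('n) + N x / m - divergence G X x"
proof -
  have tr: "trace (tensor_product (X x) (\<alpha> x)) = N x"
    using trace_mult_tensor_product[of "X x" "\<alpha> x" "mat 1"] by (simp add: sq_norm_def)
  have "scalar_curvature G x = trace (ricci_up G x)"
    by (simp add: scalar_curvature_def trace_def ricci_up_def matrix_matrix_mult_def transpose_def)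
  also have "\<dots> = lam * trace (mat 1 :: real^'n^'n) + N x / m - trace (H x ** L x) / 2"
    by (simp add: ricci_up_eq[OF x] trace_add trace_sub trace_scaleR tr)
  finally show ?thesis by (simp add: trace_I trace_H_lie_deriv[OF x])
qed

text \<open>By the equation, Z equals -Ric(X) + f X for a function \<open>f\<close>. Constancy of
  the scalar curvature removes the derivative term in div(Ric X), and the pairing of Ric with
  \<nabla>X is evaluated from the equation once more.\<close>

lemma divergence_flux:
  assumes const: "\<And>y. y \<in> U \<Longrightarrow> scalar_curvature G y = \<kappa>" and x: "x \<in> U"
  shows "divergence G (flux G X m (\<kappa> - lam * CARD('n))) x =
    trace (H x ** L x ** H x ** L x) / 4 + (divergence G X x)\<^sup>2 / 2"
proof -
  define c where "c = \<kappa> - lam * CARD('n)"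
  \<comment> \<open>The coefficient of \<open>X\<close> in Z + Ric(X): \<open>lam + N y / m\<close>
    from Ric minus \<open>(N y / m + c) / 2\<close> from Z.\<close>
  define f where "f y = (lam - c / 2) + (1 / (2 * m)) * N y" for y
  have Nm: "N y / m = divergence G X y + c" if "y \<in> U" for y
    using scalar_eq[OF that] const[OF that] by (simp add: c_def)
  have "flux G X m c y = (- 1) *\<^sub>R (ricci_up G y *v X y) + f y *\<^sub>R X y" if y: "y \<in> U" for y
  proof -
    have e: "ricci_up G y *v X y = lam *\<^sub>R X y + (N y / m) *\<^sub>R X y - (1/2) *\<^sub>R (H y *v (L y *v X y))"
      by (simp add: ricci_up_eq[OF y] matrix_vector_mult_add_rdistrib matrix_vector_mult_diff_rdistrib
          tensor_product_mult_vec sq_norm_def matrix_vector_mul_assoc flip: scaleR_matrix_vector_assoc)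
    show ?thesis
      using m_nz unfolding flux_def f_def e by (simp add: vec_eq_iff field_simps)
  qed
  then have "divergence G (flux G X m c) x
     = divergence G (\<lambda>y. (- 1) *\<^sub>R (ricci_up G y *v X y) + f y *\<^sub>R X y) x"
    by (rule divergence_cong[OF open_U x])
  also have "\<dots> = - divergence G (\<lambda>y. ricci_up G y *v X y) x
      + (f x * divergence G X x + (\<Sum>i\<in>UNIV. partial_deriv i f x * X x $ i))"
  proof -
    have dN: "N differentiable (at x)" using Ck_sq_norm[of "Suc 0"] x by auto
    then have df: "f differentiable (at x)" unfolding f_def[abs_def]
      by (intro differentiable_add differentiable_mult differentiable_const)
    have dS: "(\<lambda>y. (ricci_up G y *v X y) $ i) differentiable (at x)" for i
      using differentiable_entry[OF x] diff_X[OF x]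
      by (simp add: matrix_vector_mult_def ricci_up_def matrix_matrix_mult_def transpose_def differentiable_sum differentiable_mult)
    have "divergence G (\<lambda>y. (- 1) *\<^sub>R (ricci_up G y *v X y)) x = - divergence G (\<lambda>y. ricci_up G y *v X y) x"
      by (subst divergence_scale) (simp_all add: dS partial_deriv_const)
    moreover have "divergence G (\<lambda>y. f y *\<^sub>R X y) x = f x * divergence G X x + (\<Sum>i\<in>UNIV. partial_deriv i f x * X x $ i)"
      by (rule divergence_scale[OF df diff_X[OF x]])
    ultimately show ?thesis
      by (subst divergence_add) (simp_all add: dS df diff_X[OF x] differentiable_mult del: scaleR_minus1_left)
  qed
  also have "divergence G (\<lambda>y. ricci_up G y *v X y) x = lam * divergence G X x + (1/m) * (\<alpha> x \<bullet> (A x *v X x))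
      - trace (H x ** L x ** H x ** L x) / 4"
  proof -
    have "partial_deriv k (scalar_curvature G) x = 0" for k
      using partial_deriv_cong[OF open_U x const, where i=k] by (simp add: partial_deriv_const)
    then have "divergence G (\<lambda>y. ricci_up G y *v X y) x = trace (ricci_up G x ** A x)"
      by (simp add: divergence_ricci_up[OF x])
    then show ?thesis
      by (simp add: ricci_up_eq[OF x] matrix_plus_rdistrib matrix_diff_rdistrib matrix_mult_scaleR_left
        trace_add trace_sub trace_scaleR trace_mult_tensor_product trace_HLA[OF x] divergence_eq_trace[OF x])
  qed
  \<comment> \<open>This term cancels the contribution of X* \<otimes> X* / m to div(Ric X).\<close>
  also have "(\<Sum>i\<in>UNIV. partial_deriv i f x * X x $ i) = (1/m) * (\<alpha> x \<bullet> (A x *v X x))"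
  proof -
    have dN: "N differentiable (at x)" using Ck_sq_norm[of "Suc 0"] x by auto
    have "partial_deriv i f x = (1/m) * (transpose (A x) *v \<alpha> x) $ i" for i
      unfolding f_def[abs_def] by (simp only: partial_deriv_add[OF differentiable_const differentiable_mult[OF differentiable_const dN]]
          partial_deriv_const partial_deriv_cmult[OF dN] partial_sq_norm[OF x] add_0)
    then have "(\<Sum>i\<in>UNIV. partial_deriv i f x * X x $ i) = (1/m) * ((transpose (A x) *v \<alpha> x) \<bullet> X x)"
      by (simp add: inner_vec_def sum_distrib_left del: transpose_matrix_vector)
    then show ?thesis by (simp add: dot_lmul_matrix)
  qed
  \<comment> \<open>By the traced equation \<open>N x / m\<close> is
    \<open>divergence G X x + c\<close>, so \<open>c\<close> drops out of \<open>f x\<close>. The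
    half divergence gives the square in the result, and \<open>lam\<close> cancels against the
    \<lambda> term of div(Ric X).\<close>
  also have "f x = lam + (divergence G X x) / 2"
    using Nm[OF x] m_nz by (simp add: f_def field_simps)
  finally show ?thesis unfolding c_def by (simp add: power2_eq_square algebra_simps)
qed

text \<open>With L = 0 also div X = 0, so Ric is \<lambda> g + X* \<otimes> X* / m and its
  divergence is \<nabla>_X X* / m. For a Killing field \<nabla>_X X* is -d|X|^2/2, which accounts
  for the sign opposite to that of the traced equation.\<close>

lemma partial_sq_norm_killing:
  assumes killing: "\<And>y. y \<in> U \<Longrightarrow> L y = 0" and x: "x \<in> U"
  shows "partial_deriv k N x = 0"
proof -
  have div0: "divergence G X y = 0" if "y \<in> U" for y
    using trace_H_lie_deriv[OF that] killing[OF that] by (simp add: trace_def matrix_matrix_mult_def)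
  have d\<alpha>: "(\<lambda>y. \<alpha> y $ j) differentiable (at x)" for j using Ck_dual_form[of "Suc 0"] x by auto
  have dN: "N differentiable (at x)" using Ck_sq_norm[of "Suc 0"] x by auto
  have "partial_deriv k (scalar_curvature G) x = partial_deriv k (\<lambda>y. lam * CARD('n) + (1/m) * N y) x"
    by (rule partial_deriv_cong[OF open_U x]) (simp add: scalar_eq div0)
  also have "\<dots> = (1/m) * partial_deriv k N x"
    by (simp only: partial_deriv_add[OF differentiable_const differentiable_mult[OF differentiable_const dN]]
          partial_deriv_const partial_deriv_cmult[OF dN] add_0)
  finally have dR: "partial_deriv k (scalar_curvature G) x = (1/m) * partial_deriv k N x" .
  have S: "ricci_up G y $ l $ j = lam * (if l = j then 1 else 0) + (1/m) * (X y $ l * \<alpha> y $ j)" if "y \<in> U" for y l j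
    using killing[OF that] by (simp add: ricci_up_eq[OF that] matrix_matrix_mult_def mat_def tensor_product_def)
  have dS: "partial_deriv l (\<lambda>y. ricci_up G y $ l $ k) x
      = (1/m) * (partial_deriv l (\<lambda>y. X y $ l) x * \<alpha> x $ k + X x $ l * partial_deriv l (\<lambda>y. \<alpha> y $ k) x)" for l
  proof -
    have d: "(\<lambda>y. X y $ l * \<alpha> y $ k) differentiable (at x)" by (simp add: differentiable_mult diff_X[OF x] d\<alpha>)
    have "partial_deriv l (\<lambda>y. ricci_up G y $ l $ k) x
      = partial_deriv l (\<lambda>y. lam * (if l = k then 1 else 0) + (1/m) * (X y $ l * \<alpha> y $ k)) x"
      by (rule partial_deriv_cong[OF open_U x S])
    also have "\<dots> = (1/m) * partial_deriv l (\<lambda>y. X y $ l * \<alpha> y $ k) x"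
      by (simp only: partial_deriv_add[OF differentiable_const differentiable_mult[OF differentiable_const d]]
          partial_deriv_const partial_deriv_cmult[OF d] add_0)
    finally show ?thesis by (simp add: partial_deriv_mult[OF diff_X[OF x] d\<alpha>])
  qed
  \<comment> \<open>\<open>?D - ?C\<close> is the \<open>k\<close>-th component of \<nabla>_X
    X*.\<close>
  let ?D = "\<Sum>l\<in>UNIV. X x $ l * partial_deriv l (\<lambda>y. \<alpha> y $ k) x"
  let ?C = "\<Sum>l\<in>UNIV. \<Sum>p\<in>UNIV. \<Gamma> k x $ p $ l * (X x $ l * \<alpha> x $ p)"
  have e1: "(\<Sum>l\<in>UNIV. partial_deriv l (\<lambda>y. ricci_up G y $ l $ k) x)
      = (1/m) * ((\<Sum>l\<in>UNIV. partial_deriv l (\<lambda>y. X y $ l) x) * \<alpha> x $ k + ?D)"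
    by (simp add: dS sum_distrib_left sum_distrib_right sum.distrib distrib_left)
  \<comment> \<open>The \<lambda> terms of \<open>e2\<close> and \<open>e4\<close> are equal and
    cancel, which reflects \<nabla>g = 0.\<close>
  have e2: "(\<Sum>l\<in>UNIV. \<Sum>p\<in>UNIV. \<Gamma> l x $ l $ p * ricci_up G x $ p $ k)
      = lam * (\<Sum>l\<in>UNIV. \<Gamma> l x $ l $ k) + (1/m) * ((\<Sum>l\<in>UNIV. \<Sum>p\<in>UNIV. \<Gamma> l x $ l $ p * X x $ p) * \<alpha> x $ k)"
    by (simp add: S[OF x] distrib_left sum.distrib sum_distrib_left sum_distrib_right mult_ac
        if_distrib[of "\<lambda>z. _ * z"] if_distrib[of "\<lambda>z. z * _"] cong: if_cong)
  have e3: "(\<Sum>l\<in>UNIV. \<Sum>p\<in>UNIV. \<Gamma> l x $ l $ p * X x $ p) = (\<Sum>p\<in>UNIV. \<Sum>l\<in>UNIV. \<Gamma> l x $ l $ p * X x $ p)"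
    by (rule sum.swap)
  have e4: "(\<Sum>l\<in>UNIV. \<Sum>p\<in>UNIV. \<Gamma> k x $ p $ l * ricci_up G x $ l $ p)
      = lam * (\<Sum>l\<in>UNIV. \<Gamma> l x $ l $ k) + (1/m) * ?C"
    by (simp add: S[OF x] distrib_left sum.distrib sum_distrib_left mult_ac connection_sym[OF x, of k]
        if_distrib[of "\<lambda>z. _ * z"] if_distrib[of "\<lambda>z. z * _"] cong: if_cong)
  have e5: "(\<Sum>l\<in>UNIV. partial_deriv l (\<lambda>y. X y $ l) x) * \<alpha> x $ k
      = - ((\<Sum>p\<in>UNIV. \<Sum>l\<in>UNIV. \<Gamma> l x $ l $ p * X x $ p) * \<alpha> x $ k)"
    using div0[OF x] unfolding divergence_def by (simp add: eq_neg_iff_add_eq_0 flip: distrib_right)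
  have "partial_deriv k (scalar_curvature G) x = 2 * ((1/m) * (?D - ?C))"
    unfolding contracted_bianchi[OF x, of k] e1 e2 e3 e4 e5 by (simp add: algebra_simps)
  moreover have "?D - ?C = - (1/2) * partial_deriv k N x"
  proof -
    have "(L x *v X x) $ k = 0" using killing[OF x] by simp
    \<comment> \<open>The vanishing of the Lie derivative of X* along X trades the derivatives of
      \<open>\<alpha>\<close> for those of \<open>X\<close>.\<close>
    then have "?D = - (\<Sum>l\<in>UNIV. \<alpha> x $ l * partial_deriv k (\<lambda>y. X y $ l) x)"
      unfolding lie_deriv_mult_X[OF x] by simp
    moreover have "?C = (\<Sum>p\<in>UNIV. \<Sum>l\<in>UNIV. \<alpha> x $ p * (X x $ l * \<Gamma> l x $ p $ k))"
      by (subst sum.swap) (simp add: connection_sym[OF x, of k] mult_ac)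
    ultimately have "?D - ?C = - (transpose (A x) *v \<alpha> x) $ k"
      by (simp add: matrix_vector_mult_def transpose_def covariant_deriv_def vector_jacobian_def
          sum.distrib distrib_right distrib_left sum_distrib_left mult_ac del: transpose_matrix_vector)
    then show ?thesis by (simp add: partial_sq_norm[OF x] del: transpose_matrix_vector)
  qed
  ultimately show ?thesis using dR m_nz by simp
qed

end

section \<open>Change of charts\<close>

lemma matrix_frechet_eq_jacobian:
  fixes T :: "real^'n \<Rightarrow> real^'n"
  assumes "T differentiable (at x)"
  shows "matrix (frechet_derivative T (at x)) = vector_jacobian T x"
proof -
  have T: "(T has_derivative frechet_derivative T (at x)) (at x)"
    by (rule differentiable_has_frechet[OF assms])
  have "partial_deriv i (\<lambda>y. T y $ k) x = frechet_derivative T (at x) (axis i 1) $ k" for i k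
    by (rule has_derivative_partial[OF bounded_linear.has_derivative[OF bounded_linear_vec_nth T]])
  then show ?thesis by (simp add: vec_eq_iff matrix_def vector_jacobian_def)
qed

locale chart_change =
  source: chart_vector_field V G X + target: chart_vector_field W G' X'
  for V W :: "(real^'n::finite) set" and G G' X X' +
  fixes T :: "real^'n \<Rightarrow> real^'n"
  assumes Ck_T: "\<And>k. Ck_on k T V" and T_in: "\<And>x. x \<in> V \<Longrightarrow> T x \<in> W"
    and G_change: "\<And>x. x \<in> V \<Longrightarrow> G x = transpose (vector_jacobian T x) ** G' (T x) ** vector_jacobian T x"
    and X_change: "\<And>x. x \<in> V \<Longrightarrow> X' (T x) = vector_jacobian T x *v X x"
begin

abbreviation "J \<equiv> vector_jacobian T"

lemma diff_T: "x \<in> V \<Longrightarrow> T differentiable (at x)"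
  using Ck_T[of "Suc 0"] by auto

lemma Ck_J: "Ck_on k (\<lambda>y. J y $ p $ i) V"
proof -
  have "Ck_on (Suc k) (\<lambda>y. T y $ p) V" by (rule Ck_on_nth[OF source.open_U Ck_T])
  then show ?thesis by (simp add: vector_jacobian_def Ck_on_partial_deriv del: Ck_on.simps)
qed

lemma diff_J: "x \<in> V \<Longrightarrow> (\<lambda>y. J y $ p $ i) differentiable (at x)"
  using Ck_J[of "Suc 0"] by auto

lemma hessian_sym:
  assumes x: "x \<in> V"
  shows "partial_deriv k (\<lambda>y. J y $ p $ j) x = partial_deriv j (\<lambda>y. J y $ p $ k) x"
  using partial_deriv_commute[OF source.open_U x Ck_on_nth[OF source.open_U Ck_T], of k j p]
  by (simp add: vector_jacobian_def)

lemma chain: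
  assumes x: "x \<in> V" and f: "f differentiable (at (T x))"
  shows "partial_deriv k (\<lambda>y. f (T y)) x = (\<Sum>q\<in>UNIV. J x $ q $ k * partial_deriv q f (T x))"
  using partial_deriv_chain[OF diff_T[OF x] f, of k] by (simp add: vector_jacobian_def)

lemma dual_form_change:
  assumes x: "x \<in> V"
  shows "dual_form G X x = transpose (J x) *v dual_form G' X' (T x)"
  unfolding source.dual_form_eq[OF x] target.dual_form_eq[OF T_in[OF x]] X_change[OF x] G_change[OF x]
  by (simp only: matrix_vector_mul_assoc matrix_mul_assoc)

lemma sq_norm_change: "x \<in> V \<Longrightarrow> sq_norm G X x = sq_norm G' X' (T x)"
  by (simp add: sq_norm_def dual_form_change X_change dot_lmul_matrix)

text \<open>By the transformation law, \<open>det (J x)\<close> is a factor of the positive number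
  \<open>det (G x)\<close>.\<close>

lemma invertible_J:
  assumes x: "x \<in> V" shows "invertible (J x)" and "det (J x) \<noteq> 0"
proof -
  have "det (G x) = det (J x) * det (G' (T x)) * det (J x)"
    by (subst G_change[OF x]) (simp add: det_mul)
  then show "det (J x) \<noteq> 0" using source.det_pos[OF x] by auto
  then show "invertible (J x)" by (simp add: invertible_det_nz)
qed

lemma volume_density_change:
  assumes x: "x \<in> V"
  shows "volume_density G x = \<bar>det (J x)\<bar> * volume_density G' (T x)"
proof -
  have "det (G x) = (det (J x))\<^sup>2 * det (G' (T x))"
    by (subst G_change[OF x]) (simp add: det_mul power2_eq_square)
  then show ?thesis by (simp add: volume_density_def real_sqrt_mult)
qed

text \<open>Cancelling \<open>transpose (J x)\<close> on the left in the transformation law shows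
  that \<open>?K\<close> is a right inverse of \<open>G' (T x)\<close>.\<close>

lemma inverse_metric_change:
  assumes x: "x \<in> V"
  shows "J x ** matrix_inv (G x) ** transpose (J x) = matrix_inv (G' (T x))"
proof -
  let ?K = "J x ** matrix_inv (G x) ** transpose (J x)"
  obtain B where B: "transpose (J x) ** B = mat 1" "B ** transpose (J x) = mat 1"
    using invertible_J[OF x] transpose_invertible unfolding invertible_def by blast
  have "transpose (J x) ** (G' (T x) ** ?K) = G x ** matrix_inv (G x) ** transpose (J x)"
    by (subst G_change[OF x]) (simp add: matrix_mul_assoc)
  then have "transpose (J x) ** (G' (T x) ** ?K) = transpose (J x)"
    by (simp add: source.G_H[OF x])
  then have "B ** transpose (J x) ** (G' (T x) ** ?K) = B ** transpose (J x)"
    by (simp flip: matrix_mul_assoc)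
  then have "G' (T x) ** ?K = mat 1" by (simp add: B)
  then have "matrix_inv (G' (T x)) ** G' (T x) ** ?K = matrix_inv (G' (T x))"
    by (simp flip: matrix_mul_assoc)
  then show ?thesis by (simp add: target.H_G[OF T_in[OF x]])
qed

text \<open>By \<open>lie_deriv_mult_X\<close> both covectors are Lie derivatives of X* along X.
  Differentiating X* and differentiating X each produce a term with second derivatives of
  \<open>T\<close>, and by the symmetry of the Hessian these are negatives of each other.\<close>

lemma lie_deriv_mult_change:
  assumes x: "x \<in> V"
  shows "lie_deriv_metric X G x *v X x = transpose (J x) *v (lie_deriv_metric X' G' (T x) *v X' (T x))"
proof -
  define b where "b p = dual_form G' X' (T x) $ p" for p
  define db where "db q p = partial_deriv q (\<lambda>y. dual_form G' X' y $ p) (T x)" for q p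
  define dX where "dX q p = partial_deriv q (\<lambda>y. X' y $ p) (T x)" for q p
  define dJ where "dJ k p j = partial_deriv k (\<lambda>y. J y $ p $ j) x" for k p j
  have db: "(\<lambda>y. dual_form G' X' y $ p) differentiable (at (T x))" for p
    using target.Ck_dual_form[of "Suc 0"] T_in[OF x] by auto
  have dbT: "(\<lambda>y. dual_form G' X' (T y) $ p) differentiable (at x)" for p
    using differentiable_chain_at[OF diff_T[OF x] db[of p]] by (simp add: o_def)
  have e1: "partial_deriv k (\<lambda>y. dual_form G X y $ j) x
      = (\<Sum>p\<in>UNIV. dJ k p j * b p + J x $ p $ j * (\<Sum>q\<in>UNIV. J x $ q $ k * db q p))" for k j
  proof -
    have "partial_deriv k (\<lambda>y. dual_form G X y $ j) x
      = partial_deriv k (\<lambda>y. \<Sum>p\<in>UNIV. J y $ p $ j * dual_form G' X' (T y) $ p) x"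
      by (rule partial_deriv_cong[OF source.open_U x])
         (simp add: dual_form_change matrix_vector_mult_def transpose_def del: transpose_matrix_vector)
    then show ?thesis
      by (simp add: partial_deriv_sum partial_deriv_mult differentiable_mult diff_J[OF x] dbT
          chain[OF x db] dJ_def b_def db_def)
  qed
  have e2: "(\<Sum>k\<in>UNIV. J x $ p $ k * partial_deriv j (\<lambda>y. X y $ k) x)
      = (\<Sum>q\<in>UNIV. J x $ q $ j * dX q p) - (\<Sum>k\<in>UNIV. dJ j p k * X x $ k)" for j p
  proof -
    have dX': "(\<lambda>y. X' y $ p) differentiable (at (T x))"
      by (rule target.diff_X[OF T_in[OF x]])
    have "partial_deriv j (\<lambda>y. X' (T y) $ p) x = partial_deriv j (\<lambda>y. \<Sum>k\<in>UNIV. J y $ p $ k * X y $ k) x"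
      by (rule partial_deriv_cong[OF source.open_U x]) (simp add: X_change matrix_vector_mult_def)
    then have "(\<Sum>q\<in>UNIV. J x $ q $ j * dX q p)
       = (\<Sum>k\<in>UNIV. dJ j p k * X x $ k + J x $ p $ k * partial_deriv j (\<lambda>y. X y $ k) x)"
      by (simp add: partial_deriv_sum partial_deriv_mult differentiable_mult diff_J[OF x] source.diff_X[OF x]
          chain[OF x dX'] dJ_def dX_def)
    then show ?thesis by (simp add: sum.distrib)
  qed
  have a: "dual_form G X x $ k = (\<Sum>p\<in>UNIV. J x $ p $ k * b p)" for k
    by (simp add: dual_form_change[OF x] matrix_vector_mult_def transpose_def b_def del: transpose_matrix_vector)
  have Xd: "X' (T x) $ q = (\<Sum>k\<in>UNIV. J x $ q $ k * X x $ k)" for q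
    by (simp add: X_change[OF x] matrix_vector_mult_def)
  have "(lie_deriv_metric X G x *v X x) $ j = (transpose (J x) *v (lie_deriv_metric X' G' (T x) *v X' (T x))) $ j" for j
  proof -
    \<comment> \<open>\<open>E\<close> collects the second-derivative term; it enters fact
      \<open>1\<close> with a plus and fact \<open>2\<close> with a minus sign.\<close>
    define E where "E = (\<Sum>k\<in>UNIV. \<Sum>p\<in>UNIV. X x $ k * (dJ k p j * b p))"
    have "(\<Sum>k\<in>UNIV. X x $ k * partial_deriv k (\<lambda>y. dual_form G X y $ j) x)
       = E + (\<Sum>k\<in>UNIV. \<Sum>p\<in>UNIV. \<Sum>q\<in>UNIV. J x $ p $ j * (J x $ q $ k * X x $ k * db q p))"
      by (simp add: e1 E_def sum.distrib distrib_left sum_distrib_left mult_ac)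
    also have "(\<Sum>k\<in>UNIV. \<Sum>p\<in>UNIV. \<Sum>q\<in>UNIV. J x $ p $ j * (J x $ q $ k * X x $ k * db q p))
       = (\<Sum>p\<in>UNIV. \<Sum>q\<in>UNIV. \<Sum>k\<in>UNIV. J x $ p $ j * (J x $ q $ k * X x $ k * db q p))"
      by (rule trans[OF sum3_swap12 sum3_swap23])
    also have "\<dots> = (\<Sum>p\<in>UNIV. J x $ p $ j * (\<Sum>q\<in>UNIV. X' (T x) $ q * db q p))"
      unfolding Xd by (simp add: sum_distrib_left sum_distrib_right)
    finally have 1: "(\<Sum>k\<in>UNIV. X x $ k * partial_deriv k (\<lambda>y. dual_form G X y $ j) x)
       = E + (\<Sum>p\<in>UNIV. J x $ p $ j * (\<Sum>q\<in>UNIV. X' (T x) $ q * db q p))" .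
    have "(\<Sum>k\<in>UNIV. dual_form G X x $ k * partial_deriv j (\<lambda>y. X y $ k) x)
       = (\<Sum>k\<in>UNIV. \<Sum>p\<in>UNIV. b p * (J x $ p $ k * partial_deriv j (\<lambda>y. X y $ k) x))"
      unfolding a sum_distrib_right by (intro sum.cong refl) simp
    also have "\<dots> = (\<Sum>p\<in>UNIV. \<Sum>k\<in>UNIV. b p * (J x $ p $ k * partial_deriv j (\<lambda>y. X y $ k) x))"
      by (rule sum.swap)
    also have "\<dots> = (\<Sum>p\<in>UNIV. b p * ((\<Sum>q\<in>UNIV. J x $ q $ j * dX q p) - (\<Sum>k\<in>UNIV. dJ j p k * X x $ k)))"
      by (simp only: e2 flip: sum_distrib_left)
    also have "\<dots> = (\<Sum>p\<in>UNIV. \<Sum>q\<in>UNIV. J x $ q $ j * (b p * dX q p)) - (\<Sum>p\<in>UNIV. \<Sum>k\<in>UNIV. X x $ k * (dJ k p j * b p))"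
      by (simp add: right_diff_distrib sum_subtractf sum_distrib_left mult_ac dJ_def hessian_sym[OF x, of j])
    also have "(\<Sum>p\<in>UNIV. \<Sum>k\<in>UNIV. X x $ k * (dJ k p j * b p)) = E"
      unfolding E_def by (rule sum.swap)
    also have "(\<Sum>p\<in>UNIV. \<Sum>q\<in>UNIV. J x $ q $ j * (b p * dX q p)) = (\<Sum>p\<in>UNIV. J x $ p $ j * (\<Sum>q\<in>UNIV. b q * dX p q))"
      unfolding sum_distrib_left by (rule sum.swap)
    finally have 2: "(\<Sum>k\<in>UNIV. dual_form G X x $ k * partial_deriv j (\<lambda>y. X y $ k) x)
      = (\<Sum>p\<in>UNIV. J x $ p $ j * (\<Sum>q\<in>UNIV. b q * dX p q)) - E" .
    have "(lie_deriv_metric X G x *v X x) $ j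
      = (\<Sum>p\<in>UNIV. J x $ p $ j * (\<Sum>q\<in>UNIV. X' (T x) $ q * db q p)) + (\<Sum>p\<in>UNIV. J x $ p $ j * (\<Sum>q\<in>UNIV. b q * dX p q))"
      unfolding source.lie_deriv_mult_X[OF x] 1 2 by simp
    also have "\<dots> = (\<Sum>p\<in>UNIV. J x $ p $ j * (lie_deriv_metric X' G' (T x) *v X' (T x)) $ p)"
      unfolding target.lie_deriv_mult_X[OF T_in[OF x]] b_def db_def dX_def by (simp add: sum.distrib distrib_left)
    also have "\<dots> = (transpose (J x) *v (lie_deriv_metric X' G' (T x) *v X' (T x))) $ j"
      by (subst (2) matrix_vector_mult_def) (simp add: transpose_def del: transpose_matrix_vector)
    finally show ?thesis .
  qed
  then show ?thesis by (simp add: vec_eq_iff)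
qed

lemma flux_change:
  assumes x: "x \<in> V"
  shows "flux G' X' m c (T x) = J x *v flux G X m c x"
proof -
  have "J x *v (matrix_inv (G x) *v (lie_deriv_metric X G x *v X x))
     = matrix_inv (G' (T x)) *v (lie_deriv_metric X' G' (T x) *v X' (T x))"
    unfolding lie_deriv_mult_change[OF x] inverse_metric_change[OF x, symmetric]
    by (simp only: matrix_vector_mul_assoc matrix_mul_assoc)
  then show ?thesis
    by (simp add: flux_def sq_norm_change[OF x] X_change[OF x] matrix_vector_mult_diff_distrib matrix_vector_mult_scaleR)
qed

text \<open>Supplies \<open>Z_change\<close> of the locale \<open>partitioned_flux\<close>: the
  divergence theorem uses Z across charts only as a derivation on functions.\<close>

lemma flux_derivative_change:
  assumes x: "x \<in> V" and f: "f differentiable (at (T x))"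
  shows "(\<Sum>i\<in>UNIV. flux G X m c x $ i * partial_deriv i (\<lambda>y. f (T y)) x)
    = (\<Sum>i\<in>UNIV. flux G' X' m c (T x) $ i * partial_deriv i f (T x))"
proof -
  have "(\<Sum>i\<in>UNIV. flux G X m c x $ i * partial_deriv i (\<lambda>y. f (T y)) x)
    = (\<Sum>i\<in>UNIV. \<Sum>q\<in>UNIV. J x $ q $ i * flux G X m c x $ i * partial_deriv q f (T x))"
    by (simp add: chain[OF x f] sum_distrib_left mult_ac)
  also have "\<dots> = (\<Sum>q\<in>UNIV. \<Sum>i\<in>UNIV. J x $ q $ i * flux G X m c x $ i * partial_deriv q f (T x))"
    by (rule sum.swap)
  finally show ?thesis
    by (simp add: flux_change[OF x] matrix_vector_mult_def sum_distrib_right)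
qed

end

section \<open>Integration in coordinates\<close>

subsection \<open>Integration by parts\<close>

lemma integral_supported:
  fixes F :: "'a::euclidean_space \<Rightarrow> real"
  assumes "\<And>x. x \<notin> S \<Longrightarrow> F x = 0"
  shows "integral UNIV F = integral S F"
proof -
  have "(\<lambda>x. if x \<in> S then F x else 0) = F" using assms by auto
  then show ?thesis using integral_restrict_UNIV[of S F] by simp
qed

lemma integral_translate_supported:
  fixes F :: "'a::euclidean_space \<Rightarrow> real"
  assumes "continuous_on UNIV F" "\<And>x. x \<notin> cbox a b \<Longrightarrow> F x = 0"
  shows "integral UNIV (\<lambda>x. F (x + c)) = integral UNIV F"
proof -
  have "(F has_integral integral (cbox a b) F) (cbox a b)"
    using assms(1) by (intro integrable_integral integrable_continuous) (auto intro: continuous_on_subset)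
  then have "((\<lambda>x. F (x + c)) has_integral integral (cbox a b) F) (cbox (a - c) (b - c))"
    using has_integral_affinity_iff[of 1 F c "integral (cbox a b) F" a b] by simp
  then have "integral (cbox (a - c) (b - c)) (\<lambda>x. F (x + c)) = integral (cbox a b) F"
    by (rule integral_unique)
  moreover have "integral UNIV (\<lambda>x. F (x + c)) = integral (cbox (a - c) (b - c)) (\<lambda>x. F (x + c))"
  proof (rule integral_supported)
    fix x assume "x \<notin> cbox (a - c) (b - c)"
    then have "x + c \<notin> cbox a b" by (auto simp: mem_box inner_diff_left inner_add_left algebra_simps)
    then show "F (x + c) = 0" by (rule assms(2))
  qed
  ultimately show ?thesis using integral_supported[of "cbox a b" F] assms(2) by simp
qed

text \<open>By translation invariance the integral of \<open>F (x + t *\<^sub>R e)\<close> does not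
  depend on \<open>t\<close>; differentiating under the integral sign at \<open>t = 0\<close> gives
  the claim.\<close>

lemma integral_partial_deriv_eq_0:
  fixes F :: "real^'n \<Rightarrow> real"
  assumes diff: "\<And>x. F differentiable (at x)" and cont: "continuous_on UNIV (partial_deriv i F)"
    and K: "compact K" "\<And>x. x \<notin> K \<Longrightarrow> F x = 0"
  shows "integral UNIV (partial_deriv i F) = 0"
proof -
  define e where "e = (axis i 1 :: real^'n)"
  obtain r where r: "\<And>x. x \<in> K \<Longrightarrow> norm x \<le> r"
    using compact_imp_bounded[OF K(1)] bounded_iff by blast
  \<comment> \<open>The margin 1 keeps the support of every translate with |t| at most 1 inside one
    box, so that the Leibniz rule applies on a fixed box.\<close>
  obtain a where a: "cball 0 (r + 1) \<subseteq> cbox (- a) (a :: real^'n)"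
    using bounded_subset_cbox_symmetric[OF bounded_cball] by blast
  have zero: "F (x + t *\<^sub>R e) = 0" if "x \<notin> cbox (- a) a" "\<bar>t\<bar> \<le> 1" for x t
  proof -
    have "norm x > r + 1"
    proof (rule ccontr)
      assume "\<not> norm x > r + 1"
      then have "x \<in> cball 0 (r + 1)" by simp
      then show False using that(1) a by blast
    qed
    moreover have "norm x \<le> norm (x + t *\<^sub>R e) + norm (t *\<^sub>R e)"
      using norm_triangle_ineq4[of "x + t *\<^sub>R e" "t *\<^sub>R e"] by simp
    moreover have "norm (t *\<^sub>R e) \<le> 1" using that by (simp add: e_def)
    ultimately have "x + t *\<^sub>R e \<notin> K" using r[of "x + t *\<^sub>R e"] by auto
    then show ?thesis by (rule K(2))
  qed
  have contF: "continuous_on UNIV F"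
    using diff by (auto intro!: continuous_at_imp_continuous_on differentiable_imp_continuous_within)
  let ?I = "\<lambda>t. integral (cbox (- a) a) (\<lambda>x. F (x + t *\<^sub>R e))"
  have const: "?I t = integral UNIV F" if "\<bar>t\<bar> \<le> 1" for t
  proof -
    have "?I t = integral UNIV (\<lambda>x. F (x + t *\<^sub>R e))"
      using zero that by (intro integral_supported[symmetric]) auto
    also have "\<dots> = integral UNIV F"
      using zero[of _ 0] by (intro integral_translate_supported[OF contF]) auto
    finally show ?thesis .
  qed
  have "(?I has_field_derivative integral (cbox (- a) a) (\<lambda>x. partial_deriv i F (x + 0 *\<^sub>R e))) (at 0 within {-1<..<1})"
  proof (rule leibniz_rule_field_derivative)
    show "((\<lambda>t. F (x + t *\<^sub>R e)) has_field_derivative partial_deriv i F (x + t *\<^sub>R e)) (at t within {-1<..<1})" for t x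
    proof -
      have F': "(F has_derivative frechet_derivative F (at (x + t *\<^sub>R e))) (at (x + t *\<^sub>R e))"
        by (rule differentiable_has_frechet[OF diff])
      have "((\<lambda>t. x + t *\<^sub>R e) has_derivative (\<lambda>d. d *\<^sub>R e)) (at t)"
        by (auto intro!: derivative_eq_intros)
      from has_derivative_compose[OF this F']
      have "((\<lambda>t. F (x + t *\<^sub>R e)) has_field_derivative partial_deriv i F (x + t *\<^sub>R e)) (at t)"
        unfolding has_field_derivative_def
        by (rule has_derivative_eq_rhs)
          (simp add: fun_eq_iff linear_cmul[OF has_derivative_linear[OF F']] partial_deriv_def flip: e_def)
      then show ?thesis by (rule has_field_derivative_at_within)
    qed
    show "(\<lambda>x. F (x + t *\<^sub>R e)) integrable_on cbox (- a) a" for t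
      by (rule integrable_continuous, rule continuous_on_compose2[OF contF]) (auto intro!: continuous_intros)
    show "continuous_on ({-1<..<1} \<times> cbox (- a) a) (\<lambda>(t, x). partial_deriv i F (x + t *\<^sub>R e))"
      unfolding case_prod_beta by (rule continuous_on_compose2[OF cont]) (auto intro!: continuous_intros)
  qed auto
  then have "(?I has_field_derivative integral (cbox (- a) a) (partial_deriv i F)) (at 0)"
    by (simp add: at_within_open[of 0 "{-1<..<1}"] del: at_within_open_NO_MATCH)
  moreover have "(?I has_field_derivative 0) (at 0)"
  proof -
    have "((\<lambda>t. integral UNIV F) has_field_derivative 0) (at (0::real))" by simp
    then show ?thesis
      by (rule has_field_derivative_transform_within_open[of _ _ _ "{-1<..<1}"]) (auto simp: const)
  qed
  ultimately have "integral (cbox (- a) a) (partial_deriv i F) = 0"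
    by (rule DERIV_unique)
  moreover have "partial_deriv i F x = 0" if "x \<notin> cbox (- a) a" for x
  proof -
    have "partial_deriv i F x = partial_deriv i (\<lambda>y. 0) x"
      by (rule partial_deriv_cong[where U="- cbox (- a) a"]) (use that zero[of _ 0] in auto)
    then show ?thesis by (simp add: partial_deriv_const)
  qed
  ultimately show ?thesis by (simp add: integral_supported[of "cbox (- a) a"])
qed

subsection \<open>Change of variables\<close>

lemma absolutely_integrable_supported:
  fixes F :: "'a::euclidean_space \<Rightarrow> 'b::euclidean_space"
  assumes "continuous_on UNIV F" and K: "compact K" "\<And>x. x \<notin> K \<Longrightarrow> F x = 0" "K \<subseteq> W"
  shows "F absolutely_integrable_on W"
proof -
  obtain a where a: "K \<subseteq> cbox (- a) a"
    using bounded_subset_cbox_symmetric[OF compact_imp_bounded[OF K(1)]] by blast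
  have "F absolutely_integrable_on cbox (- a) a"
    using assms(1) by (intro absolutely_integrable_continuous) (auto intro: continuous_on_subset)
  then have "F absolutely_integrable_on K"
    by (rule set_integrable_subset) (use K(1) a in \<open>auto simp: compact_imp_closed lmeasurable_compact fmeasurableD\<close>)
  moreover have "(\<lambda>x. indicator W x *\<^sub>R F x) = (\<lambda>x. indicator K x *\<^sub>R F x)"
    using K by (auto simp: fun_eq_iff indicator_def)
  ultimately show ?thesis by (simp add: set_integrable_def)
qed

lemma continuous_nonneg_integral_eq_0:
  fixes f :: "'a::euclidean_space \<Rightarrow> real"
  assumes "continuous_on UNIV f" "\<And>x. f x \<ge> 0" "compact K" "\<And>x. x \<notin> K \<Longrightarrow> f x = 0" "integral UNIV f = 0"
  shows "f x = 0"
proof -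
  obtain a where a: "insert x K \<subseteq> cbox (- a) a"
    using bounded_subset_cbox_symmetric[of "insert x K"] compact_imp_bounded[OF assms(3)] by auto
  obtain b where b: "cbox (- a) a \<subseteq> box (- b) b"
    using bounded_subset_box_symmetric[OF bounded_cbox] by blast
  have "integral (cbox (- b) b) f = 0"
    using integral_supported[of "cbox (- b) b" f] assms(4,5) a b box_subset_cbox[of "- b" b] by auto
  then have "(f has_integral 0) (cbox (- b) b)"
    using assms(1) by (metis continuous_on_subset integrable_continuous integrable_integral top_greatest)
  then show ?thesis
    using has_integral_0_cbox_imp_0[of "- b" b f x] assms(1,2) a b box_subset_cbox[of "- b" b]
    by (auto intro: continuous_on_subset)
qed

lemma change_of_variables_wellorder:
  fixes T :: "real^'m::{finite,wellorder} \<Rightarrow> real^'m::_" and F F' :: "real^'m::_ \<Rightarrow> real"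
  assumes V: "open V" and T': "\<And>x. x \<in> V \<Longrightarrow> (T has_derivative T' x) (at x)" and inj: "inj_on T V"
    and F': "continuous_on UNIV F'" "compact K" "K \<subseteq> T ` V" "\<And>x. x \<notin> K \<Longrightarrow> F' x = 0"
    and F: "\<And>x. x \<in> V \<Longrightarrow> F x = \<bar>det (matrix (T' x))\<bar> * F' (T x)" "\<And>x. x \<notin> V \<Longrightarrow> F x = 0"
  shows "integral UNIV F = integral UNIV F'"
proof -
  \<comment> \<open>\<open>integral_change_of_variables\<close> takes vector-valued integrands, so
    the values are wrapped in \<open>real^1\<close> and read off by component afterwards.\<close>
  define f where "f x = (vec (F' x) :: real^1)" for x
  have "continuous_on UNIV f"
    unfolding f_def vec_def using F'(1) by (intro continuous_intros)
  then have f: "f absolutely_integrable_on (T ` V)"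
    by (rule absolutely_integrable_supported[OF _ F'(2) _ F'(3)]) (use F'(4) in \<open>simp add: f_def vec_eq_iff\<close>)
  have T'': "(T has_derivative T' x) (at x within V)" if "x \<in> V" for x
    using T'[OF that] has_derivative_at_withinI by blast
  have V': "V \<in> sets lebesgue" using V by simp
  have eq: "integral (T ` V) f = integral V (\<lambda>x. \<bar>det (matrix (T' x))\<bar> *\<^sub>R f (T x))"
    by (rule integral_change_of_variables[OF V' T'' inj disjI1[OF f]])
  have f': "(\<lambda>x. \<bar>det (matrix (T' x))\<bar> *\<^sub>R f (T x)) absolutely_integrable_on V"
    using absolutely_integrable_change_of_variables[OF V' T'' inj, of f] f by simp
  have "integral UNIV F' = integral (T ` V) F'"
    using F' by (intro integral_supported) auto
  also have "\<dots> = integral (T ` V) f $ 1"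
    using f by (simp add: f_def absolutely_integrable_on_def flip: integral_component_eq_cart)
  also have "\<dots> = integral V (\<lambda>x. (\<bar>det (matrix (T' x))\<bar> *\<^sub>R f (T x)) $ 1)"
    unfolding eq using f' by (intro integral_component_eq_cart[symmetric]) (simp add: absolutely_integrable_on_def)
  also have "\<dots> = integral V F"
    using F(1) by (intro integral_cong) (simp add: f_def)
  also have "\<dots> = integral UNIV F"
    using F(2) by (intro integral_supported[symmetric])
  finally show ?thesis by simp
qed

text \<open>The library states the change of variables theorem for well-ordered index types only. Every
  finite type is in bijection with a well-ordered copy of itself.\<close>

typedef 'n ordered_copy = "UNIV :: 'n set" by auto

definition index_code :: "'n::finite \<Rightarrow> nat"
  where "index_code = (SOME f. inj f)"

lemma inj_index_code: "inj (index_code :: 'n::finite \<Rightarrow> nat)"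
proof -
  have "\<exists>f::'n \<Rightarrow> nat. inj f"
    using finite_imp_inj_to_nat_seg[of "UNIV :: 'n set"] by auto
  then show ?thesis unfolding index_code_def by (rule someI_ex)
qed

instance ordered_copy :: (finite) finite
proof
  have "(UNIV :: 'a ordered_copy set) = range Abs_ordered_copy"
    by (metis Abs_ordered_copy_cases UNIV_eq_I rangeI)
  then show "finite (UNIV :: 'a ordered_copy set)" by (metis finite finite_imageI)
qed

text \<open>The order of the natural numbers is pulled back along an injection, which makes it
  linear and well-founded.\<close>

instantiation ordered_copy :: (finite) wellorder
begin

definition "x \<le> y \<longleftrightarrow> index_code (Rep_ordered_copy x) \<le> index_code (Rep_ordered_copy y)"

definition "x < y \<longleftrightarrow> index_code (Rep_ordered_copy x) < index_code (Rep_ordered_copy y)"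

instance
proof
  fix x y z :: "'a ordered_copy" and P
  show "x < y \<longleftrightarrow> x \<le> y \<and> \<not> y \<le> x" "x \<le> x" "x \<le> y \<or> y \<le> x"
    by (auto simp: less_ordered_copy_def less_eq_ordered_copy_def)
  show "x \<le> z" if "x \<le> y" "y \<le> z" using that by (simp add: less_eq_ordered_copy_def)
  show "x = y" if "x \<le> y" "y \<le> x"
  proof -
    have "index_code (Rep_ordered_copy x) = index_code (Rep_ordered_copy y)"
      using that by (simp add: less_eq_ordered_copy_def)
    then show ?thesis by (meson Rep_ordered_copy_inject injD inj_index_code)
  qed
  show "P x" if "\<And>x. (\<And>y. y < x \<Longrightarrow> P y) \<Longrightarrow> P x"
    by (induction x rule: measure_induct_rule[of "\<lambda>x. index_code (Rep_ordered_copy x)"])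
       (use that in \<open>simp add: less_ordered_copy_def\<close>)
qed

end

section \<open>Reindexing coordinates by the ordered copy, and the change of variables
  formula\<close>

definition from_copy :: "real^('n ordered_copy) \<Rightarrow> real^'n::finite"
  where "from_copy y = (\<chi> i. y $ Abs_ordered_copy i)"

definition to_copy :: "real^'n::finite \<Rightarrow> real^('n ordered_copy)"
  where "to_copy x = (\<chi> j. x $ Rep_ordered_copy j)"

lemma to_from_copy [simp]: "to_copy (from_copy y) = y"
  by (simp add: to_copy_def from_copy_def Rep_ordered_copy_inverse)

lemma from_to_copy [simp]: "from_copy (to_copy x) = x"
  by (simp add: to_copy_def from_copy_def Abs_ordered_copy_inverse)

lemma linear_from_copy: "linear from_copy"
  by (rule linearI) (simp_all add: from_copy_def vec_eq_iff)

lemma linear_to_copy: "linear to_copy"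
  by (rule linearI) (simp_all add: to_copy_def vec_eq_iff)

lemma bij_Abs_ordered_copy: "bij Abs_ordered_copy"
  by (metis Abs_ordered_copy_cases Abs_ordered_copy_inject UNIV_I bijI inj_onI surjI)

lemma from_copy_cbox: "from_copy ` cbox u v = cbox (from_copy u) (from_copy v)"
proof -
  have "x \<in> cbox (from_copy u) (from_copy v) \<longleftrightarrow> to_copy x \<in> cbox u v" for x
  proof -
    have "(\<forall>j. u $ j \<le> x $ Rep_ordered_copy j \<and> x $ Rep_ordered_copy j \<le> v $ j) \<longleftrightarrow>
       (\<forall>i. u $ Abs_ordered_copy i \<le> x $ i \<and> x $ i \<le> v $ Abs_ordered_copy i)"
      by (metis Abs_ordered_copy_inverse Rep_ordered_copy_inverse UNIV_I)
    then show ?thesis by (simp add: mem_box_cart from_copy_def to_copy_def)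
  qed
  note iff = this
  show ?thesis
  proof (rule set_eqI)
    fix x
    show "x \<in> from_copy ` cbox u v \<longleftrightarrow> x \<in> cbox (from_copy u) (from_copy v)"
      unfolding iff by (auto intro: image_eqI[of _ from_copy "to_copy x"])
  qed
qed

lemma to_copy_cbox: "to_copy ` cbox u v = cbox (to_copy u) (to_copy v)"
proof -
  have "to_copy ` cbox u v = to_copy ` from_copy ` cbox (to_copy u) (to_copy v)"
    by (simp add: from_copy_cbox)
  then show ?thesis by (simp add: image_image)
qed

lemma content_from_copy: "measure lborel (from_copy ` cbox u v) = measure lborel (cbox u v)"
proof (cases "cbox u v = {}")
  case False
  then have ne: "cbox (from_copy u) (from_copy v) \<noteq> {}" by (metis from_copy_cbox image_is_empty)
  show ?thesis
    unfolding from_copy_cbox content_cbox_cart[OF ne] content_cbox_cart[OF False]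
    using prod.reindex_bij_betw[OF bij_Abs_ordered_copy, of "\<lambda>j. v $ j - u $ j"]
    by (simp add: from_copy_def)
qed auto

text \<open>Reindexing coordinates maps boxes to boxes of equal content, so the substitution has
  factor 1.\<close>

lemma integral_from_copy:
  fixes F :: "real^'n::finite \<Rightarrow> real"
  assumes "continuous_on UNIV F" and K: "compact K" "\<And>x. x \<notin> K \<Longrightarrow> F x = 0"
  shows "integral UNIV (\<lambda>y. F (from_copy y)) = integral UNIV F"
proof -
  obtain a where a: "K \<subseteq> cbox (- a) a"
    using bounded_subset_cbox_symmetric[OF compact_imp_bounded[OF K(1)]] by blast
  have "(F has_integral integral (cbox (- a) a) F) (cbox (- a) a)"
    using assms(1) by (intro integrable_integral integrable_continuous) (auto intro: continuous_on_subset)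
  then have "((\<lambda>y. F (from_copy y)) has_integral (1 / 1) *\<^sub>R integral (cbox (- a) a) F) (to_copy ` cbox (- a) a)"
    by (intro has_integral_twiddle)
       (auto simp: from_copy_cbox to_copy_cbox content_from_copy[unfolded from_copy_cbox] linear_continuous_at linear_from_copy linear_conv_bounded_linear[symmetric])
  then have "integral (to_copy ` cbox (- a) a) (\<lambda>y. F (from_copy y)) = integral (cbox (- a) a) F"
    by (simp add: integral_unique)
  moreover have "F (from_copy y) = 0" if "y \<notin> to_copy ` cbox (- a) a" for y
  proof -
    have "from_copy y \<notin> cbox (- a) a" using that by (metis image_eqI to_from_copy)
    then show ?thesis using a K by blast
  qed
  moreover have "F x = 0" if "x \<notin> cbox (- a) a" for x using that a K by blast
  ultimately show ?thesis
    using integral_supported[of "to_copy ` cbox (- a) a" "\<lambda>y. F (from_copy y)"] integral_supported[of "cbox (- a) a" F] by simp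
qed

text \<open>Conjugation by \<open>f\<close> is a sign-preserving bijection between the permutations
  of the two index sets, and it matches the products in the Leibniz expansions.\<close>

lemma det_reindex:
  fixes M :: "real^'n^'n" and f :: "'n::finite \<Rightarrow> 'k::finite"
  assumes f: "bij f" and N: "\<And>i j. N $ f i $ f j = M $ i $ j"
  shows "det N = det M"
proof -
  let ?c = "map_permutation UNIV f"
  have c: "?c p = f \<circ> p \<circ> inv f" if "p permutes UNIV" for p
    using f by (auto simp: map_permutation_def restrict_id_def bij_is_surj)
  have bij: "bij_betw ?c {p. p permutes UNIV} {p. p permutes UNIV}"
  proof (rule bij_betw_byWitness[where f'="map_permutation UNIV (inv f)"])
    have f': "bij (inv f)" using f by (rule bij_imp_bij_inv)
    have c': "map_permutation UNIV (inv f) p = inv f \<circ> p \<circ> f" if "p permutes UNIV" for p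
      using f f' by (auto simp: map_permutation_def restrict_id_def bij_is_surj inv_inv_eq)
    have 1: "?c p permutes UNIV" if "p permutes UNIV" for p
      using that f by (intro map_permutation_permutes)
    have 2: "map_permutation UNIV (inv f) p permutes UNIV" if "p permutes UNIV" for p
      using that f' by (intro map_permutation_permutes)
    show "\<forall>p\<in>{p. p permutes UNIV}. map_permutation UNIV (inv f) (?c p) = p"
    proof
      fix p :: "'n \<Rightarrow> 'n" assume "p \<in> {p. p permutes UNIV}"
      then have "map_permutation UNIV (inv f) (?c p) = inv f \<circ> (f \<circ> p \<circ> inv f) \<circ> f"
        using c'[OF 1] c by simp
      then show "map_permutation UNIV (inv f) (?c p) = p"
        using f by (simp add: fun_eq_iff bij_is_inj inv_f_f)
    qed
    show "\<forall>p\<in>{p. p permutes UNIV}. ?c (map_permutation UNIV (inv f) p) = p"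
    proof
      fix p :: "'k \<Rightarrow> 'k" assume "p \<in> {p. p permutes UNIV}"
      then have "?c (map_permutation UNIV (inv f) p) = f \<circ> (inv f \<circ> p \<circ> f) \<circ> inv f"
        using c[OF 2] c' by simp
      then show "?c (map_permutation UNIV (inv f) p) = p"
        using f by (simp add: fun_eq_iff bij_is_surj surj_f_inv_f)
    qed
    show "?c ` {p. p permutes UNIV} \<subseteq> {p. p permutes UNIV}"
      "map_permutation UNIV (inv f) ` {p. p permutes UNIV} \<subseteq> {p. p permutes UNIV}"
      using 1 2 by auto
  qed
  have "det N = (\<Sum>p | p permutes UNIV. of_int (sign (?c p)) * (\<Prod>i\<in>UNIV. N $ i $ ?c p i))"
    unfolding det_def using sum.reindex_bij_betw[OF bij, symmetric] by blast
  also have "\<dots> = (\<Sum>p | p permutes UNIV. of_int (sign p) * (\<Prod>i\<in>UNIV. M $ i $ p i))"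
  proof (intro sum.cong refl)
    fix p :: "'n \<Rightarrow> 'n" assume "p \<in> {p. p permutes UNIV}"
    then have p: "p permutes UNIV" by simp
    have "(\<Prod>i\<in>UNIV. N $ i $ ?c p i) = (\<Prod>i\<in>UNIV. N $ f i $ ?c p (f i))"
      using prod.reindex_bij_betw[of f UNIV UNIV "\<lambda>i. N $ i $ ?c p i"] f by simp
    also have "\<dots> = (\<Prod>i\<in>UNIV. M $ i $ p i)"
      using f by (simp add: c[OF p] N bij_is_inj)
    finally show "of_int (sign (?c p)) * (\<Prod>i\<in>UNIV. N $ i $ ?c p i) = of_int (sign p) * (\<Prod>i\<in>UNIV. M $ i $ p i)"
      using sign_map_permutation[of f UNIV p] f p by (simp add: bij_is_inj)
  qed
  finally show ?thesis by (simp add: det_def)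
qed

text \<open>Conjugating \<open>T\<close> by the linear reindexing of coordinates alters neither the
  integrals nor the Jacobian determinant, and brings the map to a well-ordered index type.\<close>

lemma change_of_variables_supported:
  fixes T :: "real^'n::finite \<Rightarrow> real^'n" and F F' :: "real^'n \<Rightarrow> real"
  assumes V: "open V" and T': "\<And>x. x \<in> V \<Longrightarrow> (T has_derivative T' x) (at x)" and inj: "inj_on T V"
    and F': "continuous_on UNIV F'" "compact K'" "K' \<subseteq> T ` V" "\<And>x. x \<notin> K' \<Longrightarrow> F' x = 0"
    and F: "continuous_on UNIV F" "compact K" "K \<subseteq> V" "\<And>x. x \<notin> K \<Longrightarrow> F x = 0"
    and eq: "\<And>x. x \<in> V \<Longrightarrow> F x = \<bar>det (matrix (T' x))\<bar> * F' (T x)"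
  shows "integral UNIV F = integral UNIV F'"
proof -
  have cont_from: "continuous_on A from_copy" and cont_to: "continuous_on B to_copy"
    for A :: "(real^'n ordered_copy) set" and B :: "(real^'n) set"
    using linear_from_copy linear_to_copy by (auto intro!: linear_continuous_on simp: linear_conv_bounded_linear)
  have vimage: "to_copy ` A = from_copy -` A" for A :: "(real^'n) set"
  proof (rule set_eqI)
    fix y
    show "y \<in> to_copy ` A \<longleftrightarrow> y \<in> from_copy -` A"
      by (auto intro: image_eqI[of _ to_copy "from_copy y"])
  qed
  have "integral UNIV (\<lambda>y. F (from_copy y)) = integral UNIV (\<lambda>y. F' (from_copy y))"
  proof (rule change_of_variables_wellorder)
    show "open (to_copy ` V)"
      unfolding vimage using V cont_from[of UNIV] by (simp add: continuous_on_open_vimage)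
    show "((\<lambda>y. to_copy (T (from_copy y))) has_derivative (\<lambda>v. to_copy (T' (from_copy y) (from_copy v)))) (at y)"
      if "y \<in> to_copy ` V" for y
    proof -
      have f: "(from_copy has_derivative from_copy) (at y)"
        by (rule linear_imp_has_derivative[OF linear_from_copy])
      have "(T has_derivative T' (from_copy y)) (at (from_copy y))" using T' that by auto
      from has_derivative_compose[OF f this]
      have "((\<lambda>y. T (from_copy y)) has_derivative (\<lambda>v. T' (from_copy y) (from_copy v))) (at y)" .
      from has_derivative_compose[OF this linear_imp_has_derivative[OF linear_to_copy]] show ?thesis .
    qed
    show "inj_on (\<lambda>y. to_copy (T (from_copy y))) (to_copy ` V)"
      using inj by (auto simp: inj_on_def) (metis from_to_copy)
    show "continuous_on UNIV (\<lambda>y. F' (from_copy y))"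
      by (rule continuous_on_compose2[OF F'(1) cont_from]) auto
    show "compact (to_copy ` K')" by (rule compact_continuous_image[OF cont_to F'(2)])
    show "to_copy ` K' \<subseteq> (\<lambda>y. to_copy (T (from_copy y))) ` to_copy ` V"
      using F'(3) by (auto simp: image_image)
    show "F' (from_copy y) = 0" if "y \<notin> to_copy ` K'" for y
      using that F'(4) by (simp add: vimage)
    show "F (from_copy y) = \<bar>det (matrix (\<lambda>v. to_copy (T' (from_copy y) (from_copy v))))\<bar> * F' (from_copy (to_copy (T (from_copy y))))"
      if "y \<in> to_copy ` V" for y
    proof -
      have "axis (Abs_ordered_copy j) 1 = (to_copy (axis j 1) :: real^('n ordered_copy))" for j
        by (simp add: vec_eq_iff to_copy_def axis_def) (metis Abs_ordered_copy_inverse Rep_ordered_copy_inverse UNIV_I)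
      then have "det (matrix (\<lambda>v. to_copy (T' (from_copy y) (from_copy v)))) = det (matrix (T' (from_copy y)))"
        by (intro det_reindex[OF bij_Abs_ordered_copy])
           (simp add: matrix_def to_copy_def[of "T' _ _"] Abs_ordered_copy_inverse)
      moreover have "from_copy y \<in> V" using that by (simp add: vimage)
      ultimately show ?thesis by (simp add: eq)
    qed
    show "F (from_copy y) = 0" if "y \<notin> to_copy ` V" for y
      using that F(3,4) by (auto simp: vimage)
  qed
  then show ?thesis by (simp add: integral_from_copy[OF F(1,2,4)] integral_from_copy[OF F'(1,2,4)])
qed

section \<open>Charts and bump functions\<close>

lemma Ck_on_Un:
  assumes "open S" "open T" "Ck_on k f S" "Ck_on k f T"
  shows "Ck_on k f (S \<union> T)"
  using assms(3,4)
proof (induction k arbitrary: f)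
  case 0
  then show ?case using assms(1,2) by (auto intro: continuous_on_open_Un)
qed auto

lemma Ck_on_open_cover:
  assumes "open S" "open T" "U \<subseteq> S \<union> T" "Ck_on k f S" "Ck_on k f T"
  shows "Ck_on k f U"
  using Ck_on_subset[OF Ck_on_Un[OF assms(1,2,4,5)] assms(3)] .

lemma max_sq_has_derivative: "((\<lambda>t. (max 0 t)\<^sup>2) has_real_derivative 2 * max 0 t) (at t)"
proof (cases t "0::real" rule: linorder_cases)
  case less
  have "((\<lambda>t. 0) has_real_derivative 0) (at t)" by simp
  then have "((\<lambda>t. (max 0 t)\<^sup>2) has_real_derivative 0) (at t)"
    by (rule has_field_derivative_transform_within_open[of _ _ _ "{..<0}"]) (use less in auto)
  then show ?thesis using less by simp
next
  case greater
  have "((\<lambda>t. t\<^sup>2) has_real_derivative 2 * t) (at t)"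
    by (auto intro!: derivative_eq_intros)
  then have "((\<lambda>t. (max 0 t)\<^sup>2) has_real_derivative 2 * t) (at t)"
    by (rule has_field_derivative_transform_within_open[of _ _ _ "{0<..}"]) (use greater in auto)
  then show ?thesis using greater by simp
next
  case equal
  \<comment> \<open>At the kink the difference quotient is bounded by |h|, so the derivatives from
    both sides are 0.\<close>
  have "(\<lambda>h. ((max 0 (0 + h))\<^sup>2 - (max 0 0)\<^sup>2) / h) \<midarrow>0\<rightarrow> (0::real)"
  proof (rule Lim_null_comparison)
    show "\<forall>\<^sub>F h in at 0. norm (((max 0 (0 + h))\<^sup>2 - (max 0 0)\<^sup>2) / h) \<le> \<bar>h :: real\<bar>"
    proof (intro always_eventually allI)
      fix h :: real
      show "norm (((max 0 (0 + h))\<^sup>2 - (max 0 0)\<^sup>2) / h) \<le> \<bar>h\<bar>"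
        by (cases "h > 0") (simp_all add: power2_eq_square)
    qed
    show "(\<lambda>h. \<bar>h :: real\<bar>) \<midarrow>0\<rightarrow> 0" by (rule tendsto_rabs_zero) (rule tendsto_ident_at)
  qed
  then show ?thesis using equal by (simp add: DERIV_def)
qed

text \<open>The square of a positive part is C^1 and, for \<open>r \<ge> 0\<close>, positive exactly
  on the open ball. One derivative is what the divergence theorem takes of the partition
  functions.\<close>

definition euclidean_bump :: "real^'n \<Rightarrow> real \<Rightarrow> real^'n \<Rightarrow> real"
  where "euclidean_bump a r x = (max 0 (r\<^sup>2 - (x - a) \<bullet> (x - a)))\<^sup>2"

lemma euclidean_bump_eq_0: "0 \<le> r \<Longrightarrow> x \<notin> ball a r \<Longrightarrow> euclidean_bump a r x = 0"
  using power_mono[of r "norm (x - a)" 2]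
  by (simp add: euclidean_bump_def dist_norm norm_minus_commute dot_square_norm)

lemma euclidean_bump_pos: "x \<in> ball a r \<Longrightarrow> euclidean_bump a r x > 0"
proof -
  assume "x \<in> ball a r"
  then have "norm (x - a) < r" by (simp add: dist_norm norm_minus_commute)
  then have "(norm (x - a))\<^sup>2 < r\<^sup>2" by (intro power_strict_mono) auto
  then show ?thesis by (simp add: euclidean_bump_def dot_square_norm)
qed

lemma Ck_euclidean_bump: "Ck_on (Suc 0) (euclidean_bump a r) UNIV"
proof (rule Ck_on_SucI[OF open_UNIV])
  show "(euclidean_bump a r has_derivative
      (\<lambda>v. 2 * max 0 (r\<^sup>2 - (x - a) \<bullet> (x - a)) * (- 2 * ((x - a) \<bullet> v)))) (at x)" for x
  proof -
    have "((\<lambda>x. r\<^sup>2 - (x - a) \<bullet> (x - a)) has_derivative (\<lambda>v. - 2 * ((x - a) \<bullet> v))) (at x)"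
      by (auto intro!: derivative_eq_intros simp: inner_commute)
    from has_derivative_compose[OF this max_sq_has_derivative[of "r\<^sup>2 - (x - a) \<bullet> (x - a)",
        unfolded has_field_derivative_def]]
    show ?thesis by (simp add: euclidean_bump_def[abs_def])
  qed
  show "Ck_on 0 (\<lambda>x. 2 * max 0 (r\<^sup>2 - (x - a) \<bullet> (x - a)) * (- 2 * ((x - a) \<bullet> v))) UNIV" for v
    by (auto intro!: continuous_intros)
qed

definition chart_inv :: "('a, 'n::finite) chart \<Rightarrow> real^'n \<Rightarrow> 'a"
  where "chart_inv c = inv_into (chart_dom c) (chart_map c)"

definition C1_function :: "('a, 'n::finite) chart set \<Rightarrow> ('a \<Rightarrow> real) \<Rightarrow> bool"
  where "C1_function A \<phi> \<longleftrightarrow> (\<forall>c\<in>A. Ck_on (Suc 0) (\<lambda>x. \<phi> (chart_inv c x)) (chart_image c))"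

text \<open>Chart, centre and radius. A closed ball inside the chart image has compact, hence
  closed, preimage in the manifold, and the chart of the disc is where its bump is
  integrated.\<close>

type_synonym ('a, 'n) disc = "('a, 'n) chart \<times> (real, 'n) vec \<times> real"

abbreviation disc_chart :: "('a, 'n::finite) disc \<Rightarrow> ('a, 'n) chart"
  where "disc_chart \<equiv> fst"

definition disc_set :: "('a, 'n::finite) disc \<Rightarrow> (real^'n) set"
  where "disc_set j = cball (fst (snd j)) (snd (snd j))"

definition disc_in :: "('a, 'n::finite) chart set \<Rightarrow> ('a, 'n) disc \<Rightarrow> bool"
  where "disc_in A j \<longleftrightarrow> disc_chart j \<in> A \<and> 0 < snd (snd j) \<and> disc_set j \<subseteq> chart_image (disc_chart j)"

definition bump :: "('a, 'n::finite) disc \<Rightarrow> 'a \<Rightarrow> real"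
  where "bump j p = (if p \<in> chart_dom (disc_chart j)
    then euclidean_bump (fst (snd j)) (snd (snd j)) (chart_map (disc_chart j) p) else 0)"

definition disc_support :: "('a, 'n::finite) disc \<Rightarrow> 'a set"
  where "disc_support j = chart_inv (disc_chart j) ` disc_set j"

section \<open>Charts as homeomorphisms and transition maps\<close>

locale atlas =
  fixes M :: "'a topology" and A :: "('a, 'n::finite) chart set"
  assumes manifold: "smooth_manifold M A"
begin

lemma Hausdorff: "Hausdorff_space M" and charts: "c \<in> A \<Longrightarrow> chart_on M c"
  and cover: "(\<Union>c\<in>A. chart_dom c) = topspace M"
  and Ck_transition: "c \<in> A \<Longrightarrow> d \<in> A \<Longrightarrow> Ck_on k (transition c d) (overlap c d)"
  using manifold by (auto simp: smooth_manifold_def smooth_on_def)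

context
  fixes c assumes c: "c \<in> A"
begin

lemma openin_dom: "openin M (chart_dom c)" and open_image: "open (chart_image c)"
  and homeo: "homeomorphic_map (subtopology M (chart_dom c)) (top_of_set (chart_image c)) (chart_map c)"
  using charts[OF c] by (auto simp: chart_on_def)

lemma topspace_dom: "topspace (subtopology M (chart_dom c)) = chart_dom c"
  using openin_subset[OF openin_dom] by auto

lemma inj_chart: "inj_on (chart_map c) (chart_dom c)"
  using homeomorphic_imp_injective_map[OF homeo] topspace_dom by simp

lemma chart_inv_map [simp]: "p \<in> chart_dom c \<Longrightarrow> chart_inv c (chart_map c p) = p"
  unfolding chart_inv_def by (rule inv_into_f_f[OF inj_chart])

lemma chart_map_inv [simp]: "x \<in> chart_image c \<Longrightarrow> chart_map c (chart_inv c x) = x"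
  and chart_inv_in [simp]: "x \<in> chart_image c \<Longrightarrow> chart_inv c x \<in> chart_dom c"
  unfolding chart_inv_def chart_image_def by (auto intro: f_inv_into_f inv_into_into)

lemma chart_map_in: "p \<in> chart_dom c \<Longrightarrow> chart_map c p \<in> chart_image c"
  by (simp add: chart_image_def)

lemma open_chart_map:
  assumes "openin M W" shows "open (chart_map c ` (chart_dom c \<inter> W))"
proof -
  have "openin (subtopology M (chart_dom c)) (chart_dom c \<inter> W)"
    using assms by (auto simp: openin_subtopology)
  then have "openin (top_of_set (chart_image c)) (chart_map c ` (chart_dom c \<inter> W))"
    using homeomorphic_imp_open_map[OF homeo] by (simp add: open_map_def)
  then show ?thesis using open_image openin_open_trans by blast
qed

lemma openin_chart_preimage:
  assumes "open W" shows "openin M {p \<in> chart_dom c. chart_map c p \<in> W}"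
proof -
  have "openin (top_of_set (chart_image c)) (chart_image c \<inter> W)"
    using assms by (simp add: openin_open_Int)
  then have "openin (subtopology M (chart_dom c)) {p \<in> topspace (subtopology M (chart_dom c)). chart_map c p \<in> chart_image c \<inter> W}"
    using homeomorphic_imp_continuous_map[OF homeo] openin_continuous_map_preimage by blast
  then have "openin M {p \<in> topspace (subtopology M (chart_dom c)). chart_map c p \<in> chart_image c \<inter> W}"
    using openin_dom by (simp add: openin_open_subtopology)
  moreover have "{p \<in> topspace (subtopology M (chart_dom c)). chart_map c p \<in> chart_image c \<inter> W} = {p \<in> chart_dom c. chart_map c p \<in> W}"
    unfolding topspace_dom using chart_map_in by auto
  ultimately show ?thesis by simp
qed

lemma compactin_chart_inv:
  assumes "compact K" "K \<subseteq> chart_image c" shows "compactin M (chart_inv c ` K)"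
proof -
  obtain h where h: "homeomorphic_maps (subtopology M (chart_dom c)) (top_of_set (chart_image c)) (chart_map c) h"
    using homeo homeomorphic_map_maps by blast
  have "h x = chart_inv c x" if "x \<in> chart_image c" for x
  proof -
    have "\<forall>p\<in>chart_dom c. h (chart_map c p) = p"
      using h unfolding homeomorphic_maps_def topspace_dom by blast
    then have "h (chart_map c (chart_inv c x)) = chart_inv c x"
      using that chart_inv_in by blast
    then show ?thesis using that by simp
  qed
  then have "chart_inv c ` K = h ` K" using assms(2) by (intro image_cong refl) auto
  moreover have "compactin (top_of_set (chart_image c)) K"
    using assms by (simp add: compactin_subtopology)
  then have "compactin (subtopology M (chart_dom c)) (h ` K)"
    using h by (auto simp: homeomorphic_maps_def intro: image_compactin)
  ultimately show ?thesis by (simp add: compactin_subtopology)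
qed

lemma compact_chart_map:
  assumes "compactin M K" "K \<subseteq> chart_dom c" shows "compact (chart_map c ` K)"
proof -
  have "compactin (subtopology M (chart_dom c)) K"
    using assms by (simp add: compactin_subtopology)
  then have "compactin (top_of_set (chart_image c)) (chart_map c ` K)"
    using homeomorphic_imp_continuous_map[OF homeo] image_compactin by blast
  then show ?thesis by (simp add: compactin_subtopology)
qed

lemma overlap_subset: "overlap c d \<subseteq> chart_image c"
  by (auto simp: overlap_def chart_image_def)

lemma overlap_iff: "x \<in> overlap c d \<longleftrightarrow> x \<in> chart_image c \<and> chart_inv c x \<in> chart_dom d"
  by (auto simp: overlap_def chart_image_def)

lemma transition_eq: "transition c d x = chart_map d (chart_inv c x)"
  by (simp add: transition_def chart_inv_def)

end

lemma open_overlap: "c \<in> A \<Longrightarrow> d \<in> A \<Longrightarrow> open (overlap c d)"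
  unfolding overlap_def by (rule open_chart_map[OF _ openin_dom])

lemma transition_in_overlap:
  assumes "c \<in> A" "d \<in> A" "x \<in> overlap c d" shows "transition c d x \<in> overlap d c"
  using assms by (simp add: overlap_iff transition_eq chart_map_in)

lemma chart_inv_transition:
  assumes "c \<in> A" "d \<in> A" "x \<in> overlap c d" shows "chart_inv d (transition c d x) = chart_inv c x"
  using assms by (simp add: overlap_iff transition_eq)

lemma transition_inverse:
  assumes "c \<in> A" "d \<in> A" "x \<in> overlap c d" shows "transition d c (transition c d x) = x"
  using assms by (simp add: overlap_iff transition_eq)

lemma inj_on_transition: "c \<in> A \<Longrightarrow> d \<in> A \<Longrightarrow> inj_on (transition c d) (overlap c d)"
  by (rule inj_on_inverseI[of _ "transition d c"]) (rule transition_inverse)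

lemma transition_image: "c \<in> A \<Longrightarrow> d \<in> A \<Longrightarrow> transition c d ` overlap c d = overlap d c"
proof (intro set_eqI iffI)
  fix y assume cd: "c \<in> A" "d \<in> A" and "y \<in> transition c d ` overlap c d"
  then show "y \<in> overlap d c" using transition_in_overlap by blast
next
  fix y assume cd: "c \<in> A" "d \<in> A" and y: "y \<in> overlap d c"
  then have "y = transition c d (transition d c y)" using transition_inverse by simp
  then show "y \<in> transition c d ` overlap c d" using transition_in_overlap[OF cd(2,1) y] by blast
qed

section \<open>Discs and finite families of bumps\<close>

lemma disc_support_eq:
  assumes "disc_in A j"
  shows "disc_support j = {p \<in> chart_dom (disc_chart j). chart_map (disc_chart j) p \<in> disc_set j}"
proof -
  have c: "disc_chart j \<in> A" and sub: "disc_set j \<subseteq> chart_image (disc_chart j)"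
    using assms by (auto simp: disc_in_def)
  show ?thesis
  proof (intro set_eqI iffI)
    fix p assume "p \<in> disc_support j"
    then show "p \<in> {p \<in> chart_dom (disc_chart j). chart_map (disc_chart j) p \<in> disc_set j}"
      using c sub by (auto simp: disc_support_def)
  next
    fix p assume "p \<in> {p \<in> chart_dom (disc_chart j). chart_map (disc_chart j) p \<in> disc_set j}"
    then have "p = chart_inv (disc_chart j) (chart_map (disc_chart j) p)"
      "chart_map (disc_chart j) p \<in> disc_set j" using c by auto
    then show "p \<in> disc_support j" unfolding disc_support_def by blast
  qed
qed

lemma disc_support_subset: "disc_in A j \<Longrightarrow> disc_support j \<subseteq> chart_dom (disc_chart j)"
  by (auto simp: disc_support_eq)

lemma compactin_disc_support: "disc_in A j \<Longrightarrow> compactin M (disc_support j)"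
  unfolding disc_support_def by (rule compactin_chart_inv) (auto simp: disc_in_def disc_set_def)

lemma closedin_disc_support: "disc_in A j \<Longrightarrow> closedin M (disc_support j)"
  using compactin_disc_support Hausdorff compactin_imp_closedin by blast

lemma bump_eq_0: "disc_in A j \<Longrightarrow> p \<notin> disc_support j \<Longrightarrow> bump j p = 0"
  by (auto simp: bump_def disc_support_eq disc_set_def disc_in_def intro!: euclidean_bump_eq_0)

lemma bump_nonneg: "bump j p \<ge> 0"
  by (simp add: bump_def euclidean_bump_def)

text \<open>The support is closed because \<open>M\<close> is Hausdorff, so each chart image is
  covered by two open sets: the overlap with the chart of the disc, where the bump is a Euclidean
  bump after a transition map, and the complement of the support, where it is 0.\<close>

lemma C1_bump:
  assumes j: "disc_in A j" shows "C1_function A (bump j)"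
  unfolding C1_function_def
proof
  fix d assume d: "d \<in> A"
  define c where "c = disc_chart j"
  have c: "c \<in> A" using j by (simp add: disc_in_def c_def)
  let ?V = "chart_map d ` (chart_dom d \<inter> (topspace M - disc_support j))"
  have V: "open ?V"
    by (rule open_chart_map[OF d]) (use closedin_disc_support[OF j] in \<open>simp add: openin_diff\<close>)
  show "Ck_on (Suc 0) (\<lambda>x. bump j (chart_inv d x)) (chart_image d)"
  proof (rule Ck_on_open_cover[OF open_overlap[OF d c] V])
    show "chart_image d \<subseteq> overlap d c \<union> ?V"
    proof
      fix x assume x: "x \<in> chart_image d"
      show "x \<in> overlap d c \<union> ?V"
      proof (cases "chart_inv d x \<in> disc_support j")
        case True
        then show ?thesis using disc_support_subset[OF j] x d by (auto simp: overlap_iff c_def)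
      next
        case False
        have "chart_inv d x \<in> topspace M" using chart_inv_in[OF d x] openin_subset[OF openin_dom[OF d]] by auto
        then have "x \<in> ?V" using False x d by (intro image_eqI[of _ _ "chart_inv d x"]) auto
        then show ?thesis by simp
      qed
    qed
    show "Ck_on (Suc 0) (\<lambda>x. bump j (chart_inv d x)) (overlap d c)"
    proof (rule Ck_on_cong[OF open_overlap[OF d c]])
      show "Ck_on (Suc 0) (\<lambda>x. euclidean_bump (fst (snd j)) (snd (snd j)) (transition d c x)) (overlap d c)"
        by (rule Ck_on_compose[OF open_overlap[OF d c] open_UNIV Ck_euclidean_bump Ck_transition[OF d c]]) auto
      show "euclidean_bump (fst (snd j)) (snd (snd j)) (transition d c x) = bump j (chart_inv d x)"
        if "x \<in> overlap d c" for x
        using that d by (auto simp: bump_def overlap_iff transition_eq c_def)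
    qed
    show "Ck_on (Suc 0) (\<lambda>x. bump j (chart_inv d x)) ?V"
    proof (rule Ck_on_cong[OF V])
      show "Ck_on (Suc 0) (\<lambda>x. 0) ?V" by (rule Ck_on_const[OF V])
      show "0 = bump j (chart_inv d x)" if "x \<in> ?V" for x
        using that d bump_eq_0[OF j] by auto
    qed
  qed
qed

lemma ex_disc:
  assumes c: "c \<in> A" and p: "p \<in> chart_dom c"
  obtains j where "disc_in A j" "disc_chart j = c" "bump j p > 0"
proof -
  obtain r where r: "r > 0" "cball (chart_map c p) r \<subseteq> chart_image c"
    using open_contains_cball open_image[OF c] chart_map_in[OF c p] by blast
  show thesis
  proof (rule that)
    show "disc_in A (c, chart_map c p, r)" using c r by (simp add: disc_in_def disc_set_def)
    show "bump (c, chart_map c p, r) p > 0"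
      using p r by (simp add: bump_def euclidean_bump_pos)
  qed simp
qed

lemma openin_bump_pos:
  assumes j: "disc_in A j" shows "openin M {p \<in> topspace M. bump j p > 0}"
proof -
  have c: "disc_chart j \<in> A" and r: "0 < snd (snd j)" using j by (auto simp: disc_in_def)
  have "{p \<in> topspace M. bump j p > 0} = {p \<in> chart_dom (disc_chart j). chart_map (disc_chart j) p \<in> ball (fst (snd j)) (snd (snd j))}"
    (is "?L = ?R")
  proof (intro set_eqI iffI)
    fix p assume "p \<in> ?L"
    then show "p \<in> ?R"
      using euclidean_bump_eq_0[of "snd (snd j)" "chart_map (disc_chart j) p" "fst (snd j)"] r
      by (auto simp: bump_def split: if_splits)
  next
    fix p assume "p \<in> ?R"
    then show "p \<in> ?L"
      using euclidean_bump_pos[of "chart_map (disc_chart j) p" "fst (snd j)" "snd (snd j)"] openin_subset[OF openin_dom[OF c]]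
      by (auto simp: bump_def)
  qed
  then show ?thesis using openin_chart_preimage[OF c open_ball] by simp
qed

text \<open>The disc \<open>j0\<close> is prescribed so that the point at which the divergence is to
  vanish has a positive bump from the family, centred in a chart of choice.\<close>

lemma finite_disc_cover:
  assumes compact: "compact_space M" and j0: "disc_in A j0"
  obtains J where "finite J" "j0 \<in> J" "\<And>j. j \<in> J \<Longrightarrow> disc_in A j"
    "\<And>p. p \<in> topspace M \<Longrightarrow> (\<Sum>j\<in>J. bump j p) > 0"
proof -
  define W where "W j = {p \<in> topspace M. bump j p > 0}" for j :: "('a, 'n) disc"
  have "compactin M (topspace M)" using compact by (simp add: compact_space_def)
  moreover have "\<And>U. U \<in> W ` {j. disc_in A j} \<Longrightarrow> openin M U"
    using openin_bump_pos by (auto simp: W_def)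
  moreover have "topspace M \<subseteq> \<Union>(W ` {j. disc_in A j})"
  proof
    fix p assume p: "p \<in> topspace M"
    then obtain c where "c \<in> A" "p \<in> chart_dom c" using cover by blast
    then obtain j where j: "disc_in A j" "bump j p > 0" by (rule ex_disc)
    then have "p \<in> W j" using p by (simp add: W_def)
    then show "p \<in> \<Union>(W ` {j. disc_in A j})" using j by blast
  qed
  ultimately obtain F where F: "finite F" "F \<subseteq> W ` {j. disc_in A j}" "topspace M \<subseteq> \<Union>F"
    using compactinD by metis
  then obtain J where J: "finite J" "J \<subseteq> {j. disc_in A j}" "F = W ` J"
    using finite_subset_image by metis
  show thesis
  proof (rule that)
    show "finite (insert j0 J)" "j0 \<in> insert j0 J" using J by auto
    show "disc_in A j" if "j \<in> insert j0 J" for j using that J j0 by auto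
    show "(\<Sum>j\<in>insert j0 J. bump j p) > 0" if "p \<in> topspace M" for p
    proof -
      have "p \<in> \<Union>(W ` J)" using that F(3) J(3) by blast
      then obtain j where "j \<in> J" "p \<in> W j" by blast
      then have "j \<in> J" "bump j p > 0" by (auto simp: W_def)
      then show ?thesis using J(1) by (intro sum_pos2[of _ j]) (auto simp: bump_nonneg)
    qed
  qed
qed

end

section \<open>The divergence theorem on a closed manifold\<close>

lemma chart_metric_subset:
  assumes "chart_metric U G" "open V" "V \<subseteq> U" shows "chart_metric V G"
proof -
  interpret chart_metric U G by fact
  show ?thesis
  proof unfold_locales
    show "Ck_entries k G V" for k
      using Ck_G[of k] Ck_on_subset[OF _ assms(3)] unfolding Ck_entries_def by blast
  qed (use assms sym pos in auto)
qed

lemma chart_vector_field_subset: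
  assumes "chart_vector_field U G X" "open V" "V \<subseteq> U" shows "chart_vector_field V G X"
proof -
  interpret chart_vector_field U G X by fact
  interpret V: chart_metric V G by (rule chart_metric_subset[OF _ assms(2,3)]) unfold_locales
  show ?thesis
    by unfold_locales (use assms Ck_X in \<open>auto intro: Ck_on_subset\<close>)
qed

definition extend :: "'a set \<Rightarrow> ('a \<Rightarrow> real) \<Rightarrow> 'a \<Rightarrow> real"
  where "extend U f x = (if x \<in> U then f x else 0)"

text \<open>Cover the space by \<open>U\<close> and the complement of \<open>K\<close>; on the
  latter the extension is 0.\<close>

lemma Ck_extend:
  fixes f :: "'a::real_normed_vector \<Rightarrow> real"
  assumes "open U" "Ck_on k f U" "compact K" "K \<subseteq> U" "\<And>x. x \<in> U - K \<Longrightarrow> f x = 0"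
  shows "Ck_on k (extend U f) UNIV"
proof (rule Ck_on_open_cover[OF assms(1)])
  show K: "open (- K)" using assms(3) by (simp add: compact_imp_closed open_Compl)
  show "UNIV \<subseteq> U \<union> - K" using assms(4) by auto
  show "Ck_on k (extend U f) U"
    by (rule Ck_on_cong[OF assms(1) _ assms(2)]) (simp add: extend_def)
  show "Ck_on k (extend U f) (- K)"
    by (rule Ck_on_cong[OF K _ Ck_on_const[OF K, of _ 0]]) (use assms(5) in \<open>auto simp: extend_def\<close>)
qed

locale vector_field_manifold = atlas M A
  for M :: "'a topology" and A :: "('a, 'n::finite) chart set" +
  fixes g X
  assumes metric: "riemannian_metric A g" and vector_field: "vector_field A X"
begin

lemma chart_vector_field:
  assumes c: "c \<in> A" shows "chart_vector_field (chart_image c) (g c) (X c)"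
proof unfold_locales
  show "open (chart_image c)" by (rule open_image[OF c])
  show "Ck_entries k (g c) (chart_image c)" for k
    unfolding Ck_entries_def
    using metric c by (auto simp: riemannian_metric_def smooth_on_def intro!: Ck_on_nth open_image)
  show "transpose (g c x) = g c x" "v \<noteq> 0 \<Longrightarrow> v \<bullet> (g c x *v v) > 0" if "x \<in> chart_image c" for x v
    using metric c that by (auto simp: riemannian_metric_def)
  show "Ck_on k (\<lambda>y. X c y $ i) (chart_image c)" for k i
    using vector_field c by (auto simp: vector_field_def smooth_on_def intro!: Ck_on_nth open_image)
qed

lemma chart_change:
  assumes c: "c \<in> A" and d: "d \<in> A"
  shows "chart_change (overlap c d) (overlap d c) (g c) (g d) (X c) (X d) (transition c d)"
proof -
  interpret source: chart_vector_field "overlap c d" "g c" "X c"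
    by (rule chart_vector_field_subset[OF chart_vector_field[OF c] open_overlap[OF c d] overlap_subset[OF c]])
  interpret target: chart_vector_field "overlap d c" "g d" "X d"
    by (rule chart_vector_field_subset[OF chart_vector_field[OF d] open_overlap[OF d c] overlap_subset[OF d]])
  have J: "jacobian c d x = vector_jacobian (transition c d) x" if "x \<in> overlap c d" for x
    using Ck_transition[OF c d, of "Suc 0"] that by (intro matrix_frechet_eq_jacobian) auto
  show ?thesis
  proof unfold_locales
    show "Ck_on k (transition c d) (overlap c d)" for k by (rule Ck_transition[OF c d])
    show "transition c d x \<in> overlap d c" if "x \<in> overlap c d" for x
      by (rule transition_in_overlap[OF c d that])
    show "g c x = transpose (vector_jacobian (transition c d) x) ** g d (transition c d x) ** vector_jacobian (transition c d) x"
      if "x \<in> overlap c d" for x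
      using metric c d that J[OF that] unfolding riemannian_metric_def by metis
    show "X d (transition c d x) = vector_jacobian (transition c d) x *v X c x" if "x \<in> overlap c d" for x
      using vector_field c d that J[OF that] unfolding vector_field_def by metis
  qed
qed

lemma volume_density_change:
  assumes "c \<in> A" "d \<in> A" "x \<in> overlap c d"
  shows "volume_density (g c) x = \<bar>det (jacobian c d x)\<bar> * volume_density (g d) (transition c d x)"
proof -
  interpret chart_change "overlap c d" "overlap d c" "g c" "g d" "X c" "X d" "transition c d"
    by (rule chart_change[OF assms(1,2)])
  show ?thesis
    using volume_density_change[OF assms(3)] matrix_frechet_eq_jacobian[OF diff_T[OF assms(3)]] by simp
qed

end

text \<open>\<open>Z\<close> stands for the flux. \<open>Z_change\<close> says that its action on
  functions is chart-independent, which is what the functions \<phi>_i Z(\<phi>_j) require.\<close>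

locale partitioned_flux = vector_field_manifold M A g X
  for M :: "'a topology" and A :: "('a, 'n::finite) chart set" and g X +
  fixes Z :: "('a, 'n) chart \<Rightarrow> real^'n \<Rightarrow> real^'n" and J :: "('a, 'n) disc set"
  assumes Ck_Z: "\<And>c i. c \<in> A \<Longrightarrow> Ck_on (Suc 0) (\<lambda>x. Z c x $ i) (chart_image c)"
    and Z_change: "\<And>c d x f. c \<in> A \<Longrightarrow> d \<in> A \<Longrightarrow> x \<in> overlap c d \<Longrightarrow> f differentiable (at (transition c d x)) \<Longrightarrow>
      (\<Sum>i\<in>UNIV. Z c x $ i * partial_deriv i (\<lambda>y. f (transition c d y)) x)
      = (\<Sum>i\<in>UNIV. Z d (transition c d x) $ i * partial_deriv i f (transition c d x))"
    and finite_J: "finite J" and disc_J: "\<And>j. j \<in> J \<Longrightarrow> disc_in A j"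
    and bump_pos: "\<And>p. p \<in> topspace M \<Longrightarrow> (\<Sum>j\<in>J. bump j p) > 0"
begin

definition \<phi> :: "('a, 'n) disc \<Rightarrow> 'a \<Rightarrow> real"
  where "\<phi> j p = bump j p / (\<Sum>i\<in>J. bump i p)"

definition D :: "('a, 'n) chart \<Rightarrow> ('a \<Rightarrow> real) \<Rightarrow> real^'n \<Rightarrow> real"
  where "D c f x = (\<Sum>k\<in>UNIV. Z c x $ k * partial_deriv k (\<lambda>y. f (chart_inv c y)) x)"

text \<open>The density of \<phi>_i Z(\<phi>_j) read in chart \<open>c\<close>. Its support lies in
  both discs, so it can be integrated in the chart of either.\<close>

definition q :: "('a, 'n) chart \<Rightarrow> ('a, 'n) disc \<Rightarrow> ('a, 'n) disc \<Rightarrow> real^'n \<Rightarrow> real"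
  where "q c i j = extend (chart_image c) (\<lambda>x. volume_density (g c) x * \<phi> i (chart_inv c x) * D c (\<phi> j) x)"

abbreviation \<rho> :: "('a, 'n) chart \<Rightarrow> real^'n \<Rightarrow> real"
  where "\<rho> c \<equiv> volume_density (g c)"

lemma chart_J: "j \<in> J \<Longrightarrow> disc_chart j \<in> A"
  using disc_J by (simp add: disc_in_def)

lemma chart_inv_topspace: "c \<in> A \<Longrightarrow> x \<in> chart_image c \<Longrightarrow> chart_inv c x \<in> topspace M"
  using cover chart_inv_in by blast

lemma sum_\<phi>: "p \<in> topspace M \<Longrightarrow> (\<Sum>j\<in>J. \<phi> j p) = 1"
  using bump_pos[of p] by (simp add: \<phi>_def flip: sum_divide_distrib)

lemma \<phi>_nonneg: "\<phi> j p \<ge> 0"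
  by (simp add: \<phi>_def bump_nonneg sum_nonneg)

lemma \<phi>_eq_0: "j \<in> J \<Longrightarrow> p \<notin> disc_support j \<Longrightarrow> \<phi> j p = 0"
  using bump_eq_0[OF disc_J] by (simp add: \<phi>_def)

lemma C1_\<phi>:
  assumes j: "j \<in> J" and c: "c \<in> A"
  shows "Ck_on (Suc 0) (\<lambda>x. \<phi> j (chart_inv c x)) (chart_image c)"
proof -
  have b: "Ck_on (Suc 0) (\<lambda>x. bump i (chart_inv c x)) (chart_image c)" if "i \<in> J" for i
    using C1_bump[OF disc_J[OF that]] c by (simp add: C1_function_def del: Ck_on.simps)
  have "(\<Sum>i\<in>J. bump i (chart_inv c x)) \<noteq> 0" if "x \<in> chart_image c" for x
    using bump_pos[OF chart_inv_topspace[OF c that]] by simp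
  then show ?thesis unfolding \<phi>_def
    by (intro Ck_on_divide Ck_on_sum open_image[OF c] b j)
qed

lemma volume: "c \<in> A \<Longrightarrow> Ck_on k (\<rho> c) (chart_image c)" "c \<in> A \<Longrightarrow> x \<in> chart_image c \<Longrightarrow> \<rho> c x > 0"
proof -
  assume c: "c \<in> A"
  interpret chart_vector_field "chart_image c" "g c" "X c" by (rule chart_vector_field[OF c])
  show "Ck_on k (\<rho> c) (chart_image c)" by (rule Ck_volume_density)
  show "\<rho> c x > 0" if "x \<in> chart_image c" by (rule volume_density_pos[OF that])
qed

lemma continuous_D:
  assumes "j \<in> J" "c \<in> A" shows "Ck_on 0 (D c (\<phi> j)) (chart_image c)"
  unfolding D_def
  by (intro Ck_on_sum Ck_on_mult open_image assms Ck_on_partial_deriv C1_\<phi> Ck_on_SucD[OF Ck_Z])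

lemma D_eq_0:
  assumes j: "j \<in> J" and c: "c \<in> A" and x: "x \<in> chart_image c" "chart_inv c x \<notin> disc_support j"
  shows "D c (\<phi> j) x = 0"
proof -
  let ?V = "chart_map c ` (chart_dom c \<inter> (topspace M - disc_support j))"
  have V: "open ?V"
    by (rule open_chart_map[OF c]) (use closedin_disc_support[OF disc_J[OF j]] in \<open>simp add: openin_diff\<close>)
  have "x = chart_map c (chart_inv c x)" using c x by simp
  moreover have "chart_inv c x \<in> chart_dom c \<inter> (topspace M - disc_support j)"
    using x chart_inv_topspace[OF c x(1)] chart_inv_in[OF c x(1)] by simp
  ultimately have xV: "x \<in> ?V" by blast
  have "partial_deriv k (\<lambda>y. \<phi> j (chart_inv c y)) x = partial_deriv k (\<lambda>y. 0) x" for k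
    by (rule partial_deriv_cong[OF V xV]) (use c \<phi>_eq_0[OF j] in auto)
  then show ?thesis by (simp add: D_def partial_deriv_const)
qed

lemma D_change:
  assumes j: "j \<in> J" and c: "c \<in> A" and d: "d \<in> A" and x: "x \<in> overlap c d"
  shows "D c (\<phi> j) x = D d (\<phi> j) (transition c d x)"
proof -
  have "transition c d x \<in> chart_image d"
    using transition_in_overlap[OF c d x] overlap_subset[OF d, of c] by auto
  then have "(\<lambda>y. \<phi> j (chart_inv d y)) differentiable (at (transition c d x))"
    using C1_\<phi>[OF j d] by auto
  from Z_change[OF c d x this]
  have "(\<Sum>i\<in>UNIV. Z c x $ i * partial_deriv i (\<lambda>y. \<phi> j (chart_inv d (transition c d y))) x) = D d (\<phi> j) (transition c d x)"
    by (simp add: D_def)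
  moreover have "partial_deriv i (\<lambda>y. \<phi> j (chart_inv d (transition c d y))) x = partial_deriv i (\<lambda>y. \<phi> j (chart_inv c y)) x" for i
    by (rule partial_deriv_cong[OF open_overlap[OF c d] x]) (simp add: chart_inv_transition c d)
  ultimately show ?thesis by (simp add: D_def)
qed

definition common_support :: "('a, 'n) chart \<Rightarrow> ('a, 'n) disc \<Rightarrow> ('a, 'n) disc \<Rightarrow> (real^'n) set"
  where "common_support c i j = chart_map c ` (disc_support i \<inter> disc_support j)"

lemma compact_common_support:
  assumes "i \<in> J" "j \<in> J" "c \<in> A" "disc_support i \<inter> disc_support j \<subseteq> chart_dom c"
  shows "compact (common_support c i j)"
  unfolding common_support_def
  by (intro compact_chart_map assms closed_Int_compactin closedin_disc_support compactin_disc_support disc_J)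

lemma q_support:
  assumes "i \<in> J" "j \<in> J" "c \<in> A" "x \<notin> common_support c i j"
  shows "q c i j x = 0"
proof (cases "x \<in> chart_image c")
  case True
  have "chart_inv c x \<notin> disc_support i \<inter> disc_support j"
  proof
    assume "chart_inv c x \<in> disc_support i \<inter> disc_support j"
    then have "chart_map c (chart_inv c x) \<in> common_support c i j" unfolding common_support_def by blast
    then show False using assms True by simp
  qed
  then show ?thesis using \<phi>_eq_0[OF assms(1)] D_eq_0[OF assms(2,3) True] by (auto simp: q_def extend_def)
qed (simp add: q_def extend_def)

lemma continuous_q:
  assumes "i \<in> J" "j \<in> J" "c \<in> A" "disc_support i \<inter> disc_support j \<subseteq> chart_dom c"
  shows "continuous_on UNIV (q c i j)"
proof -
  have "Ck_on 0 (q c i j) UNIV"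
    unfolding q_def
  proof (rule Ck_extend[OF open_image[OF assms(3)] _ compact_common_support[OF assms]])
    show "Ck_on 0 (\<lambda>x. \<rho> c x * \<phi> i (chart_inv c x) * D c (\<phi> j) x) (chart_image c)"
      by (intro Ck_on_mult open_image continuous_D volume Ck_on_SucD[OF C1_\<phi>] assms)
    show "common_support c i j \<subseteq> chart_image c"
      using assms(4) by (auto simp: common_support_def chart_image_def)
    show "\<rho> c x * \<phi> i (chart_inv c x) * D c (\<phi> j) x = 0" if "x \<in> chart_image c - common_support c i j" for x
      using q_support[OF assms(1-3), of x] that by (simp add: q_def extend_def)
  qed
  then show ?thesis by simp
qed

lemma support_in_charts:
  assumes "i \<in> J" "j \<in> J"
  shows "disc_support i \<inter> disc_support j \<subseteq> chart_dom (disc_chart i)"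
    and "disc_support i \<inter> disc_support j \<subseteq> chart_dom (disc_chart j)"
  using assms disc_support_subset[OF disc_J] by blast+

text \<open>The volume density picks up the Jacobian determinant while \<phi>_i Z(\<phi>_j) does not
  depend on the chart, so this is the change of variables along the transition map.\<close>

lemma integral_q_change:
  assumes i: "i \<in> J" and j: "j \<in> J"
  shows "integral UNIV (q (disc_chart j) i j) = integral UNIV (q (disc_chart i) i j)"
proof -
  let ?c = "disc_chart j" and ?d = "disc_chart i"
  have c: "?c \<in> A" and d: "?d \<in> A" using i j chart_J by auto
  note sup = support_in_charts[OF i j]
  have dom: "disc_support i \<inter> disc_support j \<subseteq> chart_dom ?c \<inter> chart_dom ?d" using sup by auto
  show ?thesis
  proof (rule change_of_variables_supported[where V="overlap ?c ?d" and T="transition ?c ?d"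
        and T'="\<lambda>x. frechet_derivative (transition ?c ?d) (at x)"
        and K="common_support ?c i j" and K'="common_support ?d i j"])
    show "open (overlap ?c ?d)" by (rule open_overlap[OF c d])
    show "(transition ?c ?d has_derivative frechet_derivative (transition ?c ?d) (at x)) (at x)"
      if "x \<in> overlap ?c ?d" for x by (rule Ck_on_has_derivative[OF Ck_transition[OF c d] that])
    show "inj_on (transition ?c ?d) (overlap ?c ?d)" by (rule inj_on_transition[OF c d])
    show "continuous_on UNIV (q ?c i j)" "continuous_on UNIV (q ?d i j)"
      using continuous_q i j c d sup by auto
    show "compact (common_support ?c i j)" "compact (common_support ?d i j)"
      using compact_common_support i j c d sup by auto
    show "common_support ?c i j \<subseteq> overlap ?c ?d"
      using dom by (auto simp: common_support_def overlap_def)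
    show "common_support ?d i j \<subseteq> transition ?c ?d ` overlap ?c ?d"
      unfolding transition_image[OF c d] using dom by (auto simp: common_support_def overlap_def)
    show "q ?c i j x = 0" if "x \<notin> common_support ?c i j" for x by (rule q_support[OF i j c that])
    show "q ?d i j x = 0" if "x \<notin> common_support ?d i j" for x by (rule q_support[OF i j d that])
    show "q ?c i j x = \<bar>det (jacobian ?c ?d x)\<bar> * q ?d i j (transition ?c ?d x)" if x: "x \<in> overlap ?c ?d" for x
    proof -
      have "x \<in> chart_image ?c" "transition ?c ?d x \<in> chart_image ?d"
        using x overlap_subset[OF c, of ?d] overlap_subset[OF d, of ?c] transition_in_overlap[OF c d x] by auto
      then show ?thesis
        by (simp add: q_def extend_def volume_density_change[OF c d x] chart_inv_transition[OF c d x] D_change[OF j c d x])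
    qed
  qed
qed

lemma sum_D:
  assumes c: "c \<in> A" and x: "x \<in> chart_image c"
  shows "(\<Sum>j\<in>J. D c (\<phi> j) x) = 0"
proof -
  have diff: "(\<lambda>y. \<phi> j (chart_inv c y)) differentiable (at x)" if "j \<in> J" for j
    using C1_\<phi>[OF that c] x by auto
  have "(\<Sum>j\<in>J. partial_deriv k (\<lambda>y. \<phi> j (chart_inv c y)) x) = 0" for k
  proof -
    have "(\<Sum>j\<in>J. partial_deriv k (\<lambda>y. \<phi> j (chart_inv c y)) x) = partial_deriv k (\<lambda>y. \<Sum>j\<in>J. \<phi> j (chart_inv c y)) x"
      by (rule partial_deriv_sum[symmetric]) (rule diff)
    also have "\<dots> = partial_deriv k (\<lambda>y. 1) x"
      by (rule partial_deriv_cong[OF open_image[OF c] x]) (simp add: sum_\<phi> chart_inv_topspace c)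
    finally show ?thesis by (simp add: partial_deriv_const)
  qed
  then have "(\<Sum>k\<in>UNIV. Z c x $ k * (\<Sum>j\<in>J. partial_deriv k (\<lambda>y. \<phi> j (chart_inv c y)) x)) = 0" by simp
  moreover have "(\<Sum>j\<in>J. D c (\<phi> j) x) = (\<Sum>k\<in>UNIV. Z c x $ k * (\<Sum>j\<in>J. partial_deriv k (\<lambda>y. \<phi> j (chart_inv c y)) x))"
    unfolding D_def sum_distrib_left by (rule sum.swap)
  ultimately show ?thesis by simp
qed

lemma integrable_q:
  assumes "i \<in> J" "j \<in> J" "c \<in> A" "disc_support i \<inter> disc_support j \<subseteq> chart_dom c"
  shows "q c i j integrable_on UNIV"
  using absolutely_integrable_supported[OF continuous_q[OF assms] compact_common_support[OF assms] q_support[OF assms(1-3)], of UNIV]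
  by (simp add: absolutely_integrable_on_def)

text \<open>The integral for \<open>j\<close> is taken in the chart of its own disc, whereas
  \<Sum>_j Z(\<phi>_j) = 0 is an identity inside one chart. Inserting 1 = \<Sum>_i \<phi>_i and
  moving each summand to the chart of disc \<open>i\<close> lets the sum over \<open>j\<close> run
  in a fixed chart.\<close>

lemma sum_integral_D:
  "(\<Sum>j\<in>J. integral UNIV (extend (chart_image (disc_chart j)) (\<lambda>x. \<rho> (disc_chart j) x * D (disc_chart j) (\<phi> j) x))) = 0"
proof -
  have 1: "integral UNIV (extend (chart_image (disc_chart j)) (\<lambda>x. \<rho> (disc_chart j) x * D (disc_chart j) (\<phi> j) x))
    = (\<Sum>i\<in>J. integral UNIV (q (disc_chart j) i j))" if j: "j \<in> J" for j
  proof -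
    let ?c = "disc_chart j"
    have c: "?c \<in> A" by (rule chart_J[OF j])
    have "extend (chart_image ?c) (\<lambda>x. \<rho> ?c x * D ?c (\<phi> j) x) = (\<lambda>x. \<Sum>i\<in>J. q ?c i j x)"
    proof
      fix x
      show "extend (chart_image ?c) (\<lambda>x. \<rho> ?c x * D ?c (\<phi> j) x) x = (\<Sum>i\<in>J. q ?c i j x)"
      proof (cases "x \<in> chart_image ?c")
        case True
        then have "(\<Sum>i\<in>J. q ?c i j x) = \<rho> ?c x * (\<Sum>i\<in>J. \<phi> i (chart_inv ?c x)) * D ?c (\<phi> j) x"
          by (simp add: q_def extend_def sum_distrib_left sum_distrib_right)
        then show ?thesis using True by (simp add: extend_def sum_\<phi> chart_inv_topspace[OF c])
      qed (simp add: extend_def q_def)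
    qed
    then show ?thesis
      using integral_sum[OF finite_J, of "\<lambda>i. q ?c i j" UNIV] integrable_q[OF _ j c support_in_charts(2)[OF _ j]] by simp
  qed
  have 2: "(\<Sum>j\<in>J. integral UNIV (q (disc_chart i) i j)) = 0" if i: "i \<in> J" for i
  proof -
    let ?c = "disc_chart i"
    have c: "?c \<in> A" by (rule chart_J[OF i])
    have "(\<Sum>j\<in>J. integral UNIV (q ?c i j)) = integral UNIV (\<lambda>x. \<Sum>j\<in>J. q ?c i j x)"
      using integral_sum[OF finite_J, of "\<lambda>j. q ?c i j" UNIV] integrable_q[OF i _ c support_in_charts(1)[OF i]] by simp
    also have "(\<lambda>x. \<Sum>j\<in>J. q ?c i j x) = (\<lambda>x. 0)"
    proof
      fix x
      show "(\<Sum>j\<in>J. q ?c i j x) = 0"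
        by (cases "x \<in> chart_image ?c") (simp_all add: q_def extend_def sum_D[OF c] flip: sum_distrib_left)
    qed
    finally show ?thesis by simp
  qed
  have "(\<Sum>j\<in>J. integral UNIV (extend (chart_image (disc_chart j)) (\<lambda>x. \<rho> (disc_chart j) x * D (disc_chart j) (\<phi> j) x)))
     = (\<Sum>j\<in>J. \<Sum>i\<in>J. integral UNIV (q (disc_chart i) i j))"
  proof (rule sum.cong[OF refl])
    fix j assume j: "j \<in> J"
    show "integral UNIV (extend (chart_image (disc_chart j)) (\<lambda>x. \<rho> (disc_chart j) x * D (disc_chart j) (\<phi> j) x))
      = (\<Sum>i\<in>J. integral UNIV (q (disc_chart i) i j))"
      unfolding 1[OF j] by (rule sum.cong[OF refl integral_q_change[OF _ j]])
  qed
  also have "\<dots> = (\<Sum>i\<in>J. \<Sum>j\<in>J. integral UNIV (q (disc_chart i) i j))" by (rule sum.swap)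
  also have "\<dots> = 0" using 2 by simp
  finally show ?thesis .
qed

text \<open>In the chart of its own disc, \<open>\<phi> j\<close> times \<open>Z\<close> has compact support, so its divergence
  integrates to \<open>0\<close>.\<close>

lemma integral_divergence_\<phi>:
  assumes j: "j \<in> J"
  defines "c \<equiv> disc_chart j"
  shows "continuous_on UNIV (extend (chart_image c) (\<lambda>x. \<rho> c x * \<phi> j (chart_inv c x) * divergence (g c) (Z c) x))" (is ?C)
    and "integral UNIV (extend (chart_image c) (\<lambda>x. \<rho> c x * \<phi> j (chart_inv c x) * divergence (g c) (Z c) x))
      + integral UNIV (extend (chart_image c) (\<lambda>x. \<rho> c x * D c (\<phi> j) x)) = 0" (is ?I)
proof -
  have c: "c \<in> A" using chart_J[OF j] by (simp add: c_def)
  interpret chart_vector_field "chart_image c" "g c" "X c" by (rule chart_vector_field[OF c])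
  let ?f = "\<lambda>x. \<phi> j (chart_inv c x)"
  let ?P = "\<lambda>x. \<rho> c x * ?f x * divergence (g c) (Z c) x" and ?Q = "\<lambda>x. \<rho> c x * D c (\<phi> j) x"
  define K where "K = disc_set j"
  have K: "compact K" "K \<subseteq> chart_image c"
    using disc_J[OF j] by (auto simp: K_def c_def disc_in_def disc_set_def)
  have support: "chart_inv c x \<notin> disc_support j" if "x \<in> chart_image c - K" for x
    using that disc_support_eq[OF disc_J[OF j]] c by (auto simp: K_def c_def)
  have f0: "?f x = 0" and D0: "D c (\<phi> j) x = 0" if "x \<in> chart_image c - K" for x
    using \<phi>_eq_0[OF j support[OF that]] D_eq_0[OF j c _ support[OF that]] that by auto
  have Cf: "Ck_on (Suc 0) ?f (chart_image c)" by (rule C1_\<phi>[OF j c])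
  have df: "?f differentiable (at x)" if "x \<in> chart_image c" for x using Cf that by auto
  have dZ: "(\<lambda>y. Z c y $ i) differentiable (at x)" if "x \<in> chart_image c" for x i using Ck_Z[OF c] that by auto
  have d\<rho>: "\<rho> c differentiable (at x)" if "x \<in> chart_image c" for x
    using volume(1)[OF c, of "Suc 0"] that by auto
  \<comment> \<open>The components of \<rho> \<phi>_j Z, extended by 0 from the chart to the whole
    space.\<close>
  define E where "E i = extend (chart_image c) (\<lambda>x. \<rho> c x * ?f x * Z c x $ i)" for i
  have CE: "Ck_on (Suc 0) (E i) UNIV" for i
    unfolding E_def
  proof (rule Ck_extend[OF open_U _ K])
    show "Ck_on (Suc 0) (\<lambda>x. \<rho> c x * ?f x * Z c x $ i) (chart_image c)"
      by (intro Ck_on_mult open_U volume c Cf Ck_Z)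
  qed (use f0 in auto)
  have E0: "E i x = 0" if "x \<notin> K" for i x
    using f0[of x] that by (auto simp: E_def extend_def)
  have contE: "continuous_on UNIV (partial_deriv i (E i))" for i
    using Ck_on_partial_deriv[OF CE] by simp
  have E0': "partial_deriv i (E i) x = 0" if "x \<notin> K" for i x
  proof -
    have "partial_deriv i (E i) x = partial_deriv i (\<lambda>y. 0) x"
      by (rule partial_deriv_cong[where U="- K"]) (use that E0 K(1) in \<open>auto simp: compact_imp_closed\<close>)
    then show ?thesis by (simp add: partial_deriv_const)
  qed
  have E_int: "integral UNIV (partial_deriv i (E i)) = 0" for i
    by (rule integral_partial_deriv_eq_0[OF _ contE K(1) E0]) (use CE in auto)
  have E_able: "partial_deriv i (E i) integrable_on UNIV" for i
    using absolutely_integrable_supported[OF contE K(1) E0', of UNIV] by (simp add: absolutely_integrable_on_def)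
  \<comment> \<open>By \<open>pderiv_volume_density\<close> the derivatives of \<open>E\<close> add
    up to \<rho> div(\<phi>_j Z), which the product rule splits into these two terms.\<close>
  have split: "extend (chart_image c) ?P x + extend (chart_image c) ?Q x = (\<Sum>i\<in>UNIV. partial_deriv i (E i) x)" for x
  proof (cases "x \<in> chart_image c")
    case True
    have "partial_deriv i (E i) x = partial_deriv i (\<lambda>x. \<rho> c x * ?f x * Z c x $ i) x" for i
      by (rule partial_deriv_cong[OF open_U True]) (simp add: E_def extend_def)
    also have "\<dots> i = (partial_deriv i (\<rho> c) x * ?f x + \<rho> c x * partial_deriv i ?f x) * Z c x $ i
        + \<rho> c x * ?f x * partial_deriv i (\<lambda>x. Z c x $ i) x" for i
      by (simp add: partial_deriv_mult differentiable_mult df[OF True] dZ[OF True] d\<rho>[OF True])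
    finally have "partial_deriv i (E i) x = \<rho> c x * ?f x * ((\<Sum>k\<in>UNIV. connection (g c) k x $ k $ i) * Z c x $ i
        + partial_deriv i (\<lambda>x. Z c x $ i) x) + \<rho> c x * (Z c x $ i * partial_deriv i ?f x)" for i
      by (simp add: pderiv_volume_density[OF True] algebra_simps)
    then have "(\<Sum>i\<in>UNIV. partial_deriv i (E i) x) = \<rho> c x * ?f x * (\<Sum>i\<in>UNIV. (\<Sum>k\<in>UNIV. connection (g c) k x $ k $ i) * Z c x $ i
        + partial_deriv i (\<lambda>x. Z c x $ i) x) + \<rho> c x * (\<Sum>i\<in>UNIV. Z c x $ i * partial_deriv i ?f x)"
      by (simp add: sum.distrib sum_distrib_left sum_distrib_right algebra_simps)
    then show ?thesis using True
      by (simp add: extend_def divergence_def D_def sum.distrib sum_distrib_right add.commute)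
  next
    case False
    then have "x \<notin> K" using K(2) by auto
    then show ?thesis using E0'[of x] False by (simp add: extend_def)
  qed
  have CQ: "continuous_on UNIV (extend (chart_image c) ?Q)"
  proof -
    have "Ck_on 0 (extend (chart_image c) ?Q) UNIV"
    proof (rule Ck_extend[OF open_U _ K])
      show "Ck_on 0 ?Q (chart_image c)" by (intro Ck_on_mult open_U volume c continuous_D j)
    qed (use D0 in auto)
    then show ?thesis by simp
  qed
  have P: "extend (chart_image c) ?P = (\<lambda>x. (\<Sum>i\<in>UNIV. partial_deriv i (E i) x) - extend (chart_image c) ?Q x)"
    using split by (simp add: fun_eq_iff eq_diff_eq)
  show ?C unfolding P by (intro continuous_intros contE CQ)
  have Q_able: "extend (chart_image c) ?Q integrable_on UNIV"
    using absolutely_integrable_supported[OF CQ K(1), of UNIV] D0 by (auto simp: absolutely_integrable_on_def extend_def)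
  have "integral UNIV (extend (chart_image c) ?P) = integral UNIV (\<lambda>x. \<Sum>i\<in>UNIV. partial_deriv i (E i) x) - integral UNIV (extend (chart_image c) ?Q)"
    unfolding P by (intro integral_diff integrable_sum E_able Q_able) simp
  also have "integral UNIV (\<lambda>x. \<Sum>i\<in>UNIV. partial_deriv i (E i) x) = 0"
    by (subst integral_sum) (simp_all add: E_able E_int)
  finally show ?I by simp
qed

text \<open>The integrals of \<phi>_i div Z over all discs add up to 0 and none is negative, so each
  vanishes. A continuous nonnegative integrand with integral 0 is 0, and at \<open>p\<close> the
  weights \<rho> and \<phi>_j are positive.\<close>

lemma divergence_eq_0:
  assumes nonneg: "\<And>c x. c \<in> A \<Longrightarrow> x \<in> chart_image c \<Longrightarrow> divergence (g c) (Z c) x \<ge> 0"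
    and j: "j \<in> J" and p: "p \<in> chart_dom (disc_chart j)" "bump j p > 0"
  shows "divergence (g (disc_chart j)) (Z (disc_chart j)) (chart_map (disc_chart j) p) = 0"
proof -
  define P where "P i = extend (chart_image (disc_chart i)) (\<lambda>x. \<rho> (disc_chart i) x * \<phi> i (chart_inv (disc_chart i) x)
      * divergence (g (disc_chart i)) (Z (disc_chart i)) x)" for i
  have P_nonneg: "P i x \<ge> 0" if "i \<in> J" for i x
    using nonneg[OF chart_J[OF that]] volume(2)[OF chart_J[OF that], of x] \<phi>_nonneg[of i "chart_inv (disc_chart i) x"]
    by (simp add: P_def extend_def less_imp_le)
  have "(\<Sum>i\<in>J. integral UNIV (P i)) = 0"
  proof -
    have "(\<Sum>i\<in>J. integral UNIV (P i)) = - (\<Sum>i\<in>J. integral UNIV (extend (chart_image (disc_chart i)) (\<lambda>x. \<rho> (disc_chart i) x * D (disc_chart i) (\<phi> i) x)))"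
      unfolding sum_negf[symmetric] P_def
      using integral_divergence_\<phi>(2) by (intro sum.cong refl) (simp add: eq_neg_iff_add_eq_0)
    then show ?thesis using sum_integral_D by simp
  qed
  moreover have "integral UNIV (P i) \<ge> 0" if "i \<in> J" for i
  \<comment> \<open>\<open>integral\<close> takes the default value 0 on non-integrable functions,
    so nonnegativity holds in either case.\<close>
  proof (cases "P i integrable_on UNIV")
    case True
    then show ?thesis using P_nonneg[OF that] by (intro integral_nonneg) auto
  qed (simp add: not_integrable_integral)
  ultimately have int0: "integral UNIV (P j) = 0"
    using finite_J j by (simp add: sum_nonneg_eq_0_iff)
  have c: "disc_chart j \<in> A" by (rule chart_J[OF j])
  have x: "chart_map (disc_chart j) p \<in> chart_image (disc_chart j)" by (rule chart_map_in[OF c p(1)])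
  have "P j (chart_map (disc_chart j) p) = 0"
  proof (rule continuous_nonneg_integral_eq_0[OF _ P_nonneg[OF j] _ _ int0])
    show "continuous_on UNIV (P j)" unfolding P_def by (rule integral_divergence_\<phi>(1)[OF j])
    show "compact (disc_set j)" by (simp add: disc_set_def)
    show "P j x = 0" if "x \<notin> disc_set j" for x
    proof (cases "x \<in> chart_image (disc_chart j)")
      case True
      then have "chart_inv (disc_chart j) x \<notin> disc_support j"
        using disc_support_eq[OF disc_J[OF j]] c that by auto
      then show ?thesis using \<phi>_eq_0[OF j] by (simp add: P_def extend_def)
    qed (simp add: P_def extend_def)
  qed
  moreover have "\<phi> j p > 0"
  proof -
    have "p \<in> topspace M" using p c cover by blast
    then show ?thesis using p(2) bump_pos by (simp add: \<phi>_def)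
  qed
  moreover have "\<rho> (disc_chart j) (chart_map (disc_chart j) p) > 0" by (rule volume(2)[OF c x])
  ultimately show ?thesis using x c p by (simp add: P_def extend_def)
qed

end

section \<open>Constant scalar curvature and Killing fields\<close>

context vector_field_manifold
begin

lemma flux_divergence_eq_0:
  assumes compact: "compact_space M"
    and nonneg: "\<And>c x. c \<in> A \<Longrightarrow> x \<in> chart_image c \<Longrightarrow> divergence (g c) (flux (g c) (X c) m a) x \<ge> 0"
    and c: "c \<in> A" and x: "x \<in> chart_image c"
  shows "divergence (g c) (flux (g c) (X c) m a) x = 0"
proof -
  define p where "p = chart_inv c x"
  have p: "p \<in> chart_dom c" "chart_map c p = x" using c x by (simp_all add: p_def)
  obtain j where j: "disc_in A j" "disc_chart j = c" "bump j p > 0" by (rule ex_disc[OF c p(1)])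
  show ?thesis
  proof (rule finite_disc_cover[OF compact j(1)])
    fix J assume J: "finite J" "j \<in> J" "\<And>j. j \<in> J \<Longrightarrow> disc_in A j"
      "\<And>p. p \<in> topspace M \<Longrightarrow> (\<Sum>j\<in>J. bump j p) > 0"
    interpret partitioned_flux M A g X "\<lambda>c. flux (g c) (X c) m a" J
    proof unfold_locales
      show "Ck_on (Suc 0) (\<lambda>x. flux (g c) (X c) m a x $ i) (chart_image c)" if "c \<in> A" for c i
      proof -
        interpret chart_vector_field "chart_image c" "g c" "X c" by (rule chart_vector_field[OF that])
        show ?thesis by (rule Ck_flux)
      qed
      show "(\<Sum>i\<in>UNIV. flux (g c) (X c) m a x $ i * partial_deriv i (\<lambda>y. f (transition c d y)) x)
        = (\<Sum>i\<in>UNIV. flux (g d) (X d) m a (transition c d x) $ i * partial_deriv i f (transition c d x))"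
        if "c \<in> A" "d \<in> A" "x \<in> overlap c d" "f differentiable (at (transition c d x))" for c d x f
      proof -
        interpret chart_change "overlap c d" "overlap d c" "g c" "g d" "X c" "X d" "transition c d"
          by (rule chart_change[OF that(1,2)])
        show ?thesis by (rule flux_derivative_change[OF that(3,4)])
      qed
    qed (use J in auto)
    have "divergence (g (disc_chart j)) (flux (g (disc_chart j)) (X (disc_chart j)) m a) (chart_map (disc_chart j) p) = 0"
      by (rule divergence_eq_0[OF nonneg J(2)]) (use j p in auto)
    then show ?thesis using j p by simp
  qed
qed

text \<open>Connectedness of \<open>M\<close> has to be applied to a function on \<open>M\<close>;
  this is |X|^2 read in a chosen chart, and by \<open>sq_norm_change\<close> the choice does not
  matter.\<close>

definition sq_norm_at :: "'a \<Rightarrow> real"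
  where "sq_norm_at p = (let c = (SOME c. c \<in> A \<and> p \<in> chart_dom c) in sq_norm (g c) (X c) (chart_map c p))"

lemma sq_norm_at_eq:
  assumes c: "c \<in> A" and p: "p \<in> chart_dom c"
  shows "sq_norm_at p = sq_norm (g c) (X c) (chart_map c p)"
proof -
  define d where "d = (SOME c. c \<in> A \<and> p \<in> chart_dom c)"
  have "d \<in> A \<and> p \<in> chart_dom d"
    unfolding d_def by (rule someI[of _ c]) (use assms in auto)
  then have d: "d \<in> A" "p \<in> chart_dom d" by auto
  interpret chart_change "overlap c d" "overlap d c" "g c" "g d" "X c" "X d" "transition c d"
    by (rule chart_change[OF c d(1)])
  have "chart_map c p \<in> overlap c d" using p d by (auto simp: overlap_def)
  from sq_norm_change[OF this] show ?thesis
    using c d p by (simp add: sq_norm_at_def transition_eq flip: d_def)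
qed

text \<open>A chart image may be disconnected, so constancy is first obtained on a coordinate ball.
  Then a level set and its complement are both open in \<open>M\<close>.\<close>

lemma sq_norm_at_constant:
  assumes connected: "connected_space M"
    and zero: "\<And>c x k. c \<in> A \<Longrightarrow> x \<in> chart_image c \<Longrightarrow> partial_deriv k (sq_norm (g c) (X c)) x = 0"
    and pq: "p \<in> topspace M" "q \<in> topspace M"
  shows "sq_norm_at p = sq_norm_at q"
proof -
  have local: "\<exists>W. openin M W \<and> r \<in> W \<and> (\<forall>s\<in>W. sq_norm_at s = sq_norm_at r)" if r: "r \<in> topspace M" for r
  proof -
    obtain c where c: "c \<in> A" "r \<in> chart_dom c" using r cover by blast
    interpret chart_vector_field "chart_image c" "g c" "X c" by (rule chart_vector_field[OF c(1)])
    obtain e where e: "e > 0" "ball (chart_map c r) e \<subseteq> chart_image c"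
      by (rule openE[OF open_U chart_map_in[OF c]])
    have const: "N y = N (chart_map c r)" if y: "y \<in> ball (chart_map c r) e" for y
    proof (rule has_derivative_zero_unique_connected[OF open_ball connected_ball _ y])
      show "(N has_derivative (\<lambda>v. 0)) (at z)" if "z \<in> ball (chart_map c r) e" for z
      proof -
        have z: "z \<in> chart_image c" using e that by auto
        have d: "N differentiable (at z)" using Ck_sq_norm[of "Suc 0"] z by auto
        have "frechet_derivative N (at z) = (\<lambda>v. 0)"
          by (rule ext) (simp add: frechet_derivative_eq_sum_partial[OF d] zero[OF c(1) z])
        then show ?thesis using differentiable_has_frechet[OF d] by simp
      qed
    qed (use e in simp)
    let ?W = "{s \<in> chart_dom c. chart_map c s \<in> ball (chart_map c r) e}"
    show ?thesis
    proof (intro exI[of _ ?W] conjI ballI)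
      show "openin M ?W" by (rule openin_chart_preimage[OF c(1) open_ball])
      show "r \<in> ?W" using c e by simp
      show "sq_norm_at s = sq_norm_at r" if "s \<in> ?W" for s
      proof -
        have s: "s \<in> chart_dom c" "chart_map c s \<in> ball (chart_map c r) e" using that by auto
        show ?thesis unfolding sq_norm_at_eq[OF c(1) s(1)] sq_norm_at_eq[OF c] by (rule const[OF s(2)])
      qed
    qed
  qed
  define E where "E = {r \<in> topspace M. sq_norm_at r = sq_norm_at p}"
  define F where "F = {r \<in> topspace M. sq_norm_at r \<noteq> sq_norm_at p}"
  have open_local: "openin M {r \<in> topspace M. P (sq_norm_at r)}" for P
  proof (subst openin_subopen, intro ballI)
    fix r assume r: "r \<in> {r \<in> topspace M. P (sq_norm_at r)}"
    then have "r \<in> topspace M" by simp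
    from local[OF this] obtain W where W: "openin M W" "r \<in> W" "\<forall>s\<in>W. sq_norm_at s = sq_norm_at r"
      by (elim exE conjE)
    have "W \<subseteq> {r \<in> topspace M. P (sq_norm_at r)}"
    proof
      fix s assume s: "s \<in> W"
      have eq: "sq_norm_at s = sq_norm_at r" by (rule bspec[OF W(3) s])
      have "s \<in> topspace M" using openin_subset[OF W(1)] s by (rule subsetD)
      then show "s \<in> {r \<in> topspace M. P (sq_norm_at r)}" using r eq by simp
    qed
    then show "\<exists>T. openin M T \<and> r \<in> T \<and> T \<subseteq> {r \<in> topspace M. P (sq_norm_at r)}"
      using W(1,2) by (intro exI[of _ W] conjI)
  qed
  have "openin M E" "openin M F"
    using open_local[of "\<lambda>v. v = sq_norm_at p"] open_local[of "\<lambda>v. v \<noteq> sq_norm_at p"]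
    by (simp_all add: E_def F_def)
  moreover have "E \<union> F = topspace M" "E \<inter> F = {}" by (auto simp: E_def F_def)
  moreover have "p \<in> E" using pq by (simp add: E_def)
  ultimately have "F = {}"
    using connected_space_eq[THEN iffD1, OF connected] by blast
  then have "q \<notin> F" by simp
  then show ?thesis using pq(2) unfolding F_def by simp
qed

end

theorem theorem1p1:
  fixes m lam :: real
    and M :: "'a topology"
    and A :: "('a, 'n::finite) chart set"
    and g :: "('a, 'n) chart \<Rightarrow> real^'n \<Rightarrow> real^'n^'n"
    and X :: "('a, 'n) chart \<Rightarrow> real^'n \<Rightarrow> real^'n"
  assumes "m \<noteq> 0" and "m \<noteq> -2"
    and "smooth_manifold M A" and "compact_space M" and "connected_space M"
    and "riemannian_metric A g"
    and "vector_field A X"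
    and "quasi_einstein m lam A g X"
  shows "constant_scalar_curvature A g \<longleftrightarrow> killing_field A g X"
proof -
  interpret vector_field_manifold M A g X
    by unfold_locales fact+
  have chart: "quasi_einstein_chart (chart_image c) (g c) (X c) m lam" if c: "c \<in> A" for c
  proof -
    interpret chart_vector_field "chart_image c" "g c" "X c" by (rule chart_vector_field[OF c])
    show ?thesis
      by unfold_locales (use assms c in \<open>auto simp: quasi_einstein_def\<close>)
  qed
  show ?thesis
  proof
    assume "constant_scalar_curvature A g"
    then obtain \<kappa> where const: "\<And>c x. c \<in> A \<Longrightarrow> x \<in> chart_image c \<Longrightarrow> scalar_curvature (g c) x = \<kappa>"
      unfolding constant_scalar_curvature_def by blast
    let ?Z = "\<lambda>c. flux (g c) (X c) m (\<kappa> - lam * CARD('n))"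
    \<comment> \<open>The squared norm of L with respect to g.\<close>
    let ?T = "\<lambda>c x. trace (matrix_inv (g c x) ** lie_deriv_metric (X c) (g c) x ** matrix_inv (g c x) ** lie_deriv_metric (X c) (g c) x)"
    have div: "divergence (g c) (?Z c) x = ?T c x / 4 + (divergence (g c) (X c) x)\<^sup>2 / 2"
      and T: "?T c x \<ge> 0" "?T c x = 0 \<Longrightarrow> lie_deriv_metric (X c) (g c) x = 0"
      if c: "c \<in> A" and x: "x \<in> chart_image c" for c x
    proof -
      interpret quasi_einstein_chart "chart_image c" "g c" "X c" m lam by (rule chart[OF c])
      show "divergence (g c) (?Z c) x = ?T c x / 4 + (divergence (g c) (X c) x)\<^sup>2 / 2"
        by (rule divergence_flux[OF const[OF c] x])
      show "?T c x \<ge> 0" by (rule lie_deriv_norm_nonneg[OF x])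
      show "lie_deriv_metric (X c) (g c) x = 0" if "?T c x = 0" by (rule lie_deriv_eq_0[OF x that])
    qed
    show "killing_field A g X"
      unfolding killing_field_def
    proof (intro ballI)
      fix c x assume c: "c \<in> A" and x: "x \<in> chart_image c"
      have "divergence (g c) (?Z c) x = 0"
        using flux_divergence_eq_0[OF \<open>compact_space M\<close> _ c x] div T(1) by simp
      \<comment> \<open>Both summands of the vanishing divergence are nonnegative.\<close>
      then have "?T c x = 0" using div[OF c x] T(1)[OF c x] by (simp add: add_nonneg_eq_0_iff)
      then show "lie_deriv_metric (X c) (g c) x = 0" by (rule T(2)[OF c x])
    qed
  next
    assume killing: "killing_field A g X"
    \<comment> \<open>L = 0 forces div X = 0, so the traced equation leaves R as an affine function
      of |X|^2.\<close>
    have scalar: "scalar_curvature (g c) x = lam * CARD('n) + sq_norm (g c) (X c) x / m"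
      and zero: "partial_deriv k (sq_norm (g c) (X c)) x = 0"
      if c: "c \<in> A" and x: "x \<in> chart_image c" for c x k
    proof -
      interpret quasi_einstein_chart "chart_image c" "g c" "X c" m lam by (rule chart[OF c])
      have L: "L y = 0" if "y \<in> chart_image c" for y
        using killing c that unfolding killing_field_def by blast
      show "partial_deriv k N x = 0" by (rule partial_sq_norm_killing[OF L x])
      have "divergence (g c) (X c) x = 0"
        using trace_H_lie_deriv[OF x] L[OF x] by (simp add: trace_def matrix_matrix_mult_def)
      then show "scalar_curvature (g c) x = lam * CARD('n) + N x / m"
        by (simp add: scalar_eq[OF x])
    qed
    show "constant_scalar_curvature A g"
    \<comment> \<open>The constant is read off at a base point; on an empty manifold every chart
      image is empty and any constant serves.\<close>
    proof (cases "topspace M = {}")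
      case True
      have "chart_image c = {}" if "c \<in> A" for c
        using True cover that by (auto simp: chart_image_def)
      then show ?thesis by (simp add: constant_scalar_curvature_def)
    next
      case False
      then obtain p where p: "p \<in> topspace M" by blast
      have "scalar_curvature (g c) x = lam * CARD('n) + sq_norm_at p / m"
        if c: "c \<in> A" and x: "x \<in> chart_image c" for c x
      proof -
        have "chart_inv c x \<in> topspace M" using cover chart_inv_in[OF c x] c by blast
        then have "sq_norm_at p = sq_norm_at (chart_inv c x)"
          by (intro sq_norm_at_constant[OF \<open>connected_space M\<close> _ p] zero)
        also have "\<dots> = sq_norm (g c) (X c) x"
          using sq_norm_at_eq[OF c chart_inv_in[OF c x]] c x by simp
        finally show ?thesis using scalar[OF c x] by simp
      qed
      then show ?thesis unfolding constant_scalar_curvature_def by blast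
    qed
  qed
qed

end
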